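(* Let $(Q,\mathbf r)$ be a $Y$-shaped quiver with dimension vector, and let $A_1,\dots,A_\rho$ be the associated matrices of variables and zeros. Then the maximal ($k_i\times k_i$) minors of the $A_i$, for all $i=1,\dots,\rho$, form a SAGBI basis of the quiver Plücker algebra $\mathrm{Pl}(Q,\mathbf r)$ with respect to the lexicographic monomial order induced by the ordering of the variables described in the context.
   Context: Quivers. $Q$ is a finite acyclic quiver with vertices $\{0,1,\dots,\rho\}$, arrow set $Q_1$, source and target maps $s,t$, unique source $0$, and the number $n_{ij}$ of arrows $i\to j$ is zero unless $i<j$. The dimension vector $\mathbf r=(r_0,\dots,r_\rho)$ consists of positive integers with $r_0=1$. Put $s_i=\sum_{a:\,t(a)=i}r_{s(a)}$, let $\tilde s_i$ be the number of paths from $0$ to $i$, and $k_i=\tilde s_i-r_i$. $Y$-shaped. $Q$ is $Y$-shaped if: vertex $1$ has at most two outgoing arrows; each vertex $i>1$ has at most one outgoing arrow; each vertex $i>0$ is the target of at most one arrow whose source is not $0$. Standing assumptions: for each $j>1$ there is a path from $1$ to $j$, and $r_i<s_i$ for $i\ge1$. For $i>1$ let $p(i)\ge 1$ be the unique nonzero vertex with an arrow to $i$. If vertex $1$ has two outgoing arrows $a_1,a_2$, let $S_j'$ ($j=1,2$) be the set of vertices $i>1$ such that the path from $1$ to $i$ contains $a_j$; otherwise $S_1'=\{2,\dots,\rho\}$, $S_2'=\emptyset$. Put $S_j=S_j'\cup\{1\}$. Matrices. One has $\tilde s_1=n_{01}$, and for $i>1$: $\tilde s_i=\tilde s_{p(i)}+n_{0i}$,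 $k_i=k_{p(i)}+(s_i-r_i)$. $A_1=(x^{(1)}_{jk})$ is a $k_1\times\tilde s_1$ matrix of independent variables. For $i>1$ let $X^{(i)}=(x^{(i)}_{jk})$ be an $(s_i-r_i)\times\tilde s_i$ matrix of new independent variables, and $$A_i=\begin{pmatrix}X^{(i)}\\ 0\;\;A_{p(i)}\end{pmatrix}\ (i\in S_1'),\qquad A_i=\begin{pmatrix}A_{p(i)}\;\;0\\ X^{(i)}\end{pmatrix}\ (i\in S_2'),$$ where $0$ is a $k_{p(i)}\times n_{0i}$ zero block. So $A_i$ has size $k_i\times\tilde s_i$. The quiver Plücker algebra $\mathrm{Pl}(Q,\mathbf r)$ is the $\mathbb C$-subalgebra of $\mathbb C[x^{(i)}_{jk}]$ generated by all $k_i\times k_i$ minors of all $A_i$. Variable order. Variables of $X^{(i)}$, $i\in S_1'$, are larger than those of $A_1$, which are larger than those of $X^{(j)}$, $j\in S_2'$. For $i<j$ in $S_1'$, the variables of $X^{(j)}$ are larger than those of $X^{(i)}$; for $i<j$ in $S_2'$, the variables of $X^{(i)}$ are larger than those of $X^{(j)}$. Within a fixed $i$, $x^{(i)}_{jk}>x^{(i)}_{j'k'}$ if $j<j'$, or $j=j'$ and $k<k'$. The monomial order is the induced lexicographic order. A finite subset $F$ of a subalgebra $A$ of a polynomial ring is a SAGBI basis of $A$ if for every nonzero $f\in A$ the initial monomial of $f$ is a product of initial monomials of (nonzero) elements of $F$. *)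

theory Defs
  imports
    Complex_Main
    "HOL.Hull"
    "HOL-Library.Poly_Mapping"
    "Graph_Theory.Arc_Walk"
    "Jordan_Normal_Form.Determinant"
    "Jordan_Normal_Form.DL_Submatrix"
begin

section \<open>Quivers with dimension vector\<close>

definition num_arrows :: "('v, 'a) pre_digraph \<Rightarrow> 'v \<Rightarrow> 'v \<Rightarrow> nat" where
  "num_arrows Q i j = card {a \<in> arcs Q. tail Q a = i \<and> head Q a = j}"

text \<open>The numbers \<open>s\<^sub>i\<close>, \<open>s~\<^sub>i\<close> and \<open>k\<^sub>i\<close>. Paths are arrow sequences, so parallel arrows give
  different paths.\<close>

definition in_rank :: "(nat, 'a) pre_digraph \<Rightarrow> (nat \<Rightarrow> nat) \<Rightarrow> nat \<Rightarrow> nat" where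
  "in_rank Q r i = (\<Sum>a\<in>in_arcs Q i. r (tail Q a))"

definition num_paths :: "(nat, 'a) pre_digraph \<Rightarrow> nat \<Rightarrow> nat" where
  "num_paths Q i = card {p. pre_digraph.awalk Q 0 p i}"

text \<open>Under the standing assumptions \<open>r i < num_paths Q i\<close> for \<open>i \<ge> 1\<close>, so the natural-number
  subtraction is exact.\<close>

definition corank :: "(nat, 'a) pre_digraph \<Rightarrow> (nat \<Rightarrow> nat) \<Rightarrow> nat \<Rightarrow> nat" where
  "corank Q r i = num_paths Q i - r i"

text \<open>Acyclicity is not listed separately: it follows from every arrow going from a smaller to a
  larger vertex.\<close>

definition quiver_with_dims :: "(nat, 'a) pre_digraph \<Rightarrow> nat \<Rightarrow> (nat \<Rightarrow> nat) \<Rightarrow> bool" where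
  "quiver_with_dims Q \<rho> r \<longleftrightarrow>
     fin_digraph Q \<and> verts Q = {0..\<rho>} \<and>
     {i \<in> verts Q. in_arcs Q i = {}} = {0} \<and>
     (\<forall>i j. num_arrows Q i j \<noteq> 0 \<longrightarrow> i < j) \<and>
     r 0 = 1 \<and> (\<forall>i\<in>verts Q. r i > 0)"

text \<open>The last two conjuncts are the standing assumptions on \<open>Y\<close>-shaped quivers: there is a path from
  \<open>1\<close> to every \<open>j > 1\<close>, and \<open>r\<^sub>i < s\<^sub>i\<close> for \<open>i \<ge> 1\<close>.\<close>

definition Y_shaped :: "(nat, 'a) pre_digraph \<Rightarrow> nat \<Rightarrow> (nat \<Rightarrow> nat) \<Rightarrow> bool" where
  "Y_shaped Q \<rho> r \<longleftrightarrow>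
     quiver_with_dims Q \<rho> r \<and>
     out_degree Q 1 \<le> 2 \<and>
     (\<forall>i\<in>{1<..\<rho>}. out_degree Q i \<le> 1) \<and>
     (\<forall>i\<in>{1..\<rho>}. card {a \<in> in_arcs Q i. tail Q a \<noteq> 0} \<le> 1) \<and>
     (\<forall>j\<in>{1<..\<rho>}. \<exists>p. pre_digraph.awalk Q 1 p j) \<and>
     (\<forall>i\<in>{1..\<rho>}. r i < in_rank Q r i)"

definition parent :: "(nat, 'a) pre_digraph \<Rightarrow> nat \<Rightarrow> nat" where
  "parent Q i = (THE v. v \<noteq> 0 \<and> (\<exists>a\<in>arcs Q. tail Q a = v \<and> head Q a = i))"

definition vertices_through :: "(nat, 'a) pre_digraph \<Rightarrow> 'a \<Rightarrow> nat set" where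
  "vertices_through Q a = {i \<in> verts Q. i > 1 \<and> (\<exists>p. pre_digraph.awalk Q 1 p i \<and> a \<in> set p)}"

text \<open>\<open>S1\<close> and \<open>S2\<close> are the sets \<open>S\<^sub>1'\<close> and \<open>S\<^sub>2'\<close> (without the vertex \<open>1\<close>).  This is a relation since
  the numbering of the two arrows \<open>a1, a2\<close> out of vertex \<open>1\<close> is a free choice.\<close>

definition branches ::
  "(nat, 'a) pre_digraph \<Rightarrow> nat \<Rightarrow> nat set \<Rightarrow> nat set \<Rightarrow> bool" where
  "branches Q \<rho> S1 S2 \<longleftrightarrow>
     (if out_degree Q 1 = 2
      then \<exists>a1 a2. a1 \<noteq> a2 \<and> out_arcs Q 1 = {a1, a2} \<and>
             S1 = vertices_through Q a1 \<and> S2 = vertices_through Q a2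
      else S1 = {2..\<rho>} \<and> S2 = {})"


section \<open>Polynomials, lexicographic order, SAGBI bases\<close>

text \<open>Monomials are exponent vectors; polynomials are finitely supported complex-valued functions
  on monomials, multiplied by convolution.\<close>

type_synonym 'x monomial = "'x \<Rightarrow>\<^sub>0 nat"
type_synonym 'x cpoly = "'x monomial \<Rightarrow>\<^sub>0 complex"

definition poly_const :: "complex \<Rightarrow> 'x cpoly" where
  "poly_const c = Poly_Mapping.single 0 c"

definition poly_var :: "'x \<Rightarrow> 'x cpoly" where
  "poly_var x = Poly_Mapping.single (Poly_Mapping.single x 1) 1"

definition is_subalgebra :: "'x cpoly set \<Rightarrow> bool" where
  "is_subalgebra A \<longleftrightarrow>
     range poly_const \<subseteq> A \<and> (\<forall>f\<in>A. \<forall>g\<in>A. f + g \<in> A) \<and> (\<forall>f\<in>A. \<forall>g\<in>A. f * g \<in> A)"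

text \<open>\<open>gt x y\<close> means that the variable \<open>x\<close> is larger than \<open>y\<close>.\<close>

definition lex_greater :: "('x \<Rightarrow> 'x \<Rightarrow> bool) \<Rightarrow> 'x monomial \<Rightarrow> 'x monomial \<Rightarrow> bool" where
  "lex_greater gt m m' \<longleftrightarrow>
     (\<exists>x. Poly_Mapping.lookup m x > Poly_Mapping.lookup m' x \<and>
          (\<forall>y. gt y x \<longrightarrow> Poly_Mapping.lookup m y = Poly_Mapping.lookup m' y))"

text \<open>The initial monomial of a nonzero polynomial, as a polynomial with coefficient \<open>1\<close>.\<close>

definition initial_monomial ::
  "('x monomial \<Rightarrow> 'x monomial \<Rightarrow> bool) \<Rightarrow> 'x cpoly \<Rightarrow> 'x cpoly" where
  "initial_monomial mgt f =
     Poly_Mapping.single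
       (THE m. m \<in> Poly_Mapping.keys f \<and> (\<forall>m'\<in>Poly_Mapping.keys f. m' \<noteq> m \<longrightarrow> mgt m m')) 1"

definition is_SAGBI_basis ::
  "('x monomial \<Rightarrow> 'x monomial \<Rightarrow> bool) \<Rightarrow> 'x cpoly set \<Rightarrow> 'x cpoly set \<Rightarrow> bool" where
  "is_SAGBI_basis mgt A F \<longleftrightarrow>
     is_subalgebra A \<and> finite F \<and> F \<subseteq> A \<and>
     (\<forall>f\<in>A. f \<noteq> 0 \<longrightarrow>
        (\<exists>gs. set gs \<subseteq> F - {0} \<and>
              initial_monomial mgt f = prod_list (map (initial_monomial mgt) gs)))"


section \<open>The matrices and the quiver Pluecker algebra\<close>

text \<open>The triple \<open>(i, j, k)\<close> stands for the variable in row \<open>j\<close> and column \<open>k\<close> of the \<open>i\<close>-th block of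
  variables, where rows and columns are counted from \<open>0\<close>.  The type contains more triples than
  there are variables; the order is only relevant on those that occur in the matrices.\<close>

type_synonym qvar = "nat \<times> nat \<times> nat"

definition var_mat :: "nat \<Rightarrow> nat \<Rightarrow> nat \<Rightarrow> qvar cpoly mat" where
  "var_mat i nr nc = mat nr nc (\<lambda>(j, k). poly_var (i, j, k))"

definition append_cols :: "'b :: zero mat \<Rightarrow> 'b mat \<Rightarrow> 'b mat" where
  "append_cols A B = four_block_mat A B (0\<^sub>m 0 (dim_col A)) (0\<^sub>m 0 (dim_col B))"

text \<open>The test \<open>parent Q i < i\<close> only serves termination; it always succeeds for a vertex \<open>i > 1\<close> of a
  \<open>Y\<close>-shaped quiver.\<close>

fun quiver_matrix ::
  "(nat, 'a) pre_digraph \<Rightarrow> (nat \<Rightarrow> nat) \<Rightarrow> nat set \<Rightarrow> nat \<Rightarrow> qvar cpoly mat" where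
  "quiver_matrix Q r S1 i =
     (if i > 1 \<and> parent Q i < i then
        let p = parent Q i;
            Z = 0\<^sub>m (corank Q r p) (num_arrows Q 0 i);
            X = var_mat i (in_rank Q r i - r i) (num_paths Q i)
        in if i \<in> S1
           then X @\<^sub>r append_cols Z (quiver_matrix Q r S1 p)
           else append_cols (quiver_matrix Q r S1 p) Z @\<^sub>r X
      else var_mat i (corank Q r i) (num_paths Q i))"

declare quiver_matrix.simps [simp del]

definition minors :: "nat \<Rightarrow> 'b :: comm_ring_1 mat \<Rightarrow> 'b set" where
  "minors n A = {det (submatrix A I J) | I J.
     I \<subseteq> {..<dim_row A} \<and> J \<subseteq> {..<dim_col A} \<and> card I = n \<and> card J = n}"

definition quiver_minors ::
  "(nat, 'a) pre_digraph \<Rightarrow> nat \<Rightarrow> (nat \<Rightarrow> nat) \<Rightarrow> nat set \<Rightarrow> qvar cpoly set" where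
  "quiver_minors Q \<rho> r S1 = (\<Union>i\<in>{1..\<rho>}. minors (corank Q r i) (quiver_matrix Q r S1 i))"

definition quiver_Pluecker_algebra ::
  "(nat, 'a) pre_digraph \<Rightarrow> nat \<Rightarrow> (nat \<Rightarrow> nat) \<Rightarrow> nat set \<Rightarrow> qvar cpoly set" where
  "quiver_Pluecker_algebra Q \<rho> r S1 = is_subalgebra hull quiver_minors Q \<rho> r S1"

definition block_greater :: "nat set \<Rightarrow> nat set \<Rightarrow> nat \<Rightarrow> nat \<Rightarrow> bool" where
  "block_greater S1 S2 i i' \<longleftrightarrow>
     i \<in> S1 \<and> i' = 1 \<or> i = 1 \<and> i' \<in> S2 \<or> i \<in> S1 \<and> i' \<in> S2 \<or>
     i \<in> S1 \<and> i' \<in> S1 \<and> i > i' \<or> i \<in> S2 \<and> i' \<in> S2 \<and> i < i'"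

definition var_greater :: "nat set \<Rightarrow> nat set \<Rightarrow> qvar \<Rightarrow> qvar \<Rightarrow> bool" where
  "var_greater S1 S2 = (\<lambda>(i, j, k) (i', j', k').
     block_greater S1 S2 i i' \<or> i = i' \<and> (j < j' \<or> j = j' \<and> k < k'))"

end

(* All matrices A_i are submatrices of one staircase-shaped matrix of variables, in which they occupy
   intervals of rows. These intervals form a chain (of two of them, one has both ends at least as low
   as the other) and all contain the first row of A_1. The lexicographic order reads the big matrix
   row by row, so the initial monomial of a nonzero maximal minor is its diagonal. A product of minors
   is a tableau whose columns are the minors, ordered from the lowest row interval to the highest; it
   is standard if its rows increase weakly. By the exchange relation, obtained by antisymmetrising over
   one column more than there are rows, the standard products span the algebra. A standard tableau can
   be read off from its initial monomial, because each of its rows is the sorted list of the column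
   indices that occur in this row of the monomial. So distinct standard products have distinct initial
   monomials, which therefore do not cancel in a linear combination. *)
theory Submission
  imports Defs
begin

text \<open>The zeros in the matrices are the obstacle. They do not affect the exchange relation,
  which is an identity for an arbitrary matrix over a commutative ring. Where they matter is in
  deciding which minors vanish, and the staircase shape settles this: a zero on the diagonal of a
  minor kills every term of its expansion. Two overlapping intervals of the chain have as union an
  interval that takes one end from each of them; this is why the antisymmetrised columns are one too
  many for the available rows. The permutations that do not mix the columns of the two minors all
  return the original product, so it occurs with a positive integer coefficient, which is invertible
  over the complex numbers. All other terms move smaller column indices to the earlier factor, and a
  position-weighted sum over the entries turns this into a descent. The row common to all intervals
  fixes the number of factors of a tableau; this is what allows its columns to be recovered from its
  rows, one after the other.\<close>

section \<open>Minors of row intervals and the exchange relation\<close>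

text \<open>Leibniz expansion with rows and columns both indexed by \<open>{u..<w}\<close>, so that
  minors with different row intervals can exchange columns without renumbering. \<open>c\<close> may
  be unsorted or repeat a value, because exchanges produce such columns.\<close>

definition interval_minor :: "(nat \<Rightarrow> nat \<Rightarrow> 'r::comm_ring_1) \<Rightarrow> nat \<Rightarrow> nat \<Rightarrow> (nat \<Rightarrow> nat) \<Rightarrow> 'r" where
  "interval_minor M u w c =
     (\<Sum>\<pi> | \<pi> permutes {u..<w}. of_int (sign \<pi>) * (\<Prod>t\<in>{u..<w}. M (\<pi> t) (c t)))"

lemma interval_minor_cong:
  assumes "\<And>t. u \<le> t \<Longrightarrow> t < w \<Longrightarrow> c t = c' t"
  shows "interval_minor M u w c = interval_minor M u w c'"
  unfolding interval_minor_def by (intro sum.cong refl arg_cong2[where f="(*)"] prod.cong) (use assms in auto)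

text \<open>Composition with the transposition matches odd with even permutations, and matched terms
  cancel. Pairing the terms, instead of deriving \<open>x = - x\<close>, keeps the argument valid in
  characteristic 2.\<close>

lemma alternating_sum_eq_0:
  fixes F :: "('n \<Rightarrow> 'n) \<Rightarrow> 'r::comm_ring_1"
  assumes "finite S" "a \<in> S" "b \<in> S" "a \<noteq> b"
    and F: "\<And>\<sigma>. \<sigma> permutes S \<Longrightarrow> F (\<sigma> \<circ> transpose a b) = F \<sigma>"
  shows "(\<Sum>\<sigma> | \<sigma> permutes S. of_int (sign \<sigma>) * F \<sigma>) = 0"
proof -
  let ?\<tau> = "transpose a b"
  let ?E = "{\<sigma>. \<sigma> permutes S \<and> evenperm \<sigma>}" and ?O = "{\<sigma>. \<sigma> permutes S \<and> \<not> evenperm \<sigma>}"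
  have \<tau>: "?\<tau> permutes S" using assms by (simp add: permutes_swap_id)
  have perm: "permutation \<sigma>" if "\<sigma> permutes S" for \<sigma>
    using that assms(1) permutation_permutes by blast
  have ev: "evenperm (\<sigma> \<circ> ?\<tau>) \<longleftrightarrow> \<not> evenperm \<sigma>" if "\<sigma> permutes S" for \<sigma>
    using evenperm_comp[OF perm[OF that] perm[OF \<tau>]] assms(4) by (simp add: evenperm_swap)
  have pc: "\<sigma> \<circ> ?\<tau> permutes S" if "\<sigma> permutes S" for \<sigma>
    using that \<tau> permutes_compose by blast
  have "(\<Sum>\<sigma>\<in>?O. of_int (sign \<sigma>) * F \<sigma>) = (\<Sum>\<sigma>\<in>?E. - (of_int (sign \<sigma>) * F \<sigma>))"
    by (rule sum.reindex_bij_witness[where i="\<lambda>\<sigma>. \<sigma> \<circ> ?\<tau>" and j="\<lambda>\<sigma>. \<sigma> \<circ> ?\<tau>"])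
      (auto simp: ev pc F comp_assoc sign_def)
  moreover have "(\<Sum>\<sigma> | \<sigma> permutes S. of_int (sign \<sigma>) * F \<sigma>) =
      (\<Sum>\<sigma>\<in>?E. of_int (sign \<sigma>) * F \<sigma>) + (\<Sum>\<sigma>\<in>?O. of_int (sign \<sigma>) * F \<sigma>)"
    using finite_permutations[OF assms(1)] by (subst sum.union_disjoint[symmetric]) (auto intro: sum.cong)
  ultimately show ?thesis by (simp add: sum_negf)
qed

lemma interval_minor_permute_cols:
  assumes \<tau>: "\<tau> permutes {u..<w}"
  shows "interval_minor M u w (c \<circ> \<tau>) = of_int (sign \<tau>) * interval_minor M u w c"
proof -
  have "interval_minor M u w (c \<circ> \<tau>) =
      (\<Sum>\<pi> | \<pi> permutes {u..<w}. of_int (sign (\<pi> \<circ> \<tau>)) * (\<Prod>t\<in>{u..<w}. M ((\<pi> \<circ> \<tau>) t) ((c \<circ> \<tau>) t)))"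
    unfolding interval_minor_def by (rule sum_permutations_compose_right[OF \<tau>])
  also have "\<dots> = (\<Sum>\<pi> | \<pi> permutes {u..<w}. of_int (sign \<tau>) * (of_int (sign \<pi>) * (\<Prod>t\<in>{u..<w}. M (\<pi> t) (c t))))"
  proof (rule sum.cong[OF refl])
    fix \<pi> assume "\<pi> \<in> {\<pi>. \<pi> permutes {u..<w}}"
    then have p: "permutation \<pi>" "permutation \<tau>" using \<tau> permutation_permutes by blast+
    have "(\<Prod>t\<in>{u..<w}. M (\<pi> t) (c t)) = (\<Prod>t\<in>{u..<w}. M ((\<pi> \<circ> \<tau>) t) ((c \<circ> \<tau>) t))"
      using prod.permute[OF \<tau>, of "\<lambda>t. M (\<pi> t) (c t)"] by (simp add: o_def)
    then show "of_int (sign (\<pi> \<circ> \<tau>)) * (\<Prod>t\<in>{u..<w}. M ((\<pi> \<circ> \<tau>) t) ((c \<circ> \<tau>) t))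
      = of_int (sign \<tau>) * (of_int (sign \<pi>) * (\<Prod>t\<in>{u..<w}. M (\<pi> t) (c t)))"
      by (simp add: sign_compose p)
  qed
  finally show ?thesis unfolding interval_minor_def by (simp add: sum_distrib_left)
qed

lemma interval_minor_repeated_col:
  assumes "\<not> inj_on c {u..<w}"
  shows "interval_minor M u w c = 0"
proof -
  obtain a b where ab: "a \<in> {u..<w}" "b \<in> {u..<w}" "a \<noteq> b" "c a = c b"
    using assms unfolding inj_on_def by blast
  have \<tau>: "transpose a b permutes {u..<w}" using ab by (simp add: permutes_swap_id)
  have c: "c (transpose a b t) = c t" for t using ab by (auto simp: transpose_def)
  show ?thesis unfolding interval_minor_def
  proof (rule alternating_sum_eq_0[OF _ ab(1-3)])
    fix \<sigma>
    show "(\<Prod>t\<in>{u..<w}. M ((\<sigma> \<circ> transpose a b) t) (c t)) = (\<Prod>t\<in>{u..<w}. M (\<sigma> t) (c t))"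
      using prod.permute[OF \<tau>, of "\<lambda>t. M (\<sigma> t) (c t)"] by (simp add: c o_def)
  qed simp
qed

lemma interval_minor_sort_cols:
  fixes c :: "nat \<Rightarrow> nat"
  assumes "inj_on c {u..<w}"
  obtains \<tau> where "\<tau> permutes {u..<w}" "strict_mono_on {u..<w} (c \<circ> \<tau>)"
proof -
  let ?S = "{u..<w}"
  define L where "L = sorted_list_of_set (c ` ?S)"
  define f where "f t = L ! (t - u)" for t
  have len: "length L = w - u" using assms by (simp add: L_def card_image)
  have sL: "sorted_wrt (<) L" unfolding L_def by (rule strict_sorted_list_of_set)
  have setL: "set L = c ` ?S" by (simp add: L_def)
  have f: "f ` ?S = c ` ?S"
  proof -
    have "f ` ?S = (\<lambda>i. L ! i) ` {0..<w-u}"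
    proof -
      have S: "?S = (\<lambda>i. i + u) ` {0..<w-u}" by (cases "u \<le> w") auto
      show ?thesis unfolding f_def S image_image by (rule image_cong) auto
    qed
    also have "\<dots> = set L" using len by (auto simp: set_conv_nth)
    finally show ?thesis by (simp add: setL)
  qed
  have sm: "strict_mono_on ?S f"
  proof (rule strict_mono_onI)
    fix a b assume "a \<in> ?S" "b \<in> ?S" "a < b"
    then show "f a < f b" unfolding f_def
      by (intro sorted_wrt_nth_less[OF sL]) (auto simp: len)
  qed
  \<comment> \<open>\<open>f\<close> lists the values of \<open>c\<close> in increasing order, so
    row \<open>t\<close> is sent to the place where \<open>c\<close> takes its value of rank
    \<open>t - u\<close>.\<close>
  define \<tau> where "\<tau> t = (if t \<in> ?S then inv_into ?S c (f t) else t)" for t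
  have ct: "c (\<tau> t) = f t" if "t \<in> ?S" for t
  proof -
    have "f t \<in> c ` ?S" using that f by blast
    then show ?thesis using that by (simp add: \<tau>_def f_inv_into_f)
  qed
  have sm': "strict_mono_on ?S (c \<circ> \<tau>)"
    using sm ct by (auto simp: strict_mono_on_def)
  have "\<tau> permutes ?S"
  proof (rule bij_imp_permutes)
    have "\<tau> ` ?S \<subseteq> ?S"
    proof
      fix y assume "y \<in> \<tau> ` ?S"
      then obtain t where t: "t \<in> ?S" "y = \<tau> t" by auto
      then have "f t \<in> c ` ?S" using f by blast
      then show "y \<in> ?S" using t inv_into_into[of "f t" c ?S] by (simp add: \<tau>_def)
    qed
    moreover have "inj_on \<tau> ?S"
      using strict_mono_on_imp_inj_on[OF sm'] inj_on_imageI2 by blast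
    ultimately show "bij_betw \<tau> ?S ?S"
      by (simp add: bij_betw_def endo_inj_surj)
  qed (auto simp: \<tau>_def)
  then show thesis using that sm' by blast
qed

text \<open>The merged sequence of columns that is antisymmetrised, at the positions
  \<open>{u'..<Suc w}\<close>: \<open>c'\<close> in the rows up to \<open>r\<close>, followed by
  \<open>c\<close> in the rows from \<open>r\<close> on, shifted by one. Row \<open>r\<close> thus
  feeds the two positions \<open>r\<close> and \<open>r + 1\<close>, which accounts for the column
  in excess.\<close>

definition exch_col :: "nat \<Rightarrow> (nat \<Rightarrow> nat) \<Rightarrow> (nat \<Rightarrow> nat) \<Rightarrow> nat \<Rightarrow> nat" where
  "exch_col r c c' q = (if q \<le> r then c' q else c (q - 1))"

text \<open>\<open>Suc t\<close> undoes the shift in \<open>exch_col\<close>, so that the identity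
  permutation gives back \<open>c\<close>. The rows before \<open>r\<close> do not take part in the
  exchange.\<close>

definition exch_fst :: "nat \<Rightarrow> (nat \<Rightarrow> nat) \<Rightarrow> (nat \<Rightarrow> nat) \<Rightarrow> (nat \<Rightarrow> nat) \<Rightarrow> nat \<Rightarrow> nat" where
  "exch_fst r c c' \<sigma> t = (if r \<le> t then exch_col r c c' (\<sigma> (Suc t)) else c t)"

definition exch_snd :: "nat \<Rightarrow> (nat \<Rightarrow> nat) \<Rightarrow> (nat \<Rightarrow> nat) \<Rightarrow> (nat \<Rightarrow> nat) \<Rightarrow> nat \<Rightarrow> nat" where
  "exch_snd r c c' \<sigma> t = (if t \<le> r then exch_col r c c' (\<sigma> t) else c' t)"

lemma sum_exch_fst:
  fixes c :: "nat \<Rightarrow> nat"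
  assumes "u \<le> r" "r < w"
  shows "(\<Sum>t\<in>{u..<w}. exch_fst r c c' \<sigma> t) = sum c {u..<r} + (\<Sum>q\<in>{Suc r..<Suc w}. exch_col r c c' (\<sigma> q))"
proof -
  have "(\<Sum>t\<in>{u..<w}. exch_fst r c c' \<sigma> t) = (\<Sum>t\<in>{u..<r}. exch_fst r c c' \<sigma> t) + (\<Sum>t\<in>{r..<w}. exch_fst r c c' \<sigma> t)"
    using assms by (intro sum.atLeastLessThan_concat[symmetric]) auto
  also have "(\<Sum>t\<in>{u..<r}. exch_fst r c c' \<sigma> t) = sum c {u..<r}"
    by (rule sum.cong) (auto simp: exch_fst_def)
  also have "(\<Sum>t\<in>{r..<w}. exch_fst r c c' \<sigma> t) = (\<Sum>t\<in>{r..<w}. exch_col r c c' (\<sigma> (Suc t)))"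
    by (rule sum.cong) (auto simp: exch_fst_def)
  also have "\<dots> = (\<Sum>q\<in>{Suc r..<Suc w}. exch_col r c c' (\<sigma> q))"
    by (simp only: sum.shift_bounds_Suc_ivl)
  finally show ?thesis .
qed

lemma sum_exch_snd:
  fixes c :: "nat \<Rightarrow> nat"
  assumes "u' \<le> r" "r < w'"
  shows "(\<Sum>t\<in>{u'..<w'}. exch_snd r c c' \<sigma> t) = (\<Sum>q\<in>{u'..<Suc r}. exch_col r c c' (\<sigma> q)) + sum c' {Suc r..<w'}"
proof -
  have "(\<Sum>t\<in>{u'..<w'}. exch_snd r c c' \<sigma> t) = (\<Sum>t\<in>{u'..<Suc r}. exch_snd r c c' \<sigma> t) + (\<Sum>t\<in>{Suc r..<w'}. exch_snd r c c' \<sigma> t)"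
    using assms by (intro sum.atLeastLessThan_concat[symmetric]) auto
  also have "(\<Sum>t\<in>{u'..<Suc r}. exch_snd r c c' \<sigma> t) = (\<Sum>t\<in>{u'..<Suc r}. exch_col r c c' (\<sigma> t))"
    by (rule sum.cong) (auto simp: exch_snd_def)
  also have "(\<Sum>t\<in>{Suc r..<w'}. exch_snd r c c' \<sigma> t) = sum c' {Suc r..<w'}"
    by (rule sum.cong) (auto simp: exch_snd_def)
  finally show ?thesis .
qed

lemma prod_exch_fst:
  fixes M :: "nat \<Rightarrow> nat \<Rightarrow> 'r::comm_ring_1"
  assumes "u \<le> r" "r < w"
  shows "(\<Prod>t\<in>{u..<w}. M (\<pi> t) (exch_fst r c c' \<sigma> t)) =
    (\<Prod>t\<in>{u..<r}. M (\<pi> t) (c t)) * (\<Prod>q\<in>{Suc r..<Suc w}. M (\<pi> (q - 1)) (exch_col r c c' (\<sigma> q)))"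
proof -
  have "(\<Prod>t\<in>{u..<w}. M (\<pi> t) (exch_fst r c c' \<sigma> t)) =
      (\<Prod>t\<in>{u..<r}. M (\<pi> t) (exch_fst r c c' \<sigma> t)) * (\<Prod>t\<in>{r..<w}. M (\<pi> t) (exch_fst r c c' \<sigma> t))"
    using assms by (intro prod.atLeastLessThan_concat[symmetric]) auto
  also have "(\<Prod>t\<in>{u..<r}. M (\<pi> t) (exch_fst r c c' \<sigma> t)) = (\<Prod>t\<in>{u..<r}. M (\<pi> t) (c t))"
    by (rule prod.cong) (auto simp: exch_fst_def)
  also have "(\<Prod>t\<in>{r..<w}. M (\<pi> t) (exch_fst r c c' \<sigma> t)) =
      (\<Prod>t\<in>{r..<w}. M (\<pi> (Suc t - 1)) (exch_col r c c' (\<sigma> (Suc t))))"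
    by (rule prod.cong) (auto simp: exch_fst_def)
  also have "\<dots> = (\<Prod>q\<in>{Suc r..<Suc w}. M (\<pi> (q - 1)) (exch_col r c c' (\<sigma> q)))"
    by (simp only: prod.shift_bounds_Suc_ivl)
  finally show ?thesis .
qed

lemma prod_exch_snd:
  fixes M :: "nat \<Rightarrow> nat \<Rightarrow> 'r::comm_ring_1"
  assumes "u' \<le> r" "r < w'"
  shows "(\<Prod>t\<in>{u'..<w'}. M (\<pi> t) (exch_snd r c c' \<sigma> t)) =
    (\<Prod>q\<in>{u'..<Suc r}. M (\<pi> q) (exch_col r c c' (\<sigma> q))) * (\<Prod>t\<in>{Suc r..<w'}. M (\<pi> t) (c' t))"
proof -
  have "(\<Prod>t\<in>{u'..<w'}. M (\<pi> t) (exch_snd r c c' \<sigma> t)) =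
      (\<Prod>t\<in>{u'..<Suc r}. M (\<pi> t) (exch_snd r c c' \<sigma> t)) * (\<Prod>t\<in>{Suc r..<w'}. M (\<pi> t) (exch_snd r c c' \<sigma> t))"
    using assms by (intro prod.atLeastLessThan_concat[symmetric]) auto
  also have "(\<Prod>t\<in>{u'..<Suc r}. M (\<pi> t) (exch_snd r c c' \<sigma> t)) = (\<Prod>t\<in>{u'..<Suc r}. M (\<pi> t) (exch_col r c c' (\<sigma> t)))"
    by (rule prod.cong) (auto simp: exch_snd_def)
  also have "(\<Prod>t\<in>{Suc r..<w'}. M (\<pi> t) (exch_snd r c c' \<sigma> t)) = (\<Prod>t\<in>{Suc r..<w'}. M (\<pi> t) (c' t))"
    by (rule prod.cong) (auto simp: exch_snd_def)
  finally show ?thesis .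
qed

text \<open>The antisymmetrisation runs over one column more than there are rows in \<open>{u'..<w}\<close>.\<close>

lemma exchange_relation:
  fixes M :: "nat \<Rightarrow> nat \<Rightarrow> 'r::comm_ring_1"
  assumes "u' \<le> u" "u \<le> r" "r < w'" "w' \<le> w"
  shows "(\<Sum>\<sigma> | \<sigma> permutes {u'..<Suc w}. of_int (sign \<sigma>) *
    (interval_minor M u w (exch_fst r c c' \<sigma>) * interval_minor M u' w' (exch_snd r c c' \<sigma>))) = 0"
proof -
  let ?S = "{u'..<Suc w}" and ?P = "{\<sigma>. \<sigma> permutes {u'..<Suc w}}"
  let ?A = "{\<pi>. \<pi> permutes {u..<w}}" and ?B = "{\<pi>. \<pi> permutes {u'..<w'}}"
  define F where "F \<pi> \<pi>' \<sigma> = (\<Prod>t\<in>{u..<w}. M (\<pi> t) (exch_fst r c c' \<sigma> t)) *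
      (\<Prod>t\<in>{u'..<w'}. M (\<pi>' t) (exch_snd r c c' \<sigma> t))" for \<pi> \<pi>' \<sigma>
  have z: "(\<Sum>\<sigma>\<in>?P. of_int (sign \<sigma>) * F \<pi> \<pi>' \<sigma>) = 0" if \<pi>: "\<pi> permutes {u..<w}" "\<pi>' permutes {u'..<w'}" for \<pi> \<pi>'
  proof -
    \<comment> \<open>For fixed row permutations, \<open>y q\<close> is the row in which the column
      at position \<open>q\<close> is expanded. These rows lie in \<open>{u'..<w}\<close>, which has
      one element fewer than the positions, so two positions share a row and transposing them leaves
      the product of entries unchanged.\<close>
    define y where "y q = (if q \<le> r then \<pi>' q else \<pi> (q - 1))" for q
    have "y ` ?S \<subseteq> {u'..<w}"
    proof
      fix z assume "z \<in> y ` ?S"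
      then obtain q where q: "q \<in> ?S" "z = y q" by auto
      show "z \<in> {u'..<w}"
      proof (cases "q \<le> r")
        case True
        then have "q \<in> {u'..<w'}" using q assms by auto
        then have "\<pi>' q \<in> {u'..<w'}" using permutes_in_image[OF \<pi>(2)] by blast
        then show ?thesis using True q assms by (auto simp: y_def)
      next
        case False
        then have "q - 1 \<in> {u..<w}" using q assms by auto
        then have "\<pi> (q - 1) \<in> {u..<w}" using permutes_in_image[OF \<pi>(1)] by blast
        then show ?thesis using False q assms by (auto simp: y_def)
      qed
    qed
    then have "card (y ` ?S) \<le> card {u'..<w}" by (intro card_mono) auto
    then have "\<not> inj_on y ?S" using assms by (intro notI) (simp add: card_image)
    then obtain a b where ab: "a \<in> ?S" "b \<in> ?S" "a \<noteq> b" "y a = y b" unfolding inj_on_def by blast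
    let ?\<tau> = "transpose a b"
    have \<tau>: "?\<tau> permutes ?S" using ab by (intro permutes_swap_id)
    have y\<tau>: "y (?\<tau> q) = y q" for q using ab by (auto simp: transpose_def)
    let ?x = "exch_col r c c'"
    have FF: "F \<pi> \<pi>' \<sigma> = (\<Prod>t\<in>{u..<r}. M (\<pi> t) (c t)) * (\<Prod>t\<in>{Suc r..<w'}. M (\<pi>' t) (c' t)) *
        (\<Prod>q\<in>?S. M (y q) (?x (\<sigma> q)))" for \<sigma>
    proof -
      have "(\<Prod>q\<in>?S. M (y q) (?x (\<sigma> q))) =
          (\<Prod>q\<in>{u'..<Suc r}. M (y q) (?x (\<sigma> q))) * (\<Prod>q\<in>{Suc r..<Suc w}. M (y q) (?x (\<sigma> q)))"
        using assms by (intro prod.atLeastLessThan_concat[symmetric]) auto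
      also have "(\<Prod>q\<in>{u'..<Suc r}. M (y q) (?x (\<sigma> q))) = (\<Prod>q\<in>{u'..<Suc r}. M (\<pi>' q) (?x (\<sigma> q)))"
        by (rule prod.cong) (auto simp: y_def)
      also have "(\<Prod>q\<in>{Suc r..<Suc w}. M (y q) (?x (\<sigma> q))) = (\<Prod>q\<in>{Suc r..<Suc w}. M (\<pi> (q - 1)) (?x (\<sigma> q)))"
        by (rule prod.cong) (auto simp: y_def)
      finally show ?thesis unfolding F_def using assms
        by (subst prod_exch_fst, simp, simp, subst prod_exch_snd, simp, simp) (simp add: mult_ac)
    qed
    show ?thesis
    proof (rule alternating_sum_eq_0[OF _ ab(1-3)])
      fix \<sigma>
      have "(\<Prod>q\<in>?S. M (y q) (?x (\<sigma> (?\<tau> q)))) = (\<Prod>q\<in>?S. M (y q) (?x (\<sigma> q)))"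
        using prod.permute[OF \<tau>, of "\<lambda>q. M (y q) (?x (\<sigma> q))"] by (simp add: y\<tau> o_def)
      then show "F \<pi> \<pi>' (\<sigma> \<circ> ?\<tau>) = F \<pi> \<pi>' \<sigma>" unfolding FF by simp
    qed simp
  qed
  have "(\<Sum>\<sigma>\<in>?P. of_int (sign \<sigma>) *
    (interval_minor M u w (exch_fst r c c' \<sigma>) * interval_minor M u' w' (exch_snd r c c' \<sigma>)))
    = (\<Sum>\<sigma>\<in>?P. \<Sum>\<pi>\<in>?A. \<Sum>\<pi>'\<in>?B. of_int (sign \<pi>) * of_int (sign \<pi>') * (of_int (sign \<sigma>) * F \<pi> \<pi>' \<sigma>))"
    unfolding interval_minor_def sum_product unfolding F_def sum_distrib_left
    by (intro sum.cong refl) (simp only: mult_ac)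
  also have "\<dots> = (\<Sum>\<pi>\<in>?A. \<Sum>\<pi>'\<in>?B. of_int (sign \<pi>) * of_int (sign \<pi>') * (\<Sum>\<sigma>\<in>?P. of_int (sign \<sigma>) * F \<pi> \<pi>' \<sigma>))"
    unfolding sum_distrib_left by (subst sum.swap, rule sum.cong[OF refl], rule sum.swap)
  also have "\<dots> = 0" by (intro sum.neutral ballI) (simp add: z)
  finally show ?thesis .
qed

lemma image_complement_eq:
  assumes "inj f" "f ` (A \<union> B) = A \<union> B" "A \<inter> B = {}" "f ` A = A"
  shows "f ` B = B"
proof -
  have "f ` B = f ` (A \<union> B - A)" using assms(3) by (intro arg_cong[where f="image f"]) blast
  also have "\<dots> = (A \<union> B) - A" using assms by (simp add: image_set_diff)
  also have "\<dots> = B" using assms(3) by blast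
  finally show ?thesis .
qed

text \<open>Such a \<sigma> is a permutation of the first group of positions times one of the
  second. Each only permutes columns within one of the minors, and the two resulting signs cancel
  against the sign of \<sigma>.\<close>

lemma exch_stable:
  fixes M :: "nat \<Rightarrow> nat \<Rightarrow> 'r::comm_ring_1"
  assumes "u' \<le> u" "u \<le> r" "r < w'" "w' \<le> w"
    and \<sigma>: "\<sigma> permutes {u'..<Suc w}" and st: "\<sigma> ` {u'..<Suc r} = {u'..<Suc r}"
  shows "of_int (sign \<sigma>) *
    (interval_minor M u w (exch_fst r c c' \<sigma>) * interval_minor M u' w' (exch_snd r c c' \<sigma>))
    = interval_minor M u w c * interval_minor M u' w' c'"
proof -
  let ?I = "{u'..<Suc r}" and ?J = "{Suc r..<Suc w}"
  have IJ: "{u'..<Suc w} = ?I \<union> ?J" "?I \<inter> ?J = {}" using assms by auto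
  have inj: "inj \<sigma>" using \<sigma> by (rule permutes_inj)
  have stJ: "\<sigma> ` ?J = ?J"
    by (rule image_complement_eq[OF inj _ IJ(2) st]) (use permutes_image[OF \<sigma>] IJ(1) in simp)
  have restr: "restrict_id \<sigma> A permutes A" if "\<sigma> ` A = A" for A
  proof (rule bij_imp_permutes)
    have "bij_betw \<sigma> A A" using that inj inj_on_subset unfolding bij_betw_def by blast
    then show "bij_betw (restrict_id \<sigma> A) A A"
      by (rule iffD1[OF bij_betw_cong, rotated]) (simp add: restrict_id_def)
  qed (simp add: restrict_id_def)
  define \<sigma>1 where "\<sigma>1 = restrict_id \<sigma> ?I"
  define \<sigma>2 where "\<sigma>2 = restrict_id \<sigma> ?J"
  have p1: "\<sigma>1 permutes ?I"
    unfolding \<sigma>1_def by (rule restr[OF st])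
  have p2: "\<sigma>2 permutes ?J"
    unfolding \<sigma>2_def by (rule restr[OF stJ])
  have "\<sigma> = \<sigma>1 \<circ> \<sigma>2"
  proof
    fix q
    consider "q \<in> ?I" | "q \<in> ?J" | "q \<notin> {u'..<Suc w}" using IJ by blast
    then show "\<sigma> q = (\<sigma>1 \<circ> \<sigma>2) q"
    proof cases
      case 1
      then have "q \<notin> ?J" by auto
      then show ?thesis using 1 by (simp add: \<sigma>1_def \<sigma>2_def restrict_id_def del: atLeastLessThan_iff)
    next
      case 2
      then have "\<sigma> q \<in> ?J" using stJ by blast
      then have "\<sigma> q \<notin> ?I" using IJ by blast
      then show ?thesis using 2 by (simp add: \<sigma>1_def \<sigma>2_def restrict_id_def del: atLeastLessThan_iff)
    next
      case 3
      then have "q \<notin> ?I" "q \<notin> ?J" using IJ by auto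
      then show ?thesis using permutes_not_in[OF \<sigma> 3] by (simp add: \<sigma>1_def \<sigma>2_def restrict_id_def del: atLeastLessThan_iff)
    qed
  qed
  moreover have perm: "permutation \<sigma>1" "permutation \<sigma>2" using p1 p2 permutation_permutes by blast+
  ultimately have sg: "sign \<sigma> = sign \<sigma>1 * sign \<sigma>2" by (simp add: sign_compose)
  \<comment> \<open>The second group consists of the positions \<open>{Suc r..<Suc w}\<close>, but
    its columns belong to the rows \<open>{r..<w}\<close>; the shift by one transports the
    permutation together with its sign.\<close>
  define \<tau> where "\<tau> = map_permutation ?J (\<lambda>q. q - 1) \<sigma>2"
  have injm: "inj_on (\<lambda>q. q - 1 :: nat) ?J" by (auto simp: inj_on_def)
  have im: "(\<lambda>q. q - 1) ` ?J = {r..<w}"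
    unfolding image_Suc_atLeastLessThan[symmetric] image_image by simp
  have \<tau>: "\<tau> permutes {r..<w}" unfolding \<tau>_def
    by (rule map_permutation_permutes[OF _ p2]) (use injm im in \<open>auto simp: bij_betw_def\<close>)
  have sg\<tau>: "sign \<tau> = sign \<sigma>2" unfolding \<tau>_def
    by (rule sign_map_permutation[OF injm p2]) simp
  have \<tau>app: "\<tau> t = \<sigma> (Suc t) - 1" if "r \<le> t" "t < w" for t
  proof -
    have "\<tau> (Suc t - 1) = \<sigma>2 (Suc t) - 1" unfolding \<tau>_def
      by (rule map_permutation_apply[OF injm]) (use that in auto)
    then show ?thesis using that by (simp add: \<sigma>2_def restrict_id_def)
  qed
  have "interval_minor M u w (exch_fst r c c' \<sigma>) = interval_minor M u w (c \<circ> \<tau>)"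
  proof (rule interval_minor_cong)
    fix t assume t: "u \<le> t" "t < w"
    show "exch_fst r c c' \<sigma> t = (c \<circ> \<tau>) t"
    proof (cases "r \<le> t")
      case True
      then have "\<sigma> (Suc t) \<in> ?J" using stJ t by auto
      then show ?thesis using True t by (auto simp: exch_fst_def exch_col_def \<tau>app)
    next
      case False
      then show ?thesis using permutes_not_in[OF \<tau>, of t] by (simp add: exch_fst_def)
    qed
  qed
  also have "\<dots> = of_int (sign \<tau>) * interval_minor M u w c"
    using assms by (intro interval_minor_permute_cols permutes_subset[OF \<tau>]) auto
  finally have 1: "interval_minor M u w (exch_fst r c c' \<sigma>) = of_int (sign \<sigma>2) * interval_minor M u w c"
    by (simp add: sg\<tau>)
  have "interval_minor M u' w' (exch_snd r c c' \<sigma>) = interval_minor M u' w' (c' \<circ> \<sigma>1)"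
  proof (rule interval_minor_cong)
    fix t assume t: "u' \<le> t" "t < w'"
    show "exch_snd r c c' \<sigma> t = (c' \<circ> \<sigma>1) t"
    proof (cases "t \<le> r")
      case True
      then have "\<sigma> t \<in> ?I" using st t by auto
      then show ?thesis using True t by (auto simp: exch_snd_def exch_col_def \<sigma>1_def restrict_id_def)
    next
      case False
      then show ?thesis using permutes_not_in[OF p1, of t] by (simp add: exch_snd_def)
    qed
  qed
  also have "\<dots> = of_int (sign \<sigma>1) * interval_minor M u' w' c'"
    using assms by (intro interval_minor_permute_cols permutes_subset[OF p1]) auto
  finally have 2: "interval_minor M u' w' (exch_snd r c c' \<sigma>) = of_int (sign \<sigma>1) * interval_minor M u' w' c'" .
  have "of_int (sign \<sigma>) * (of_int (sign \<sigma>2) * of_int (sign \<sigma>1)) = (1 :: 'r)"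
    unfolding sg by (simp add: sign_def)
  moreover have "of_int (sign \<sigma>) * ((of_int (sign \<sigma>2) * interval_minor M u w c) * (of_int (sign \<sigma>1) * interval_minor M u' w' c'))
      = (of_int (sign \<sigma>) * (of_int (sign \<sigma>2) * of_int (sign \<sigma>1))) * (interval_minor M u w c * interval_minor M u' w' c')"
    by (simp only: mult_ac)
  ultimately show ?thesis unfolding 1 2 by simp
qed

text \<open>Equally many columns enter and leave the first minor. Those entering come from
  \<open>c'\<close> in rows up to \<open>r\<close> and are at most \<open>c' r\<close>; those
  leaving come from \<open>c\<close> in rows from \<open>r\<close> on and are at least
  \<open>c r\<close>, which is larger.\<close>

lemma sum_exch_fst_less:
  fixes c :: "nat \<Rightarrow> nat"
  assumes le: "u' \<le> u" "u \<le> r" "r < w'" "w' \<le> w"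
    and \<sigma>: "\<sigma> permutes {u'..<Suc w}" and st: "\<sigma> ` {u'..<Suc r} \<noteq> {u'..<Suc r}"
    and c: "strict_mono_on {u..<w} c" and c': "strict_mono_on {u'..<w'} c'" and viol: "c' r < c r"
  shows "(\<Sum>t\<in>{u..<w}. exch_fst r c c' \<sigma> t) < sum c {u..<w}"
proof -
  let ?I = "{u'..<Suc r}" and ?J = "{Suc r..<Suc w}" and ?x = "exch_col r c c'"
  have IJ: "{u'..<Suc w} = ?I \<union> ?J" "?I \<inter> ?J = {}" using le by auto
  have inj: "inj \<sigma>" using \<sigma> by (rule permutes_inj)
  have sub: "\<sigma> ` ?J \<subseteq> ?I \<union> ?J" using permutes_image[OF \<sigma>] IJ by blast
  have card: "card (\<sigma> ` ?J) = card ?J" using inj by (intro card_image) (auto simp: inj_on_def)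
  have ne: "\<sigma> ` ?J \<noteq> ?J"
  proof
    assume J: "\<sigma> ` ?J = ?J"
    have "\<sigma> ` ?I = ?I"
      by (rule image_complement_eq[OF inj _ _ J]) (use permutes_image[OF \<sigma>] IJ in \<open>simp_all add: Un_commute Int_commute\<close>)
    then show False using st by contradiction
  qed
  let ?K = "\<sigma> ` ?J"
  have cd: "card (?K - ?J) = card (?J - ?K)"
    using card by (simp add: card_Diff_subset_Int Int_commute)
  \<comment> \<open>At least one column really changes sides; this makes the comparison of the two
    sums strict.\<close>
  have pos: "?K - ?J \<noteq> {}"
  proof
    assume "?K - ?J = {}"
    then have "?K \<subseteq> ?J" by blast
    then show False using ne card card_subset_eq[of ?J ?K] by simp
  qed
  have lo: "?x q \<le> c' r" if "q \<in> ?K - ?J" for q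
  proof -
    have q: "u' \<le> q" "q \<le> r" using that sub by auto
    then have "c' q \<le> c' r" using c' le by (cases "q = r") (auto simp: strict_mono_on_def less_imp_le)
    then show ?thesis using q by (simp add: exch_col_def)
  qed
  have hi: "c r \<le> ?x q" if "q \<in> ?J - ?K" for q
  proof -
    have "r \<le> q - 1" "q - 1 < w" using that by auto
    then have "c r \<le> c (q - 1)" using c le by (cases "r = q - 1") (auto simp: strict_mono_on_def less_imp_le)
    then show ?thesis using that by (auto simp: exch_col_def)
  qed
  have "sum ?x (?K - ?J) \<le> card (?K - ?J) * c' r"
    using sum_bounded_above[of "?K - ?J" ?x "c' r"] lo by simp
  also have "\<dots> < card (?K - ?J) * c r" using viol pos by (simp add: card_gt_0_iff)
  also have "\<dots> \<le> sum ?x (?J - ?K)"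
    using sum_bounded_below[of "?J - ?K" "c r" ?x] hi cd by simp
  finally have "sum ?x (?K - ?J) < sum ?x (?J - ?K)" .
  moreover have "sum ?x ?K = sum ?x (?K \<inter> ?J) + sum ?x (?K - ?J)"
    by (intro sum.Int_Diff) auto
  moreover have "sum ?x ?J = sum ?x (?K \<inter> ?J) + sum ?x (?J - ?K)"
    using sum.Int_Diff[of ?J ?x ?K] by (simp add: Int_commute)
  ultimately have "sum ?x ?K < sum ?x ?J" by linarith
  moreover have "sum ?x ?K = (\<Sum>q\<in>?J. ?x (\<sigma> q))"
    using inj by (subst sum.reindex) (auto simp: inj_on_def)
  moreover have "sum c {u..<w} = sum c {u..<r} + sum c {r..<w}"
    using le by (intro sum.atLeastLessThan_concat[symmetric]) auto
  moreover have "sum ?x ?J = sum c {r..<w}"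
    by (subst sum.shift_bounds_Suc_ivl) (auto intro!: sum.cong simp: exch_col_def)
  ultimately show ?thesis using sum_exch_fst[of u r w c c' \<sigma>] le by simp
qed

text \<open>The permutation only redistributes the merged sequence: what the first minor loses, the
  second one gains. This balance is behind the decrease of \<open>energy\<close>.\<close>

lemma sum_exch_add:
  fixes c :: "nat \<Rightarrow> nat"
  assumes le: "u' \<le> u" "u \<le> r" "r < w'" "w' \<le> w" and \<sigma>: "\<sigma> permutes {u'..<Suc w}"
  shows "(\<Sum>t\<in>{u..<w}. exch_fst r c c' \<sigma> t) + (\<Sum>t\<in>{u'..<w'}. exch_snd r c c' \<sigma> t) = sum c {u..<w} + sum c' {u'..<w'}"
proof -
  let ?x = "exch_col r c c'"
  have a: "sum f {u'..<Suc w} = sum f {u'..<Suc r} + sum f {Suc r..<Suc w}" for f :: "nat \<Rightarrow> nat"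
    using le by (intro sum.atLeastLessThan_concat[symmetric]) auto
  have "(\<Sum>q\<in>{u'..<Suc w}. ?x (\<sigma> q)) = sum ?x {u'..<Suc w}"
    using sum.permute[OF \<sigma>, of ?x] by (simp add: o_def)
  moreover have "sum ?x {Suc r..<Suc w} = sum c {r..<w}"
    by (subst sum.shift_bounds_Suc_ivl) (auto intro!: sum.cong simp: exch_col_def)
  moreover have "sum ?x {u'..<Suc r} = sum c' {u'..<Suc r}"
    by (auto intro!: sum.cong simp: exch_col_def)
  moreover have "sum c {u..<w} = sum c {u..<r} + sum c {r..<w}" "sum c' {u'..<w'} = sum c' {u'..<Suc r} + sum c' {Suc r..<w'}"
    using le by (intro sum.atLeastLessThan_concat[symmetric]; simp)+
  ultimately show ?thesis using sum_exch_fst[of u r w c c' \<sigma>] sum_exch_snd[of u' r w' c c' \<sigma>] le a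
    by simp
qed

lemma exch_less:
  assumes le: "u' \<le> u" "u \<le> r" "r < w'" "w' \<le> w" and \<sigma>: "\<sigma> permutes {u'..<Suc w}"
    and "\<And>t. t \<in> {u..<w} \<Longrightarrow> c t < N" "\<And>t. t \<in> {u'..<w'} \<Longrightarrow> c' t < N"
  shows "t \<in> {u..<w} \<Longrightarrow> exch_fst r c c' \<sigma> t < N" "t \<in> {u'..<w'} \<Longrightarrow> exch_snd r c c' \<sigma> t < N"
proof -
  have x: "exch_col r c c' q < N" if "q \<in> {u'..<Suc w}" for q
  proof (cases "q \<le> r")
    case False
    then have "q - 1 \<in> {u..<w}" using that le by auto
    then show ?thesis using assms(6) False by (simp add: exch_col_def del: atLeastLessThan_iff)
  qed (use that assms in \<open>auto simp: exch_col_def\<close>)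
  have \<sigma>in: "\<sigma> q \<in> {u'..<Suc w}" if "q \<in> {u'..<Suc w}" for q
    using permutes_in_image[OF \<sigma>] that by blast
  show "t \<in> {u..<w} \<Longrightarrow> exch_fst r c c' \<sigma> t < N"
    using assms x[OF \<sigma>in, of "Suc t"] by (auto simp: exch_fst_def)
  show "t \<in> {u'..<w'} \<Longrightarrow> exch_snd r c c' \<sigma> t < N"
    using assms x[OF \<sigma>in, of t] by (auto simp: exch_snd_def)
qed

section \<open>Initial monomials\<close>

abbreviation "keys \<equiv> Poly_Mapping.keys"
abbreviation "lookup \<equiv> Poly_Mapping.lookup"

text \<open>Transitivity and totality are asked for on \<open>D\<close> alone, because the relations
  to which this is applied are orders only on the variables that occur and on the monomials in
  them.\<close>

lemma finite_maximum_of_relation: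
  assumes "finite D" "D \<noteq> {}"
    and "\<And>x y z. x \<in> D \<Longrightarrow> y \<in> D \<Longrightarrow> z \<in> D \<Longrightarrow> R x y \<Longrightarrow> R y z \<Longrightarrow> R x z"
    and "\<And>x y. x \<in> D \<Longrightarrow> y \<in> D \<Longrightarrow> x \<noteq> y \<Longrightarrow> R x y \<or> R y x"
  shows "\<exists>x\<in>D. \<forall>y\<in>D. y \<noteq> x \<longrightarrow> R x y"
  using assms
proof (induction D rule: finite_ne_induct)
  case (insert a D)
  have "\<exists>x\<in>D. \<forall>y\<in>D. y \<noteq> x \<longrightarrow> R x y"
    by (rule insert.IH) (use insert.prems in \<open>blast+\<close>)
  then obtain x where x: "x \<in> D" "\<forall>y\<in>D. y \<noteq> x \<longrightarrow> R x y" by blast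
  show ?case
  proof (cases "R a x")
    case True
    have "R a y" if "y \<in> D" for y
      using True that x insert.prems(1)[of a x y] by (cases "y = x") auto
    then show ?thesis by blast
  next
    case False
    then have "R x a" using insert.prems(2)[of x a] x insert.hyps by blast
    then show ?thesis using x by blast
  qed
qed simp

lemma lookup_poly_const_mult: "lookup (poly_const k * p) m = k * lookup p m"
  unfolding poly_const_def mult_map_scale_conv_mult[symmetric]
  by (auto simp: Poly_Mapping.map.rep_eq when_def)

lemma poly_const_add: "poly_const (a + b) = poly_const a + poly_const b"
  by (simp add: poly_const_def single_add)

lemma poly_const_mult: "poly_const (a * b) = poly_const a * poly_const b"
  by (simp add: poly_const_def mult_single)

lemma poly_const_0 [simp]: "poly_const 0 = 0"
  by (simp add: poly_const_def)

lemma poly_const_1 [simp]: "poly_const 1 = 1"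
  by (simp add: poly_const_def)

lemma poly_const_of_int: "poly_const (of_int k) = of_int k"
  by (simp add: poly_const_def)

lemma poly_const_of_nat: "poly_const (of_nat k) = of_nat k"
  by (simp add: poly_const_def)

section \<open>Complex polynomials as a vector space\<close>

global_interpretation cpoly: vector_space "\<lambda>(k::complex) (p::'x cpoly). poly_const k * p"
  by unfold_locales (simp_all add: poly_const_add poly_const_mult algebra_simps)

text \<open>Bilinearity, one factor at a time. It makes the span of the standard products a
  subalgebra once the product of any two of them is known to lie in the span.\<close>

lemma cpoly_span_mult:
  assumes B: "\<And>p q. p \<in> B \<Longrightarrow> q \<in> B \<Longrightarrow> p * q \<in> cpoly.span B"
    and f: "f \<in> cpoly.span B" and g: "g \<in> cpoly.span B"
  shows "f * g \<in> cpoly.span B"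
proof -
  have 1: "p * g \<in> cpoly.span B" if "p \<in> B" for p
    using g
  proof (induction rule: cpoly.span_induct_alt)
    case base show ?case by (simp add: cpoly.span_zero)
  next
    case (step c x y)
    have "p * (poly_const c * x + y) = poly_const c * (p * x) + p * y" by (simp add: algebra_simps)
    then show ?case using step B[OF that step(1)] by (simp add: cpoly.span_add cpoly.span_scale)
  qed
  show ?thesis using f
  proof (induction rule: cpoly.span_induct_alt)
    case base show ?case by (simp add: cpoly.span_zero)
  next
    case (step c x y)
    have "(poly_const c * x + y) * g = poly_const c * (x * g) + y * g" by (simp add: algebra_simps)
    then show ?case using step 1[OF step(1)] by (simp add: cpoly.span_add cpoly.span_scale)
  qed
qed

lemma is_subalgebra_hull:
  fixes S :: "'a cpoly set"
  shows "is_subalgebra (is_subalgebra hull S)"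
proof (rule hull_in)
  fix T :: "'a cpoly set set"
  assume "Ball T is_subalgebra"
  then have T: "is_subalgebra X" if "X \<in> T" for X using that by blast
  show "is_subalgebra (\<Inter>T)"
    unfolding is_subalgebra_def
  proof (intro conjI ballI subsetI InterI)
    fix p :: "'a cpoly" and X assume "p \<in> range poly_const" "X \<in> T"
    then show "p \<in> X" using T[of X] by (auto simp: is_subalgebra_def)
  next
    fix f g X assume "f \<in> \<Inter>T" "g \<in> \<Inter>T" "X \<in> T"
    then show "f + g \<in> X" "f * g \<in> X" using T[of X] by (auto simp: is_subalgebra_def)
  qed
qed

text \<open>The axioms are confined to \<open>V\<close> because the type of variables is larger than
  the set that occurs in the matrices, and the given relation need not be a total order on the rest.
  This is the source of the conditions \<open>keys m \<subseteq> V\<close>.\<close>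

locale var_order =
  fixes gt :: "'x \<Rightarrow> 'x \<Rightarrow> bool" and V :: "'x set"
  assumes gt_irrefl: "x \<in> V \<Longrightarrow> \<not> gt x x"
    and gt_trans: "x \<in> V \<Longrightarrow> y \<in> V \<Longrightarrow> z \<in> V \<Longrightarrow> gt x y \<Longrightarrow> gt y z \<Longrightarrow> gt x z"
    and gt_total: "x \<in> V \<Longrightarrow> y \<in> V \<Longrightarrow> x \<noteq> y \<Longrightarrow> gt x y \<or> gt y x"
begin

abbreviation mgt :: "'x monomial \<Rightarrow> 'x monomial \<Rightarrow> bool" where
  "mgt \<equiv> lex_greater gt"

lemma mgt_irrefl: "\<not> mgt m m"
  by (auto simp: lex_greater_def)

lemma mgt_trans:
  assumes "keys m \<subseteq> V" "keys n \<subseteq> V" "keys k \<subseteq> V" "mgt m n" "mgt n k"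
  shows "mgt m k"
proof -
  obtain x where x: "lookup m x > lookup n x" "\<And>z. gt z x \<Longrightarrow> lookup m z = lookup n z"
    using assms(4) unfolding lex_greater_def by blast
  obtain y where y: "lookup n y > lookup k y" "\<And>z. gt z y \<Longrightarrow> lookup n z = lookup k z"
    using assms(5) unfolding lex_greater_def by blast
  have "lookup m x \<noteq> 0" "lookup n y \<noteq> 0" using x(1) y(1) by linarith+
  then have V: "x \<in> V" "y \<in> V" using assms by (auto simp: in_keys_iff)
  have out: "lookup m z = lookup k z" if "z \<notin> V" for z
    using that assms by (metis in_keys_iff subsetD)
  consider "x = y" | "gt x y" | "gt y x" using gt_total V by blast
  then show ?thesis
  proof cases
    case 1
    then show ?thesis using x y unfolding lex_greater_def by (metis less_trans)
  next
    case 2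
    have "lookup m z = lookup k z" if "gt z x" for z
      using that x(2)[OF that] y(2)[OF gt_trans[OF _ V that 2]] out by (cases "z \<in> V") auto
    then show ?thesis using x(1) y(2)[OF 2] unfolding lex_greater_def by metis
  next
    case 3
    have "lookup m z = lookup k z" if "gt z y" for z
      using that y(2)[OF that] x(2)[OF gt_trans[OF _ V(2,1) that 3]] out by (cases "z \<in> V") auto
    then show ?thesis using y(1) x(2)[OF 3] unfolding lex_greater_def by metis
  qed
qed

lemma mgt_total:
  assumes "keys m \<subseteq> V" "keys n \<subseteq> V" "m \<noteq> n"
  shows "mgt m n \<or> mgt n m"
proof -
  define D where "D = {x. lookup m x \<noteq> lookup n x}"
  have D: "D \<subseteq> keys m \<union> keys n" by (auto simp: D_def in_keys_iff)
  then have fin: "finite D" by (rule finite_subset) simp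
  have ne: "D \<noteq> {}" using assms(3) poly_mapping_eqI[of m n] by (auto simp: D_def)
  have DV: "D \<subseteq> V" using D assms by blast
  have "\<exists>x\<in>D. \<forall>y\<in>D. y \<noteq> x \<longrightarrow> gt x y"
  proof (rule finite_maximum_of_relation[OF fin ne])
    show "gt x z" if "x \<in> D" "y \<in> D" "z \<in> D" "gt x y" "gt y z" for x y z
      using gt_trans[of x y z] that DV by auto
    show "gt x y \<or> gt y x" if "x \<in> D" "y \<in> D" "x \<noteq> y" for x y
      using gt_total[of x y] that DV by auto
  qed
  then obtain x where x: "x \<in> D" "\<forall>y\<in>D. y \<noteq> x \<longrightarrow> gt x y" by blast
  have eq: "lookup m y = lookup n y" if "gt y x" for y
  proof (rule ccontr)
    assume "\<not> ?thesis"
    then have yD: "y \<in> D" by (simp add: D_def)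
    then have "y \<noteq> x" using that gt_irrefl DV by blast
    then show False using x yD that gt_trans[of x y x] gt_irrefl DV by blast
  qed
  show ?thesis using x(1) eq unfolding lex_greater_def D_def
    by (metis (mono_tags, lifting) mem_Collect_eq nat_neq_iff)
qed

lemma keys_add_subset: "keys m \<subseteq> V \<Longrightarrow> keys n \<subseteq> V \<Longrightarrow> keys (m + n) \<subseteq> V"
  using keys_add[of m n] by (meson Un_least order_trans)

lemma mgt_add_right: "mgt m n \<Longrightarrow> mgt (m + k) (n + k)"
  unfolding lex_greater_def lookup_add by auto

lemma mgt_add_left: "mgt m n \<Longrightarrow> mgt (k + m) (k + n)"
  unfolding lex_greater_def lookup_add by auto

lemma mgt_add:
  assumes "keys m \<subseteq> V" "keys n \<subseteq> V" "keys k \<subseteq> V" "keys l \<subseteq> V" "mgt m n" "mgt k l"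
  shows "mgt (m + k) (n + l)"
proof (rule mgt_trans[OF _ _ _ mgt_add_right[OF assms(5)] mgt_add_left[OF assms(6)]])
qed (rule keys_add_subset; fact)+

text \<open>The coefficient is fixed to 1: the diagonal term of a minor has it, and products
  preserve it, so leading monomials multiply without scalars.\<close>

definition leads :: "'x monomial \<Rightarrow> 'x cpoly \<Rightarrow> bool" where
  "leads m f \<longleftrightarrow> lookup f m = 1 \<and> keys m \<subseteq> V \<and> (\<forall>k\<in>keys f. k \<noteq> m \<longrightarrow> keys k \<subseteq> V \<and> mgt m k)"

lemma initial_monomial_eqI:
  assumes "m \<in> keys f" "\<And>k. k \<in> keys f \<Longrightarrow> keys k \<subseteq> V" "\<And>k. k \<in> keys f \<Longrightarrow> k \<noteq> m \<Longrightarrow> mgt m k"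
  shows "initial_monomial mgt f = Poly_Mapping.single m 1"
proof -
  have "(THE m. m \<in> keys f \<and> (\<forall>k\<in>keys f. k \<noteq> m \<longrightarrow> mgt m k)) = m"
  proof (rule the_equality)
    fix n assume n: "n \<in> keys f \<and> (\<forall>k\<in>keys f. k \<noteq> n \<longrightarrow> mgt n k)"
    show "n = m"
    proof (rule ccontr)
      assume "n \<noteq> m"
      then have "mgt n m" "mgt m n" using n assms(1) assms(3)[of n] by auto
      moreover have "keys m \<subseteq> V" "keys n \<subseteq> V" using n assms(1,2) by auto
      ultimately show False using mgt_trans[of m n m] mgt_irrefl[of m] by simp
    qed
  qed (use assms in blast)
  then show ?thesis unfolding initial_monomial_def by simp
qed

lemma leads_initial_monomial:
  assumes "leads m f"
  shows "initial_monomial mgt f = Poly_Mapping.single m 1"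
  by (rule initial_monomial_eqI) (use assms in \<open>auto simp: leads_def in_keys_iff\<close>)

lemma leads_not_0: "leads m f \<Longrightarrow> f \<noteq> 0"
  by (auto simp: leads_def)

lemma leads_1: "leads 0 1"
  by (simp add: leads_def)

text \<open>With the two leading terms split off, every other product of terms is smaller, since the
  order is compatible with the addition of exponents. Hence nothing else contributes to the
  coefficient of \<open>m + n\<close>.\<close>

lemma leads_mult:
  assumes f: "leads m f" and g: "leads n g"
  shows "leads (m + n) (f * g)"
proof -
  define f' where "f' = f - Poly_Mapping.single m 1"
  define g' where "g' = g - Poly_Mapping.single n 1"
  let ?m = "Poly_Mapping.single m (1::complex)" and ?n = "Poly_Mapping.single n (1::complex)"
  have mn: "keys m \<subseteq> V" "keys n \<subseteq> V" using f g by (auto simp: leads_def)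
  have f': "keys k \<subseteq> V \<and> mgt m k" if "k \<in> keys f'" for k
    using that f by (cases "k = m") (auto simp: f'_def leads_def in_keys_iff lookup_minus lookup_single when_def split: if_splits)
  have g': "keys k \<subseteq> V \<and> mgt n k" if "k \<in> keys g'" for k
    using that g by (cases "k = n") (auto simp: g'_def leads_def in_keys_iff lookup_minus lookup_single when_def split: if_splits)
  define h where "h = ?m * g' + f' * ?n + f' * g'"
  have fg: "f * g = Poly_Mapping.single (m + n) 1 + h"
  proof -
    have "f = ?m + f'" "g = ?n + g'" by (simp_all add: f'_def g'_def)
    then have "f * g = (?m + f') * (?n + g')" by simp
    also have "\<dots> = ?m * ?n + h" by (simp add: h_def algebra_simps)
    finally show ?thesis by (simp add: mult_single)
  qed
  have h: "keys k \<subseteq> V \<and> mgt (m + n) k" if "k \<in> keys h" for k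
  proof -
    have "k \<in> keys (?m * g') \<or> k \<in> keys (f' * ?n) \<or> k \<in> keys (f' * g')"
      using that unfolding h_def by (meson UnE keys_add subsetD)
    then consider b where "b \<in> keys g'" "k = m + b" | a where "a \<in> keys f'" "k = a + n"
      | a b where "a \<in> keys f'" "b \<in> keys g'" "k = a + b"
      using keys_mult[of ?m g'] keys_mult[of f' ?n] keys_mult[of f' g'] by (auto split: if_splits)
    then show ?thesis
    proof cases
      case 1
      then show ?thesis using g'[OF 1(1)] mn by (simp add: keys_add_subset mgt_add_left)
    next
      case 2
      then show ?thesis using f'[OF 2(1)] mn by (simp add: keys_add_subset mgt_add_right)
    next
      case 3
      then show ?thesis using f'[OF 3(1)] g'[OF 3(2)] mn by (simp add: keys_add_subset mgt_add)
    qed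
  qed
  have "m + n \<notin> keys h" using h mgt_irrefl by blast
  then have lh: "lookup h (m + n) = 0" by (simp add: in_keys_iff)
  show ?thesis
    unfolding leads_def fg
  proof (intro conjI ballI impI)
    show "keys (m + n) \<subseteq> V" using mn by (simp add: keys_add_subset)
    fix k assume "k \<in> keys (Poly_Mapping.single (m + n) 1 + h)" "k \<noteq> m + n"
    then have "k \<in> keys h" by (simp add: in_keys_iff lookup_add lookup_single_not_eq)
    then show "keys k \<subseteq> V" "mgt (m + n) k" using h by auto
  qed (simp add: lookup_add lh)
qed

lemma leads_prod_list:
  "(\<And>x. x \<in> set xs \<Longrightarrow> leads (\<mu> x) (P x)) \<Longrightarrow> leads (\<Sum>x\<leftarrow>xs. \<mu> x) (\<Prod>x\<leftarrow>xs. P x)"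
  by (induction xs) (auto simp: leads_1 leads_mult)

text \<open>Among the elements used with nonzero coefficient, injectivity singles out one with the
  greatest leading monomial. This monomial exceeds all monomials of the other elements, so nothing
  cancels it.\<close>

lemma span_initial_monomial:
  assumes f: "f \<in> cpoly.span B" "f \<noteq> 0"
    and B: "\<And>b. b \<in> B \<Longrightarrow> leads (\<mu> b) b" and inj: "inj_on \<mu> B"
  shows "\<exists>b\<in>B. initial_monomial mgt f = Poly_Mapping.single (\<mu> b) 1"
proof -
  obtain T r where T: "finite T" "T \<subseteq> B" "f = (\<Sum>b\<in>T. poly_const (r b) * b)"
    using f(1) unfolding cpoly.span_explicit by blast
  define D where "D = {b \<in> T. r b \<noteq> 0}"
  have D: "finite D" "D \<subseteq> B" using T by (auto simp: D_def)
  have fD: "f = (\<Sum>b\<in>D. poly_const (r b) * b)"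
    unfolding T(3) D_def using T(1) by (intro sum.mono_neutral_right) auto
  have neD: "D \<noteq> {}" using fD f(2) by auto
  have \<mu>V: "keys (\<mu> b) \<subseteq> V" if "b \<in> B" for b using B[OF that] by (simp add: leads_def)
  have "\<exists>b\<in>D. \<forall>b'\<in>D. b' \<noteq> b \<longrightarrow> mgt (\<mu> b) (\<mu> b')"
  proof (rule finite_maximum_of_relation[OF D(1) neD])
    fix x y z assume "x \<in> D" "y \<in> D" "z \<in> D" "mgt (\<mu> x) (\<mu> y)" "mgt (\<mu> y) (\<mu> z)"
    then show "mgt (\<mu> x) (\<mu> z)" using mgt_trans[of "\<mu> x" "\<mu> y" "\<mu> z"] \<mu>V D(2) by blast
  next
    fix x y assume "x \<in> D" "y \<in> D" "x \<noteq> y"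
    then show "mgt (\<mu> x) (\<mu> y) \<or> mgt (\<mu> y) (\<mu> x)"
      using mgt_total[of "\<mu> x" "\<mu> y"] \<mu>V D(2) inj unfolding inj_on_def by blast
  qed
  then obtain b where b: "b \<in> D" "\<And>b'. b' \<in> D \<Longrightarrow> b' \<noteq> b \<Longrightarrow> mgt (\<mu> b) (\<mu> b')" by blast
  have below: "keys k \<subseteq> V \<and> mgt (\<mu> b) k" if "b' \<in> D" "k \<in> keys b'" "k \<noteq> \<mu> b \<or> b' \<noteq> b" for b' k
  proof (cases "b' = b")
    case True
    then show ?thesis using that B[of b] D(2) by (auto simp: leads_def)
  next
    case False
    have L: "leads (\<mu> b') b'" using B that D(2) by blast
    have bb: "mgt (\<mu> b) (\<mu> b')" using b that False by blast
    show ?thesis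
    proof (cases "k = \<mu> b'")
      case True
      then show ?thesis using bb L by (simp add: leads_def)
    next
      case False
      then have "keys k \<subseteq> V" "mgt (\<mu> b') k" using L that(2) by (auto simp: leads_def)
      then show ?thesis using mgt_trans[OF _ _ _ bb, of k] \<mu>V[of b] \<mu>V[of b'] b(1) that(1) D(2) by blast
    qed
  qed
  have lf: "lookup f k = (\<Sum>b'\<in>D. r b' * lookup b' k)" for k
    unfolding fD lookup_sum by (simp add: lookup_poly_const_mult)
  have "lookup f (\<mu> b) = (\<Sum>b'\<in>D. if b' = b then r b else 0)"
    unfolding lf
  proof (rule sum.cong[OF refl])
    fix b' assume b': "b' \<in> D"
    show "r b' * lookup b' (\<mu> b) = (if b' = b then r b else 0)"
    proof (cases "b' = b")
      case True
      then show ?thesis using B[of b] b D(2) by (auto simp: leads_def)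
    next
      case False
      then have "\<mu> b \<notin> keys b'" using below[OF b', of "\<mu> b"] mgt_irrefl by blast
      then show ?thesis using False by (simp add: in_keys_iff)
    qed
  qed
  then have lb: "lookup f (\<mu> b) \<noteq> 0" using b(1) D(1) by (simp add: D_def)
  have all: "keys k \<subseteq> V \<and> mgt (\<mu> b) k" if "k \<in> keys f" "k \<noteq> \<mu> b" for k
  proof -
    have "(\<Sum>b'\<in>D. r b' * lookup b' k) \<noteq> 0" using that(1) lf by (simp add: in_keys_iff)
    then obtain b' where "b' \<in> D" "r b' * lookup b' k \<noteq> 0" using sum.not_neutral_contains_not_neutral by blast
    then show ?thesis using below[of b' k] that(2) by (simp add: in_keys_iff)
  qed
  have "initial_monomial mgt f = Poly_Mapping.single (\<mu> b) 1"
    by (rule initial_monomial_eqI) (use lb all \<mu>V b(1) D(2) in \<open>auto simp: in_keys_iff\<close>)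
  then show ?thesis using b(1) D(2) by blast
qed

end

section \<open>Staircase-shaped matrices of variables\<close>

lemma prod_poly_var:
  "finite A \<Longrightarrow> (\<Prod>a\<in>A. poly_var (f a)) = Poly_Mapping.single (\<Sum>a\<in>A. Poly_Mapping.single (f a) 1) 1"
  by (induction A rule: finite_induct) (simp_all add: poly_var_def mult_single)

lemma prod_list_single:
  "(\<Prod>x\<leftarrow>xs. Poly_Mapping.single (m x) (1 :: complex)) = Poly_Mapping.single (\<Sum>x\<leftarrow>xs. m x) 1"
  by (induction xs) (simp_all add: mult_single)

lemma prod_list_eq_0: "(0 :: 'r::comm_semiring_1) \<in> set xs \<Longrightarrow> prod_list xs = 0"
  by (induction xs) auto

text \<open>Zeros lie in the lower left, where the blocks of \<open>S1\<close> put them, or in the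
  upper right, where those of \<open>S2\<close> do. Besides ordering the variables row by row,
  \<open>gt_iff\<close> forces distinct positions of the support to carry distinct variables,
  because no variable is greater than itself.\<close>

locale staircase =
  fixes supp :: "nat \<Rightarrow> nat \<Rightarrow> bool" and v :: "nat \<Rightarrow> nat \<Rightarrow> 'x" and gt :: "'x \<Rightarrow> 'x \<Rightarrow> bool"
  assumes stair: "\<not> supp t c \<Longrightarrow>
      (\<forall>t' c'. t \<le> t' \<longrightarrow> c' \<le> c \<longrightarrow> \<not> supp t' c') \<or> (\<forall>t' c'. t' \<le> t \<longrightarrow> c \<le> c' \<longrightarrow> \<not> supp t' c')"
    and gt_iff: "supp t c \<Longrightarrow> supp t' c' \<Longrightarrow> gt (v t c) (v t' c') \<longleftrightarrow> t < t' \<or> t = t' \<and> c < c'"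
begin

definition V :: "'x set" where
  "V = {v t c | t c. supp t c}"

lemma v_in_V: "supp t c \<Longrightarrow> v t c \<in> V"
  by (auto simp: V_def)

lemma v_eq_iff:
  assumes "supp t c" "supp t' c'"
  shows "v t c = v t' c' \<longleftrightarrow> t = t' \<and> c = c'"
  using gt_iff[OF assms] gt_iff[OF assms(2,1)] gt_iff[OF assms(1,1)] by (metis linorder_neq_iff)

sublocale var_order gt V
proof
  fix x y z assume V: "x \<in> V" "y \<in> V"
  then obtain a b c d where *: "x = v a b" "supp a b" "y = v c d" "supp c d" unfolding V_def by blast
  show "\<not> gt x x" using * gt_iff by simp
  show "gt x y \<or> gt y x" if "x \<noteq> y" using that * gt_iff v_eq_iff by (metis linorder_neq_iff)
  show "gt x z" if "z \<in> V" "gt x y" "gt y z"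
  proof -
    obtain e f where z: "z = v e f" "supp e f" using \<open>z \<in> V\<close> unfolding V_def by blast
    have "a < c \<or> a = c \<and> b < d" using that(2) * gt_iff by simp
    moreover have "c < e \<or> c = e \<and> d < f" using that(3) * z gt_iff by simp
    ultimately have "a < e \<or> a = e \<and> b < f" by auto
    then show ?thesis using * z gt_iff by simp
  qed
qed

definition M :: "nat \<Rightarrow> nat \<Rightarrow> 'x cpoly" where
  "M t c = (if supp t c then poly_var (v t c) else 0)"

definition diag :: "nat \<Rightarrow> nat \<Rightarrow> (nat \<Rightarrow> nat) \<Rightarrow> 'x monomial" where
  "diag u w c = (\<Sum>t\<in>{u..<w}. Poly_Mapping.single (v t (c t)) 1)"

text \<open>Pigeonhole on a zero quadrant. The columns \<open>c s\<close> with
  \<open>s \<le> t\<close> are one more than the rows before \<open>t\<close>, so every permutation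
  sends one of them to row \<open>t\<close> or below, into the zeros of the lower left; the upper
  right case is symmetric. Hence a nonzero minor has its whole diagonal in the support.\<close>

lemma minor_eq_0:
  assumes c: "strict_mono_on {u..<w} c" and t: "t \<in> {u..<w}" and ns: "\<not> supp t (c t)"
  shows "interval_minor M u w c = 0"
  unfolding interval_minor_def
proof (intro sum.neutral ballI)
  fix \<pi> assume "\<pi> \<in> {\<pi>. \<pi> permutes {u..<w}}"
  then have \<pi>: "\<pi> permutes {u..<w}" by simp
  then have inj: "inj \<pi>" by (rule permutes_inj)
  have in': "\<pi> s \<in> {u..<w}" if "s \<in> {u..<w}" for s using permutes_in_image[OF \<pi>] that by blast
  have mono: "c a \<le> c b" if "a \<le> b" "a \<in> {u..<w}" "b \<in> {u..<w}" for a b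
    using strict_mono_on_leD[OF c that(2,3,1)] .
  have "\<exists>s\<in>{u..<w}. \<not> supp (\<pi> s) (c s)"
    using stair[OF ns]
  proof
    assume *: "\<forall>t' c'. t \<le> t' \<longrightarrow> c' \<le> c t \<longrightarrow> \<not> supp t' c'"
    have "\<exists>s\<in>{u..<Suc t}. t \<le> \<pi> s"
    proof (rule ccontr)
      assume "\<not> ?thesis"
      then have "\<pi> ` {u..<Suc t} \<subseteq> {u..<t}" using in' t by (auto simp: not_le)
      then have "card (\<pi> ` {u..<Suc t}) \<le> card {u..<t}" by (intro card_mono) auto
      moreover have "card (\<pi> ` {u..<Suc t}) = card {u..<Suc t}"
        using inj by (intro card_image) (auto simp: inj_on_def)
      ultimately show False using t by auto
    qed
    then obtain s where s: "s \<in> {u..<Suc t}" "t \<le> \<pi> s" by blast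
    then have "c s \<le> c t" using mono t by auto
    then show ?thesis using * s t by (intro bexI[of _ s]) auto
  next
    assume *: "\<forall>t' c'. t' \<le> t \<longrightarrow> c t \<le> c' \<longrightarrow> \<not> supp t' c'"
    have "\<exists>s\<in>{t..<w}. \<pi> s \<le> t"
    proof (rule ccontr)
      assume "\<not> ?thesis"
      then have "\<pi> ` {t..<w} \<subseteq> {Suc t..<w}" using in' t by (auto simp: not_le Suc_le_eq)
      then have "card (\<pi> ` {t..<w}) \<le> card {Suc t..<w}" by (intro card_mono) auto
      moreover have "card (\<pi> ` {t..<w}) = card {t..<w}"
        using inj by (intro card_image) (auto simp: inj_on_def)
      ultimately show False using t by auto
    qed
    then obtain s where s: "s \<in> {t..<w}" "\<pi> s \<le> t" by blast
    then have "c t \<le> c s" using mono t by auto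
    then show ?thesis using * s t by (intro bexI[of _ s]) auto
  qed
  then obtain s where "s \<in> {u..<w}" "M (\<pi> s) (c s) = 0" by (auto simp: M_def)
  then have "(\<Prod>t\<in>{u..<w}. M (\<pi> t) (c t)) = 0" by (intro prod_zero) auto
  then show "of_int (sign \<pi>) * (\<Prod>t\<in>{u..<w}. M (\<pi> t) (c t)) = 0" by simp
qed

text \<open>The deciding variable is \<open>v t (c t)\<close> for the first row \<open>t\<close>
  moved by \<pi>. The columns from \<open>t\<close> on cannot use an earlier row, and the one that
  lands in row \<open>t\<close> has an index greater than \<open>c t\<close>.\<close>

lemma mgt_diag:
  assumes c: "strict_mono_on {u..<w} c" and d: "\<And>t. t \<in> {u..<w} \<Longrightarrow> supp t (c t)"
    and \<pi>: "\<pi> permutes {u..<w}" "\<pi> \<noteq> id" and s\<pi>: "\<And>t. t \<in> {u..<w} \<Longrightarrow> supp (\<pi> t) (c t)"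
  shows "mgt (diag u w c) (\<Sum>t\<in>{u..<w}. Poly_Mapping.single (v (\<pi> t) (c t)) 1)"
proof -
  define t where "t = (LEAST t. \<pi> t \<noteq> t)"
  obtain a where "\<pi> a \<noteq> a" using \<pi>(2) by (auto simp: fun_eq_iff)
  then have t: "\<pi> t \<noteq> t" unfolding t_def by (rule LeastI)
  have fixed: "\<pi> s = s" if "s < t" for s using not_less_Least that unfolding t_def by blast
  have tin: "t \<in> {u..<w}" using permutes_not_in[OF \<pi>(1)] t by blast
  have inj: "\<pi> a = \<pi> b \<longleftrightarrow> a = b" for a b using permutes_inj[OF \<pi>(1)] by (simp add: inj_eq)
  have cmono: "c t \<le> c s" if "s \<in> {u..<w}" "t \<le> s" for s
    using strict_mono_on_leD[OF c tin that] .
  have ceq: "s = t" if "s \<in> {u..<w}" "c s = c t" for s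
    using inj_onD[OF strict_mono_on_imp_inj_on[OF c] that(2,1) tin] .
  let ?x = "v t (c t)"
  have "lookup (\<Sum>s\<in>{u..<w}. Poly_Mapping.single (v (\<pi> s) (c s)) (1::nat)) ?x = 0"
    unfolding lookup_sum
  proof (intro sum.neutral ballI)
    fix s assume s: "s \<in> {u..<w}"
    have "v (\<pi> s) (c s) \<noteq> ?x"
    proof
      assume "v (\<pi> s) (c s) = ?x"
      then have "\<pi> s = t" "c s = c t" using v_eq_iff[OF s\<pi>[OF s] d[OF tin]] by blast+
      then show False using ceq[OF s] t by simp
    qed
    then show "lookup (Poly_Mapping.single (v (\<pi> s) (c s)) (1::nat)) ?x = 0" by (simp add: lookup_single_not_eq)
  qed
  moreover have "lookup (diag u w c) ?x > 0"
  proof -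
    have "lookup (Poly_Mapping.single ?x (1::nat)) ?x \<le> lookup (diag u w c) ?x"
      unfolding diag_def lookup_sum
      by (rule member_le_sum[of t "{u..<w}" "\<lambda>t. lookup (Poly_Mapping.single (v t (c t)) (1::nat)) ?x"]) (use tin in auto)
    then show ?thesis by simp
  qed
  moreover have "lookup (diag u w c) y = lookup (\<Sum>s\<in>{u..<w}. Poly_Mapping.single (v (\<pi> s) (c s)) 1) y"
    if y: "gt y ?x" for y
    unfolding diag_def lookup_sum
  proof (rule sum.cong[OF refl])
    fix s assume s: "s \<in> {u..<w}"
    show "lookup (Poly_Mapping.single (v s (c s)) (1::nat)) y = lookup (Poly_Mapping.single (v (\<pi> s) (c s)) 1) y"
    proof (cases "s < t")
      case True
      then show ?thesis by (simp add: fixed)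
    next
      case False
      have "v s (c s) \<noteq> y"
      proof
        assume "v s (c s) = y"
        then have "s < t \<or> s = t \<and> c s < c t" using gt_iff[OF d[OF s] d[OF tin]] y by simp
        then show False using False by auto
      qed
      moreover have "v (\<pi> s) (c s) \<noteq> y"
      proof
        assume "v (\<pi> s) (c s) = y"
        then have "\<pi> s < t \<or> \<pi> s = t \<and> c s < c t" using gt_iff[OF s\<pi>[OF s] d[OF tin]] y by simp
        then show False
        proof
          assume "\<pi> s < t"
          then show False using fixed[of "\<pi> s"] inj[of "\<pi> s" s] False by simp
        next
          assume "\<pi> s = t \<and> c s < c t"
          then show False using cmono[OF s] False by simp
        qed
      qed
      ultimately show ?thesis by (simp add: lookup_single_not_eq)
    qed
  qed
  ultimately show ?thesis unfolding lex_greater_def by (intro exI[of _ ?x]) auto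
qed

lemma keys_monomial_V:
  assumes "\<And>a. a \<in> A \<Longrightarrow> f a \<in> V"
  shows "keys (\<Sum>a\<in>A. Poly_Mapping.single (f a) (1::nat)) \<subseteq> V"
  using keys_sum[of "\<lambda>a. Poly_Mapping.single (f a) (1::nat)" A] assms by auto

lemma leads_minor:
  assumes c: "strict_mono_on {u..<w} c" and d: "\<And>t. t \<in> {u..<w} \<Longrightarrow> supp t (c t)"
  shows "leads (diag u w c) (interval_minor M u w c)"
proof -
  define m where "m \<pi> = (\<Sum>t\<in>{u..<w}. Poly_Mapping.single (v (\<pi> t) (c t)) (1::nat))" for \<pi>
  define g where "g \<pi> = of_int (sign \<pi>) * (\<Prod>t\<in>{u..<w}. M (\<pi> t) (c t))" for \<pi>
  let ?P = "{\<pi>. \<pi> permutes {u..<w}}"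
  have D: "interval_minor M u w c = (\<Sum>\<pi>\<in>?P. g \<pi>)" unfolding interval_minor_def g_def ..
  have m_id: "m id = diag u w c" by (simp add: m_def diag_def)
  have gs: "g \<pi> = poly_const (of_int (sign \<pi>)) * Poly_Mapping.single (m \<pi>) 1"
    if "\<And>t. t \<in> {u..<w} \<Longrightarrow> supp (\<pi> t) (c t)" for \<pi>
  proof -
    have "(\<Prod>t\<in>{u..<w}. M (\<pi> t) (c t)) = (\<Prod>t\<in>{u..<w}. poly_var (v (\<pi> t) (c t)))"
      by (rule prod.cong) (use that in \<open>auto simp: M_def\<close>)
    then show ?thesis by (simp add: g_def m_def prod_poly_var poly_const_of_int)
  qed
  have key: "keys k \<subseteq> V \<and> mgt (diag u w c) k" if "\<pi> \<in> ?P" "\<pi> \<noteq> id" "k \<in> keys (g \<pi>)" for \<pi> k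
  proof -
    have s: "supp (\<pi> t) (c t)" if "t \<in> {u..<w}" for t
    proof (rule ccontr)
      assume "\<not> ?thesis"
      then have "(\<Prod>t\<in>{u..<w}. M (\<pi> t) (c t)) = 0" using that by (intro prod_zero) (auto simp: M_def)
      then show False using \<open>k \<in> keys (g \<pi>)\<close> by (simp add: g_def)
    qed
    have "g \<pi> = poly_const (of_int (sign \<pi>)) * Poly_Mapping.single (m \<pi>) 1"
      by (rule gs) (rule s)
    then have "k = m \<pi>" using that(3) by (auto simp: in_keys_iff lookup_poly_const_mult lookup_single when_def split: if_splits)
    moreover have "keys (m \<pi>) \<subseteq> V" unfolding m_def by (intro keys_monomial_V v_in_V s)
    moreover have "mgt (diag u w c) (m \<pi>)" unfolding m_def
      by (rule mgt_diag[OF c d _ that(2) s]) (use that(1) in auto)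
    ultimately show ?thesis by simp
  qed
  have gid: "g id = Poly_Mapping.single (diag u w c) 1" using gs[of id] d by (simp add: m_id)
  have idP: "id \<in> ?P" by (simp add: permutes_id)
  have fin: "finite ?P" by (simp add: finite_permutations)
  have lD: "lookup (interval_minor M u w c) k = lookup (g id) k + (\<Sum>\<pi>\<in>?P - {id}. lookup (g \<pi>) k)" for k
    unfolding D lookup_sum using sum.remove[OF fin idP] by blast
  show ?thesis
    unfolding leads_def
  proof (intro conjI ballI impI)
    have "lookup (g \<pi>) (diag u w c) = 0" if "\<pi> \<in> ?P - {id}" for \<pi>
      using key[of \<pi> "diag u w c"] that mgt_irrefl by (auto simp: in_keys_iff)
    then show "lookup (interval_minor M u w c) (diag u w c) = 1"
      unfolding lD by (simp add: gid)
    show "keys (diag u w c) \<subseteq> V" unfolding diag_def by (rule keys_monomial_V) (use d v_in_V in auto)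
    fix k assume k: "k \<in> keys (interval_minor M u w c)" "k \<noteq> diag u w c"
    then have "(\<Sum>\<pi>\<in>?P - {id}. lookup (g \<pi>) k) \<noteq> 0"
      using lD[of k] by (simp add: gid in_keys_iff lookup_single_not_eq)
    then obtain \<pi> where "\<pi> \<in> ?P - {id}" "lookup (g \<pi>) k \<noteq> 0"
      using sum.not_neutral_contains_not_neutral by blast
    then show "keys k \<subseteq> V" "mgt (diag u w c) k" using key[of \<pi> k] by (auto simp: in_keys_iff)
  qed
qed

end

section \<open>Standard products of minors\<close>

lemma prod_list_update2:
  fixes f :: "'b \<Rightarrow> 'r::comm_monoid_mult"
  assumes "i < j" "j < length xs"
  shows "(\<Prod>x\<leftarrow>xs[i := a, j := b]. f x) = f a * f b * (\<Prod>k\<in>{..<length xs} - {i, j}. f (xs ! k))"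
proof -
  have "(\<Prod>x\<leftarrow>xs[i := a, j := b]. f x) = (\<Prod>k<length xs. f (xs[i := a, j := b] ! k))"
    by (simp add: prod.list_conv_set_nth lessThan_atLeast0)
  also have "\<dots> = f (xs[i := a, j := b] ! i) * (\<Prod>k\<in>{..<length xs} - {i}. f (xs[i := a, j := b] ! k))"
    using assms by (intro prod.remove) auto
  also have "(\<Prod>k\<in>{..<length xs} - {i}. f (xs[i := a, j := b] ! k)) =
      f (xs[i := a, j := b] ! j) * (\<Prod>k\<in>{..<length xs} - {i} - {j}. f (xs[i := a, j := b] ! k))"
    using assms by (intro prod.remove) auto
  also have "(\<Prod>k\<in>{..<length xs} - {i} - {j}. f (xs[i := a, j := b] ! k)) = (\<Prod>k\<in>{..<length xs} - {i, j}. f (xs ! k))"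
    by (rule prod.cong) auto
  finally show ?thesis using assms by (simp add: mult.assoc)
qed

lemma sum_update2:
  fixes f :: "nat \<Rightarrow> 'b \<Rightarrow> 'r::comm_monoid_add"
  assumes "i < j" "j < length xs"
  shows "(\<Sum>k<length xs. f k (xs[i := a, j := b] ! k)) = f i a + f j b + (\<Sum>k\<in>{..<length xs} - {i, j}. f k (xs ! k))"
proof -
  have "(\<Sum>k<length xs. f k (xs[i := a, j := b] ! k)) =
      f i (xs[i := a, j := b] ! i) + (\<Sum>k\<in>{..<length xs} - {i}. f k (xs[i := a, j := b] ! k))"
    using assms by (intro sum.remove) auto
  also have "(\<Sum>k\<in>{..<length xs} - {i}. f k (xs[i := a, j := b] ! k)) =
      f j (xs[i := a, j := b] ! j) + (\<Sum>k\<in>{..<length xs} - {i} - {j}. f k (xs[i := a, j := b] ! k))"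
    using assms by (intro sum.remove) auto
  also have "(\<Sum>k\<in>{..<length xs} - {i} - {j}. f k (xs[i := a, j := b] ! k)) = (\<Sum>k\<in>{..<length xs} - {i, j}. f k (xs ! k))"
    by (rule sum.cong) auto
  finally show ?thesis using assms by (simp add: add.assoc)
qed

text \<open>A triple \<open>(u, w, c)\<close> is a tableau column occupying the rows \<open>u..<w\<close>, with entry \<open>c t\<close> in
  row \<open>t\<close>; it stands for the minor with these rows and columns.\<close>

type_synonym tcol = "nat \<times> nat \<times> (nat \<Rightarrow> nat)"

fun covers :: "tcol \<Rightarrow> nat \<Rightarrow> bool" where
  "covers (u, w, c) t \<longleftrightarrow> u \<le> t \<and> t < w"

fun entry :: "tcol \<Rightarrow> nat \<Rightarrow> nat" where
  "entry (u, w, c) t = c t"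

text \<open>Row numbers grow downwards, so a tableau starts with its lowest intervals. In an
  exchange the earlier column then supplies the lower end \<open>w\<close> of the merged row range
  and the later one the upper end \<open>u'\<close>.\<close>

fun tcol_le :: "tcol \<Rightarrow> tcol \<Rightarrow> bool" where
  "tcol_le (u, w, c) (u', w', c') \<longleftrightarrow> u' \<le> u \<and> w' \<le> w"

definition trow :: "tcol list \<Rightarrow> nat \<Rightarrow> nat list" where
  "trow xs t = map (\<lambda>x. entry x t) (filter (\<lambda>x. covers x t) xs)"

text \<open>The column function of a triple is total, but only its values in \<open>{u..<w}\<close>
  belong to the tableau. A tableau can therefore be determined only up to this relation.\<close>

fun same_tcol :: "tcol \<Rightarrow> tcol \<Rightarrow> bool" where
  "same_tcol (u, w, c) (u', w', c') \<longleftrightarrow> u = u' \<and> w = w' \<and> (\<forall>t\<in>{u..<w}. c t = c' t)"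

lemma trow_Nil [simp]: "trow [] t = []"
  by (simp add: trow_def)

lemma trow_Cons: "trow (x # xs) t = (if covers x t then entry x t # trow xs t else trow xs t)"
  by (simp add: trow_def)

lemma length_trow_le: "length (trow xs t) \<le> length xs"
  by (simp add: trow_def)

lemma length_trow_eq: "(\<And>x. x \<in> set xs \<Longrightarrow> covers x t) \<Longrightarrow> length (trow xs t) = length xs"
  by (simp add: trow_def)

lemma trow_eq_Nil_iff: "trow xs t = [] \<longleftrightarrow> (\<forall>x\<in>set xs. \<not> covers x t)"
  by (simp add: trow_def filter_empty_conv)

lemma sorted_trowI:
  "sorted_wrt (\<lambda>x y. covers x t \<longrightarrow> covers y t \<longrightarrow> entry x t \<le> entry y t) xs \<Longrightarrow> sorted (trow xs t)"
  by (induction xs) (auto simp: trow_Cons, auto simp: trow_def)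

text \<open>The first column both starts and ends lowest. Its last row is the last nonempty row, and
  its first row is the first one of full length, because all columns pass through \<open>t0\<close>.
  Its entries are the heads of the rows in between, and removing them leaves the rows of the
  remaining tableau.\<close>

lemma tcols_determined_by_rows:
  assumes "sorted_wrt tcol_le xs" "sorted_wrt tcol_le ys"
    and "\<And>x. x \<in> set xs \<union> set ys \<Longrightarrow> covers x t0"
    and "\<And>t. trow xs t = trow ys t"
  shows "list_all2 same_tcol xs ys"
  using assms
proof (induction xs arbitrary: ys)
  case Nil
  have "trow ys t0 = []" using Nil.prems(4)[of t0] by simp
  then have "y \<notin> set ys" for y using Nil.prems(3)[of y] unfolding trow_eq_Nil_iff by auto
  then have "ys = []" by (cases ys) (auto simp del: split_paired_All)
  then show ?case by simp
next
  case (Cons x xs ys0)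
  obtain y ys where ys0: "ys0 = y # ys"
  proof (cases ys0)
    case Nil
    then have "trow (x # xs) t0 = []" using Cons.prems(4)[of t0] by simp
    then show ?thesis using Cons.prems(3)[of x] by (simp add: trow_Cons)
  qed auto
  note prems = Cons.prems[unfolded ys0]
  obtain u w c where x: "x = (u, w, c)" by (cases x)
  obtain u' w' c' where y: "y = (u', w', c')" by (cases y)
  have core: "u \<le> t0" "t0 < w" "u' \<le> t0" "t0 < w'" using prems(3)[of x] prems(3)[of y] by (auto simp: x y)
  have len: "length xs = length ys"
  proof -
    have "length (trow (x # xs) t0) = length (x # xs)" by (rule length_trow_eq) (use prems(3) in blast)
    moreover have "length (trow (y # ys) t0) = length (y # ys)" by (rule length_trow_eq) (use prems(3) in blast)
    ultimately show ?thesis using prems(4)[of t0] by simp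
  qed
  \<comment> \<open>Row \<open>b - 1\<close> is the last one of a column ending at \<open>b\<close>.
    It is empty in a list whose first column ends at \<open>a < b\<close>, as no later column
    reaches lower.\<close>
  have top: "\<not> a < b" if h: "sorted_wrt tcol_le ((ua, a, ca) # as)" "trow ((ua, a, ca) # as) (b - 1) = trow ((ub, b, cb) # bs) (b - 1)"
    "ub \<le> t0" "t0 < b" "t0 < a" for ua a ca as ub b cb bs
  proof
    assume "a < b"
    have "covers (ub, b, cb) (b - 1)" using h(3,4) by auto
    then have "trow ((ub, b, cb) # bs) (b - 1) \<noteq> []" by (simp add: trow_Cons del: covers.simps)
    then obtain z where z: "z \<in> set ((ua, a, ca) # as)" "covers z (b - 1)" using h(2) trow_eq_Nil_iff by metis
    obtain u2 w2 c2 where z': "z = (u2, w2, c2)" by (cases z)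
    have "w2 \<le> a" using z h(1) by (auto simp: z')
    then show False using z(2) \<open>a < b\<close> unfolding z' covers.simps by linarith
  qed
  \<comment> \<open>Row \<open>a\<close> has full length in the list whose first column starts
    there. If the other first column started later, row \<open>a\<close> of that equally long list
    would be shorter.\<close>
  have bot: "\<not> a < b" if h: "sorted_wrt tcol_le ((a, wa, ca) # as)" "trow ((a, wa, ca) # as) a = trow ((b, wb, cb) # bs) a"
    "\<And>z. z \<in> set ((a, wa, ca) # as) \<Longrightarrow> covers z t0" "length as = length bs" for a wa ca as b wb cb bs
  proof
    assume "a < b"
    have "covers z a" if z: "z \<in> set ((a, wa, ca) # as)" for z
    proof -
      obtain u2 w2 c2 where z': "z = (u2, w2, c2)" by (cases z)
      have "u2 \<le> a" using z \<open>sorted_wrt tcol_le ((a, wa, ca) # as)\<close> by (auto simp: z')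
      moreover have "a \<le> t0" using h(3)[of "(a, wa, ca)"] by simp
      ultimately show ?thesis using h(3)[OF z] by (simp add: z')
    qed
    then have "length (trow ((a, wa, ca) # as) a) = Suc (length as)" by (subst length_trow_eq) auto
    moreover have "length (trow ((b, wb, cb) # bs) a) \<le> length bs"
      using \<open>a < b\<close> length_trow_le[of bs a] by (simp add: trow_Cons)
    ultimately show False using h(2,4) by simp
  qed
  have "\<not> w < w'" by (rule top[where ua=u and ca=c and as=xs and ub=u' and cb=c' and bs=ys]) (use prems core in \<open>auto simp: x y\<close>)
  moreover have "\<not> w' < w" by (rule top[where ua=u' and ca=c' and as=ys and ub=u and cb=c and bs=xs]) (use prems core in \<open>auto simp: x y\<close>)
  ultimately have w: "w = w'" by simp
  have "\<not> u < u'" by (rule bot[where wa=w and ca=c and as=xs and wb=w' and cb=c' and bs=ys]) (use prems len in \<open>auto simp: x y\<close>)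
  moreover have "\<not> u' < u" by (rule bot[where wa=w' and ca=c' and as=ys and wb=w and cb=c and bs=xs]) (use prems len in \<open>auto simp: x y\<close>)
  ultimately have u: "u = u'" by simp
  have "c t = c' t" if "t \<in> {u..<w}" for t
    using prems(4)[of t] that by (simp add: x y u w trow_Cons)
  moreover have "list_all2 same_tcol xs ys"
  proof (rule Cons.IH)
    show "trow xs t = trow ys t" for t
      using prems(4)[of t] by (simp add: x y u w trow_Cons split: if_splits)
  qed (use prems in auto)
  ultimately show ?case by (simp add: ys0 x y u w)
qed

locale staircase_shapes = staircase supp v gt
  for supp :: "nat \<Rightarrow> nat \<Rightarrow> bool" and v :: "nat \<Rightarrow> nat \<Rightarrow> 'x" and gt :: "'x \<Rightarrow> 'x \<Rightarrow> bool" +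
  fixes Sh :: "(nat \<times> nat) set" and t0 N :: nat
  assumes shape_core: "(u, w) \<in> Sh \<Longrightarrow> u \<le> t0 \<and> t0 < w"
    and shape_chain: "(u, w) \<in> Sh \<Longrightarrow> (u', w') \<in> Sh \<Longrightarrow> u \<le> u' \<and> w \<le> w' \<or> u' \<le> u \<and> w' \<le> w"
begin

fun admissible :: "tcol \<Rightarrow> bool" where
  "admissible (u, w, c) \<longleftrightarrow> (u, w) \<in> Sh \<and> (\<forall>t\<in>{u..<w}. c t < N)"

fun increasing :: "tcol \<Rightarrow> bool" where
  "increasing (u, w, c) \<longleftrightarrow> strict_mono_on {u..<w} c"

fun supported :: "tcol \<Rightarrow> bool" where
  "supported (u, w, c) \<longleftrightarrow> (\<forall>t\<in>{u..<w}. supp t (c t))"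

fun tminor :: "tcol \<Rightarrow> 'x cpoly" where
  "tminor (u, w, c) = interval_minor M u w c"

fun tdiag :: "tcol \<Rightarrow> 'x monomial" where
  "tdiag (u, w, c) = diag u w c"

section \<open>Standard tableaux and their initial monomials\<close>

definition standard :: "tcol list \<Rightarrow> bool" where
  "standard xs \<longleftrightarrow> sorted_wrt tcol_le xs \<and> (\<forall>x\<in>set xs. admissible x \<and> increasing x \<and> supported x) \<and>
     (\<forall>t. sorted (trow xs t))"

definition tprod :: "tcol list \<Rightarrow> 'x cpoly" where
  "tprod xs = (\<Prod>x\<leftarrow>xs. tminor x)"

definition tmon :: "tcol list \<Rightarrow> 'x monomial" where
  "tmon xs = (\<Sum>x\<leftarrow>xs. tdiag x)"

lemma admissible_covers_core: "admissible x \<Longrightarrow> covers x t0"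
  using shape_core by (cases x) auto

lemma leads_tminor: "increasing x \<Longrightarrow> supported x \<Longrightarrow> leads (tdiag x) (tminor x)"
  by (cases x) (auto intro: leads_minor)

lemma leads_tprod: "standard xs \<Longrightarrow> leads (tmon xs) (tprod xs)"
  unfolding tmon_def tprod_def by (rule leads_prod_list) (auto simp: standard_def leads_tminor)

lemma tminor_cong: "same_tcol x y \<Longrightarrow> tminor x = tminor y"
  by (cases x; cases y) (auto intro: interval_minor_cong)

lemma tprod_cong: "list_all2 same_tcol xs ys \<Longrightarrow> tprod xs = tprod ys"
  unfolding tprod_def by (induction rule: list_all2_induct) (auto simp: tminor_cong)

lemma lookup_tdiag:
  assumes "supported x" "supp t d"
  shows "lookup (tdiag x) (v t d) = (if covers x t \<and> entry x t = d then 1 else 0)"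
proof -
  obtain u w c where x: "x = (u, w, c)" by (cases x)
  have "lookup (tdiag x) (v t d) = (\<Sum>s\<in>{u..<w}. if s = t then (if c t = d then 1 else 0) else 0)"
    unfolding x tdiag.simps diag_def lookup_sum
  proof (rule sum.cong[OF refl])
    fix s assume "s \<in> {u..<w}"
    then have "supp s (c s)" using assms(1) by (simp add: x)
    then have "v s (c s) = v t d \<longleftrightarrow> s = t \<and> c s = d" using assms(2) by (rule v_eq_iff)
    then show "lookup (Poly_Mapping.single (v s (c s)) 1) (v t d) = (if s = t then (if c t = d then 1 else 0) else 0)"
      by (auto simp: lookup_single when_def)
  qed
  then show ?thesis by (simp add: x)
qed

lemma lookup_tmon:
  assumes "\<And>x. x \<in> set xs \<Longrightarrow> supported x" "supp t d"
  shows "lookup (tmon xs) (v t d) = count (mset (trow xs t)) d"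
  using assms(1)
proof (induction xs)
  case (Cons x xs)
  then have "lookup (tmon xs) (v t d) = count (mset (trow xs t)) d" by simp
  then show ?case using lookup_tdiag[OF Cons.prems[of x] assms(2)]
    by (simp add: tmon_def lookup_add trow_Cons)
qed (simp add: tmon_def)

lemma supp_trow: "(\<And>x. x \<in> set xs \<Longrightarrow> supported x) \<Longrightarrow> d \<in> set (trow xs t) \<Longrightarrow> supp t d"
  by (induction xs) (auto simp: trow_Cons split: if_splits, metis atLeastLessThan_iff covers.simps entry.simps prod_cases3 supported.simps)

lemma tprod_determined_by_tmon:
  assumes xs: "standard xs" and ys: "standard ys" and eq: "tmon xs = tmon ys"
  shows "tprod xs = tprod ys"
proof (rule tprod_cong, rule tcols_determined_by_rows[of _ _ t0])
  fix t
  have sx: "supported x" if "x \<in> set xs \<union> set ys" for x using xs ys that by (auto simp: standard_def)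
  have "mset (trow xs t) = mset (trow ys t)"
  proof (rule multiset_eqI)
    fix d
    show "count (mset (trow xs t)) d = count (mset (trow ys t)) d"
    proof (cases "supp t d")
      case True
      then show ?thesis using lookup_tmon[of xs t d] lookup_tmon[of ys t d] sx eq by simp
    next
      case False
      \<comment> \<open>At a position outside the support there is no variable from which to read an
        exponent, but supported columns have no entry there.\<close>
      then have "d \<notin> set (trow xs t)" "d \<notin> set (trow ys t)" using supp_trow sx by blast+
      then have "count (mset (trow xs t)) d = 0" "count (mset (trow ys t)) d = 0"
        by (simp_all add: not_in_iff[symmetric])
      then show ?thesis by (simp only:)
    qed
  qed
  moreover have "sorted (trow xs t)" "sorted (trow ys t)" using xs ys by (auto simp: standard_def)
  ultimately show "trow xs t = trow ys t" by (metis properties_for_sort)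
qed (use xs ys admissible_covers_core in \<open>auto simp: standard_def\<close>)

section \<open>Straightening by descent\<close>

fun weight :: "tcol \<Rightarrow> nat" where
  "weight (u, w, c) = (\<Sum>t\<in>{u..<w}. N - c t)"

text \<open>An exchange keeps the total weight and lowers the entries of the earlier column, so it
  moves weight from position \<open>j\<close> to position \<open>i < j\<close>; the factor
  \<open>k\<close> turns this into a strict decrease. The weights are complements to
  \<open>N\<close> because with the entries themselves the number would increase.\<close>

definition energy :: "tcol list \<Rightarrow> nat" where
  "energy xs = (\<Sum>k<length xs. k * weight (xs ! k))"

lemma weight_add_sum:
  assumes "admissible (u, w, c)"
  shows "weight (u, w, c) + sum c {u..<w} = (w - u) * N"
proof -
  have "weight (u, w, c) + sum c {u..<w} = (\<Sum>t\<in>{u..<w}. N - c t + c t)"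
    by (simp add: sum.distrib)
  also have "\<dots> = (\<Sum>t\<in>{u..<w}. N)"
    by (rule sum.cong) (use assms in \<open>auto simp: less_imp_le\<close>)
  finally show ?thesis by simp
qed

lemma sort_tcol:
  assumes "admissible (u, w, c)" "inj_on c {u..<w}"
  shows "\<exists>c' e. admissible (u, w, c') \<and> increasing (u, w, c') \<and> weight (u, w, c') = weight (u, w, c) \<and>
    tminor (u, w, c) = of_int e * tminor (u, w, c')"
proof -
  obtain \<tau> where \<tau>: "\<tau> permutes {u..<w}" "strict_mono_on {u..<w} (c \<circ> \<tau>)"
    using interval_minor_sort_cols[OF assms(2)] .
  have adm: "admissible (u, w, c \<circ> \<tau>)"
    using assms(1) permutes_in_image[OF \<tau>(1)] by auto
  have "sum (c \<circ> \<tau>) {u..<w} = sum c {u..<w}" using sum.permute[OF \<tau>(1), of c] by (simp only:)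
  then have "weight (u, w, c \<circ> \<tau>) = weight (u, w, c)"
    using weight_add_sum[OF adm] weight_add_sum[OF assms(1)] by simp
  moreover have "tminor (u, w, c) = of_int (sign \<tau>) * tminor (u, w, c \<circ> \<tau>)"
  proof -
    have "of_int (sign \<tau>) * tminor (u, w, c \<circ> \<tau>) = (of_int (sign \<tau>) * of_int (sign \<tau>)) * tminor (u, w, c)"
      by (simp only: tminor.simps interval_minor_permute_cols[OF \<tau>(1)] mult.assoc)
    also have "of_int (sign \<tau>) * of_int (sign \<tau>) = (1 :: 'x cpoly)" by (simp add: sign_def)
    finally show ?thesis by (simp only: mult_1)
  qed
  ultimately show ?thesis using adm \<tau>(2) by (intro exI[of _ "c \<circ> \<tau>"] exI[of _ "sign \<tau>"]) simp
qed

text \<open>Exchanged columns need not increase. Either one of them repeats an index and the product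
  vanishes, or sorting every column changes the product only by a sign and keeps the energy, so the
  descent is not disturbed.\<close>

lemma sort_tcols:
  assumes "\<And>x. x \<in> set xs \<Longrightarrow> admissible x" "sorted_wrt tcol_le xs"
  shows "tprod xs = 0 \<or> (\<exists>ys e. sorted_wrt tcol_le ys \<and> (\<forall>y\<in>set ys. admissible y \<and> increasing y) \<and>
    energy ys = energy xs \<and> tprod xs = of_int e * tprod ys)"
proof (cases "\<exists>(u, w, c)\<in>set xs. \<not> inj_on c {u..<w}")
  case True
  then obtain u w c where "(u, w, c) \<in> set xs" "\<not> inj_on c {u..<w}" by blast
  then have "0 \<in> set (map tminor xs)" using interval_minor_repeated_col[of c u w M] by force
  then show ?thesis unfolding tprod_def by (intro disjI1 prod_list_eq_0)
next
  case False
  have "\<forall>x\<in>set xs. \<exists>y e. tcol_le x y \<and> tcol_le y x \<and> admissible y \<and> increasing y \<and> weight y = weight x \<and>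
      tminor x = of_int e * tminor y"
  proof
    fix x assume x: "x \<in> set xs"
    obtain u w c where xe: "x = (u, w, c)" by (cases x)
    have "inj_on c {u..<w}" using False x xe by blast
    then obtain c' e where "admissible (u, w, c')" "increasing (u, w, c')" "weight (u, w, c') = weight x"
      "tminor x = of_int e * tminor (u, w, c')"
      using sort_tcol[of u w c] assms(1)[OF x] xe by blast
    then show "\<exists>y e. tcol_le x y \<and> tcol_le y x \<and> admissible y \<and> increasing y \<and> weight y = weight x \<and>
      tminor x = of_int e * tminor y"
      by (intro exI[of _ "(u, w, c')"] exI[of _ e]) (simp add: xe)
  qed
  then obtain f e where f: "\<And>x. x \<in> set xs \<Longrightarrow> tcol_le x (f x) \<and> tcol_le (f x) x \<and> admissible (f x) \<and>
      increasing (f x) \<and> weight (f x) = weight x \<and> tminor x = of_int (e x) * tminor (f x)" by metis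
  have trans: "tcol_le x z" if "tcol_le x y" "tcol_le y z" for x y z
    using that by (cases x; cases y; cases z) auto
  have "sorted_wrt tcol_le (map f xs)"
    unfolding sorted_wrt_map using assms(2)
    by (rule sorted_wrt_mono_rel[rotated]) (meson f trans)
  moreover have "energy (map f xs) = energy xs"
    unfolding energy_def by (simp add: f)
  moreover have "tprod xs = of_int (prod_list (map e xs)) * tprod (map f xs)"
    using f unfolding tprod_def
  proof (induction xs)
    case (Cons x xs)
    have "tminor x = of_int (e x) * tminor (f x)" using Cons.prems[of x] by simp
    moreover have "(\<Prod>x\<leftarrow>xs. tminor x) = of_int (prod_list (map e xs)) * (\<Prod>x\<leftarrow>map f xs. tminor x)"
      using Cons.IH Cons.prems by simp
    ultimately show ?case by (simp add: mult_ac)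
  qed simp
  ultimately show ?thesis using f by (intro disjI2 exI[of _ "map f xs"] exI[of _ "prod_list (map e xs)"]) auto
qed

text \<open>Every other term of the exchange relation for a violation of row monotonicity moves smaller
  entries to the left, which lowers the energy.\<close>

lemma exchange_step:
  assumes sorted: "sorted_wrt tcol_le xs" and xs: "\<And>x. x \<in> set xs \<Longrightarrow> admissible x \<and> increasing x"
    and ij: "i < j" "j < length xs"
    and r: "covers (xs ! i) r" "covers (xs ! j) r" "\<not> entry (xs ! i) r \<le> entry (xs ! j) r"
    and IH: "\<And>ys. energy ys < energy xs \<Longrightarrow> (\<And>y. y \<in> set ys \<Longrightarrow> admissible y) \<Longrightarrow> sorted_wrt tcol_le ys \<Longrightarrow>
      tprod ys \<in> cpoly.span B"
  shows "tprod xs \<in> cpoly.span B"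
proof -
  obtain u w c where x: "xs ! i = (u, w, c)" by (cases "xs ! i")
  obtain u' w' c' where y: "xs ! j = (u', w', c')" by (cases "xs ! j")
  have adm: "admissible (u, w, c)" "admissible (u', w', c')"
    and inc: "strict_mono_on {u..<w} c" "strict_mono_on {u'..<w'} c'"
    using xs[of "xs ! i"] xs[of "xs ! j"] nth_mem[of i xs] nth_mem[of j xs] ij by (auto simp: x y)
  have "tcol_le (xs ! i) (xs ! j)" using sorted ij by (simp add: sorted_wrt_iff_nth_less)
  then have le: "u' \<le> u" "u \<le> r" "r < w'" "w' \<le> w" and viol: "c' r < c r" using r by (auto simp: x y)
  define Z where "Z \<sigma> = xs[i := (u, w, exch_fst r c c' \<sigma>), j := (u', w', exch_snd r c c' \<sigma>)]" for \<sigma>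
  define R where "R = (\<Prod>k\<in>{..<length xs} - {i, j}. tminor (xs ! k))"
  let ?S = "{u'..<Suc w}"
  let ?P = "{\<sigma>. \<sigma> permutes ?S}"
  \<comment> \<open>The stabiliser of the first group of positions; by \<open>exch_stable\<close>
    each of its terms equals the original product.\<close>
  define G where "G = {\<sigma> \<in> ?P. \<sigma> ` {u'..<Suc r} = {u'..<Suc r}}"
  have xs_upd: "xs = xs[i := (u, w, c), j := (u', w', c')]" by (metis x y list_update_id)
  have P0: "tprod xs = interval_minor M u w c * interval_minor M u' w' c' * R"
    unfolding tprod_def R_def by (subst xs_upd, subst prod_list_update2[OF ij]) simp
  have PZ: "tprod (Z \<sigma>) = interval_minor M u w (exch_fst r c c' \<sigma>) * interval_minor M u' w' (exch_snd r c c' \<sigma>) * R" for \<sigma>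
    unfolding tprod_def R_def Z_def by (subst prod_list_update2[OF ij]) simp
  have fin: "finite ?P" by (simp add: finite_permutations)
  have "(\<Sum>\<sigma>\<in>?P. of_int (sign \<sigma>) * tprod (Z \<sigma>)) = 0"
  proof -
    have "(\<Sum>\<sigma>\<in>?P. of_int (sign \<sigma>) * tprod (Z \<sigma>)) = (\<Sum>\<sigma>\<in>?P. of_int (sign \<sigma>) *
        (interval_minor M u w (exch_fst r c c' \<sigma>) * interval_minor M u' w' (exch_snd r c c' \<sigma>))) * R"
      unfolding PZ sum_distrib_right by (simp only: mult.assoc)
    then show ?thesis by (simp only: exchange_relation[OF le] mult_zero_left)
  qed
  moreover have "(\<Sum>\<sigma>\<in>?P. of_int (sign \<sigma>) * tprod (Z \<sigma>)) =
      (\<Sum>\<sigma>\<in>G. of_int (sign \<sigma>) * tprod (Z \<sigma>)) + (\<Sum>\<sigma>\<in>?P - G. of_int (sign \<sigma>) * tprod (Z \<sigma>))"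
    by (subst add.commute, rule sum.subset_diff[OF _ fin]) (auto simp: G_def)
  moreover have "(\<Sum>\<sigma>\<in>G. of_int (sign \<sigma>) * tprod (Z \<sigma>)) = of_nat (card G) * tprod xs"
  proof -
    have "of_int (sign \<sigma>) * tprod (Z \<sigma>) = tprod xs" if "\<sigma> \<in> G" for \<sigma>
    proof -
      have \<sigma>: "\<sigma> permutes ?S" "\<sigma> ` {u'..<Suc r} = {u'..<Suc r}" using that by (auto simp: G_def)
      show ?thesis unfolding PZ P0 exch_stable[OF le \<sigma>, of M c c', symmetric] by (simp only: mult.assoc)
    qed
    then show ?thesis by simp
  qed
  ultimately have eq: "of_nat (card G) * tprod xs = - (\<Sum>\<sigma>\<in>?P - G. of_int (sign \<sigma>) * tprod (Z \<sigma>))"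
    by (simp add: eq_neg_iff_add_eq_0)
  have Zspan: "tprod (Z \<sigma>) \<in> cpoly.span B" if "\<sigma> \<in> ?P - G" for \<sigma>
  proof (rule IH)
    have \<sigma>: "\<sigma> permutes ?S" "\<sigma> ` {u'..<Suc r} \<noteq> {u'..<Suc r}" using that by (auto simp: G_def)
    let ?a = "(u, w, exch_fst r c c' \<sigma>)" and ?b = "(u', w', exch_snd r c c' \<sigma>)"
    have adm': "admissible ?a" "admissible ?b"
      using adm exch_less[OF le \<sigma>(1), of c N c'] by auto
    show "admissible z" if "z \<in> set (Z \<sigma>)" for z
    proof -
      have "set (Z \<sigma>) \<subseteq> insert ?b (insert ?a (set xs))"
        unfolding Z_def using set_update_subset_insert[of "xs[i := ?a]" j ?b] set_update_subset_insert[of xs i ?a] by blast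
      then show ?thesis using that adm' xs by blast
    qed
    show "sorted_wrt tcol_le (Z \<sigma>)"
      unfolding sorted_wrt_iff_nth_less
    proof (intro allI impI)
      fix k l assume kl: "k < l" "l < length (Z \<sigma>)"
      \<comment> \<open>The exchange keeps the row intervals at the positions \<open>i\<close> and
        \<open>j\<close>, and \<open>tcol_le\<close> sees nothing else.\<close>
      have shape: "tcol_le (xs ! k) z = tcol_le (Z \<sigma> ! k) z \<and> tcol_le z (xs ! k) = tcol_le z (Z \<sigma> ! k)" if "k < length xs" for k z
        using that ij x y by (cases z) (auto simp: Z_def nth_list_update)
      have len: "length (Z \<sigma>) = length xs" by (simp add: Z_def)
      have "tcol_le (xs ! k) (xs ! l)" using sorted kl len by (simp add: sorted_wrt_iff_nth_less)
      then show "tcol_le (Z \<sigma> ! k) (Z \<sigma> ! l)" using shape[of k] shape[of l] kl len by simp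
    qed
    show "energy (Z \<sigma>) < energy xs"
    proof -
      define E where "E = (\<Sum>k\<in>{..<length xs} - {i, j}. k * weight (xs ! k))"
      have Z: "energy (Z \<sigma>) = i * weight ?a + j * weight ?b + E"
        unfolding energy_def Z_def E_def by (simp only: length_list_update sum_update2[OF ij, of "\<lambda>k x. k * weight x"])
      have X: "energy xs = i * weight (u, w, c) + j * weight (u', w', c') + E"
        unfolding energy_def E_def
        using sum_update2[OF ij, of "\<lambda>k x. k * weight x" "(u, w, c)" "(u', w', c')"] unfolding xs_upd[symmetric] .
      have less: "a < a'" if "a' + s' = n" "a + s = n" "s' < s" for a a' s s' n :: nat
        using that by linarith
      have lt: "weight (u, w, c) < weight ?a"
        by (rule less[OF weight_add_sum[OF adm'(1)] weight_add_sum[OF adm(1)] sum_exch_fst_less[OF le \<sigma> inc viol]])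
      obtain d where d: "weight ?a = weight (u, w, c) + d" "0 < d"
        using less_imp_add_positive[OF lt] by (metis (no_types))
      have eq: "b = b' + d" if "a' + s' = m" "a + s = m" "b' + q' = n" "b + q = n" "s' + q' = s + q" "a' = a + d"
        for a a' s s' m b b' q q' n :: nat
        using that by linarith
      have "weight (u', w', c') = weight ?b + d"
        by (rule eq[OF weight_add_sum[OF adm'(1)] weight_add_sum[OF adm(1)] weight_add_sum[OF adm'(2)]
              weight_add_sum[OF adm(2)] sum_exch_add[OF le \<sigma>(1)] d(1)])
      moreover have "i * (a + d) + j * b + E < i * a + j * (b + d) + E" for a b
        using d(2) ij(1) by (simp add: algebra_simps)
      ultimately show ?thesis unfolding Z X d(1) by (simp only:)
    qed
  qed
  have "(\<Sum>\<sigma>\<in>?P - G. of_int (sign \<sigma>) * tprod (Z \<sigma>)) \<in> cpoly.span B"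
    unfolding poly_const_of_int[symmetric] by (intro cpoly.span_sum cpoly.span_scale Zspan)
  then have "of_nat (card G) * tprod xs \<in> cpoly.span B" unfolding eq by (rule cpoly.span_neg)
  \<comment> \<open>Characteristic zero enters here: the original product occurs
    \<open>card G\<close> times, and this number is inverted.\<close>
  then have "poly_const (1 / of_nat (card G)) * (poly_const (of_nat (card G)) * tprod xs) \<in> cpoly.span B"
    unfolding poly_const_of_nat by (rule cpoly.span_scale)
  moreover have "card G \<noteq> 0"
  proof -
    have "id \<in> G" by (simp add: G_def permutes_id)
    moreover have "finite G" using fin by (simp add: G_def)
    ultimately show ?thesis by auto
  qed
  ultimately show ?thesis by (simp add: mult.assoc[symmetric] poly_const_mult[symmetric])
qed

definition standard_products :: "'x cpoly set" where
  "standard_products = tprod ` {xs. standard xs}"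

text \<open>Sorting within the columns leaves the energy unchanged. If the result is not standard,
  either some column leaves the support and the product is zero, or some row is out of order and an
  exchange leads to products of smaller energy.\<close>

lemma straighten_sorted:
  assumes "\<And>x. x \<in> set xs \<Longrightarrow> admissible x" "sorted_wrt tcol_le xs"
  shows "tprod xs \<in> cpoly.span standard_products"
  using assms
proof (induction "energy xs" arbitrary: xs rule: less_induct)
  case (less xs0)
  have "\<exists>ys e. sorted_wrt tcol_le ys \<and> (\<forall>y\<in>set ys. admissible y \<and> increasing y) \<and>
      energy ys = energy xs0 \<and> tprod xs0 = of_int e * tprod ys" if "tprod xs0 \<noteq> 0"
    using sort_tcols[OF less.prems] that by blast
  then consider "tprod xs0 = 0" | xs e where "sorted_wrt tcol_le xs" "\<And>x. x \<in> set xs \<Longrightarrow> admissible x \<and> increasing x"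
    "energy xs = energy xs0" "tprod xs0 = of_int e * tprod xs" by metis
  then show ?case
  proof cases
    case 1
    then show ?thesis by (simp add: cpoly.span_zero)
  next
    case (2 xs e)
    have "tprod xs \<in> cpoly.span standard_products"
    proof (cases "standard xs")
      case True
      then show ?thesis by (intro cpoly.span_base) (auto simp: standard_products_def)
    next
      case False
      show ?thesis
      proof (cases "\<forall>x\<in>set xs. supported x")
        case False
        then obtain u w c where x: "(u, w, c) \<in> set xs" "\<not> supported (u, w, c)" by (metis prod_cases3)
        then obtain t where "t \<in> {u..<w}" "\<not> supp t (c t)" by auto
        then have "tminor (u, w, c) = 0" using minor_eq_0[of u w c t] 2(2)[OF x(1)] by simp
        then have "0 \<in> set (map tminor xs)" using x(1) by force
        then show ?thesis unfolding tprod_def by (simp add: prod_list_eq_0 cpoly.span_zero)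
      next
        case True
        then have "\<exists>r. \<not> sorted (trow xs r)" using False 2(1,2) by (auto simp: standard_def)
        then obtain r where r: "\<not> sorted (trow xs r)" by blast
        have "\<not> sorted_wrt (\<lambda>x y. covers x r \<longrightarrow> covers y r \<longrightarrow> entry x r \<le> entry y r) xs"
          using r sorted_trowI by blast
        then obtain i j where ij: "i < j" "j < length xs" and
          viol: "covers (xs ! i) r" "covers (xs ! j) r" "\<not> entry (xs ! i) r \<le> entry (xs ! j) r"
          unfolding sorted_wrt_iff_nth_less by blast
        show ?thesis
          by (rule exchange_step[OF 2(1,2) ij viol less.hyps]) (simp_all add: 2(3))
      qed
    qed
    then have "poly_const (of_int e) * tprod xs \<in> cpoly.span standard_products" by (rule cpoly.span_scale)
    then show ?thesis using 2(4) by (simp add: poly_const_of_int)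
  qed
qed

lemma straighten:
  assumes "\<And>x. x \<in> set xs \<Longrightarrow> admissible x"
  shows "tprod xs \<in> cpoly.span standard_products"
proof -
  \<comment> \<open>In a chain of intervals the sum of the two ends decides the comparison: if the
    sums are ordered, so are both ends.\<close>
  define key :: "tcol \<Rightarrow> nat" where "key = (\<lambda>(u, w, c). u + w)"
  define ys where "ys = rev (sort_key key xs)"
  have ys: "mset ys = mset xs" by (simp add: ys_def)
  have set: "set ys = set xs" by (simp add: ys_def)
  have "sorted_wrt (\<lambda>x y. key y \<le> key x) ys"
    unfolding ys_def sorted_wrt_rev using sorted_sort_key[of key xs] by (simp add: sorted_wrt_map)
  moreover have "tcol_le x y" if "x \<in> set ys" "y \<in> set ys" "key y \<le> key x" for x y
  proof -
    obtain u w c u' w' c' where xy: "x = (u, w, c)" "y = (u', w', c')" by (cases x; cases y)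
    have "admissible x" "admissible y" using that assms set by auto
    then show ?thesis using shape_chain[of u w u' w'] that(3) by (auto simp: xy key_def)
  qed
  ultimately have "sorted_wrt tcol_le ys" by (rule sorted_wrt_mono_rel[rotated])
  then have "tprod ys \<in> cpoly.span standard_products"
    using straighten_sorted assms set by blast
  moreover have "tprod ys = tprod xs"
    unfolding tprod_def using ys by (metis mset_map prod_mset_prod_list)
  ultimately show ?thesis by simp
qed

section \<open>The SAGBI property\<close>

definition minor_set :: "'x cpoly set" where
  "minor_set = {tminor x | x. admissible x \<and> increasing x}"

lemma standard_products_mult:
  assumes "p \<in> standard_products" "q \<in> standard_products"
  shows "p * q \<in> cpoly.span standard_products"
proof -
  obtain xs ys where *: "p = tprod xs" "q = tprod ys" "standard xs" "standard ys"
    using assms by (auto simp: standard_products_def)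
  have "tprod (xs @ ys) \<in> cpoly.span standard_products"
    by (rule straighten) (use * in \<open>auto simp: standard_def\<close>)
  then show ?thesis by (simp add: * tprod_def)
qed

text \<open>The two sets are compared only up to 0, since a zero minor may belong to one of them and
  not to the other. The factors of a standard product are nonzero, so \<open>F - {0}\<close>
  supplies all of them.\<close>

theorem minors_SAGBI:
  assumes fin: "finite F" and F: "F \<subseteq> minor_set \<union> {0}" "minor_set \<subseteq> F \<union> {0}"
  shows "is_SAGBI_basis mgt (is_subalgebra hull F) F"
proof -
  let ?B = standard_products
  have one: "1 \<in> ?B"
    unfolding standard_products_def by (rule image_eqI[of _ _ "[]"]) (simp_all add: tprod_def standard_def)
  have "is_subalgebra (cpoly.span ?B)"
    unfolding is_subalgebra_def
  proof (intro conjI ballI subsetI)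
    fix p :: "'x cpoly" assume "p \<in> range poly_const"
    then obtain k where "p = poly_const k * 1" by auto
    then show "p \<in> cpoly.span ?B" using cpoly.span_scale[OF cpoly.span_base[OF one]] by simp
  qed (auto intro: cpoly.span_add cpoly_span_mult standard_products_mult)
  moreover have "F \<subseteq> cpoly.span ?B"
  proof
    fix p assume "p \<in> F"
    then consider "p = 0" | x where "p = tminor x" "admissible x" using F(1) by (auto simp: minor_set_def)
    then show "p \<in> cpoly.span ?B"
    proof cases
      case 2
      then show ?thesis using straighten[of "[x]"] by (simp add: tprod_def)
    qed (simp add: cpoly.span_zero)
  qed
  ultimately have sub: "is_subalgebra hull F \<subseteq> cpoly.span ?B" by (intro hull_minimal)
  \<comment> \<open>Different lists of columns can give the same product, so the leading monomial is
    attached to the polynomial and not to the list.\<close>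
  define \<mu> where "\<mu> b = (SOME m. leads m b)" for b :: "'x cpoly"
  have \<mu>: "\<mu> (tprod xs) = tmon xs" if "standard xs" for xs
  proof -
    have "leads (\<mu> (tprod xs)) (tprod xs)" unfolding \<mu>_def using leads_tprod[OF that] by (rule someI)
    then have "Poly_Mapping.single (\<mu> (tprod xs)) (1::complex) = Poly_Mapping.single (tmon xs) 1"
      using leads_initial_monomial leads_tprod[OF that] by metis
    then show ?thesis by (metis keys_single one_neq_zero singleton_inject)
  qed
  have leadB: "leads (\<mu> b) b" if "b \<in> ?B" for b
    using that by (auto simp: standard_products_def \<mu> leads_tprod)
  have inj: "inj_on \<mu> ?B"
  proof (rule inj_onI)
    fix p q assume "p \<in> ?B" "q \<in> ?B" "\<mu> p = \<mu> q"
    then show "p = q" by (auto simp: standard_products_def \<mu> intro: tprod_determined_by_tmon)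
  qed
  show ?thesis
    unfolding is_SAGBI_basis_def
  proof (intro conjI ballI impI)
    fix f assume "f \<in> is_subalgebra hull F" "f \<noteq> 0"
    then obtain b where b: "b \<in> ?B" "initial_monomial mgt f = Poly_Mapping.single (\<mu> b) 1"
      using span_initial_monomial[of f ?B \<mu>] sub leadB inj by blast
    then obtain xs where xs: "standard xs" "b = tprod xs" by (auto simp: standard_products_def)
    have x: "admissible x" "increasing x" "leads (tdiag x) (tminor x)" if "x \<in> set xs" for x
      using xs(1) that leads_tminor by (auto simp: standard_def)
    have "set (map tminor xs) \<subseteq> F - {0}"
    proof
      fix p assume "p \<in> set (map tminor xs)"
      then obtain y where y: "y \<in> set xs" "p = tminor y" by auto
      then have "p \<in> minor_set" using x(1,2)[of y] unfolding minor_set_def by blast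
      moreover have "p \<noteq> 0" using leads_not_0[OF x(3)[OF y(1)]] y(2) by simp
      ultimately show "p \<in> F - {0}" using F(2) by blast
    qed
    moreover have "map (initial_monomial mgt) (map tminor xs) = map (\<lambda>x. Poly_Mapping.single (tdiag x) 1) xs"
      using leads_initial_monomial[OF x(3)] by simp
    then have "initial_monomial mgt f = prod_list (map (initial_monomial mgt) (map tminor xs))"
      by (simp only: prod_list_single b(2) xs(2) \<mu>[OF xs(1)] tmon_def)
    ultimately show "\<exists>gs. set gs \<subseteq> F - {0} \<and> initial_monomial mgt f = prod_list (map (initial_monomial mgt) gs)"
      by blast
  qed (auto simp: is_subalgebra_hull fin intro: hull_inc)
qed

end

section \<open>The two branches of a Y-shaped quiver\<close>

text \<open>Descending along \<open>p\<close> ends at 1, and injectivity excludes branching, so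
  \<open>insert 1 S\<close> is a single chain and none of its elements lies strictly between
  \<open>p j\<close> and \<open>j\<close>. In the induction, \<open>p i < p j\<close> follows from
  the pair \<open>(p i, j)\<close>, and the pair \<open>(p j, i)\<close> refutes
  \<open>p j < i\<close>.\<close>

lemma le_pred_of_inj_pred:
  fixes p :: "nat \<Rightarrow> nat"
  assumes pred: "\<And>i. i \<in> S \<Longrightarrow> 1 \<le> p i \<and> p i < i \<and> p i \<in> insert 1 S"
    and inj: "\<And>i j. i \<in> S \<Longrightarrow> j \<in> S \<Longrightarrow> p i = p j \<Longrightarrow> i = j"
    and "i \<in> insert 1 S" "j \<in> insert 1 S" "i < j"
  shows "i \<le> p j"
  using assms(3-)
proof (induction "i + j" arbitrary: i j rule: less_induct)
  case less
  have ge1: "1 \<le> k" if "k \<in> insert 1 S" for k using that pred[of k] by auto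
  have j: "j \<in> S" using less.prems ge1[of i] by auto
  show ?case
  proof (cases "i = 1")
    case True
    then show ?thesis using pred[OF j] by simp
  next
    case False
    then have i: "i \<in> S" using less.prems by simp
    have "p i \<le> p j" using less.hyps[of "p i" j] pred[OF i] less.prems by simp
    moreover have "p i \<noteq> p j" using inj[OF i j] less.prems by blast
    ultimately have lt: "p i < p j" by simp
    show ?thesis
    proof (rule ccontr)
      assume "\<not> i \<le> p j"
      then have "p j \<le> p i" using less.hyps[of "p j" i] pred[OF j] less.prems by simp
      then show False using lt by simp
    qed
  qed
qed

locale Y_quiver =
  fixes Q :: "(nat, 'a) pre_digraph" and \<rho> :: nat and r :: "nat \<Rightarrow> nat" and S1 S2 :: "nat set"
  assumes Y: "Y_shaped Q \<rho> r" and br: "branches Q \<rho> S1 S2"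
begin

sublocale fin_digraph Q
  using Y by (simp add: Y_shaped_def quiver_with_dims_def)

lemma verts: "verts Q = {0..\<rho>}"
  and r0: "r 0 = 1"
  using Y by (auto simp: Y_shaped_def quiver_with_dims_def)

lemma out_degree_le: "i \<in> {2..\<rho>} \<Longrightarrow> out_degree Q i \<le> 1"
  and in_nonzero_le: "i \<in> {1..\<rho>} \<Longrightarrow> card {a \<in> in_arcs Q i. tail Q a \<noteq> 0} \<le> 1"
  and walk_from_1: "i \<in> {2..\<rho>} \<Longrightarrow> \<exists>p. awalk 1 p i"
  and r_less: "i \<in> {1..\<rho>} \<Longrightarrow> r i < in_rank Q r i"
  using Y by (auto simp: Y_shaped_def)

section \<open>Arrows, walks and the recursions along parents\<close>

lemma arc_less:
  assumes "a \<in> arcs Q"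
  shows "tail Q a < head Q a"
proof -
  have "a \<in> {b \<in> arcs Q. tail Q b = tail Q a \<and> head Q b = head Q a}" using assms by simp
  moreover have "finite {b \<in> arcs Q. tail Q b = tail Q a \<and> head Q b = head Q a}" by simp
  ultimately have "num_arrows Q (tail Q a) (head Q a) \<noteq> 0"
    unfolding num_arrows_def by (metis card_0_eq empty_iff)
  then show ?thesis using Y unfolding Y_shaped_def quiver_with_dims_def by blast
qed

lemma awalk_le: "awalk i p j \<Longrightarrow> i \<le> j"
proof (induction p arbitrary: i)
  case (Cons a p)
  then have "a \<in> arcs Q" "i = tail Q a" "head Q a \<le> j" by (auto simp: awalk_Cons_iff)
  then show ?case using arc_less[of a] by simp
qed (simp add: awalk_Nil_iff)

lemma awalk_refl_iff: "awalk i p i \<longleftrightarrow> p = [] \<and> i \<in> verts Q"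
proof (cases p)
  case (Cons a q)
  have False if "awalk i (a # q) i"
    using that arc_less[of a] awalk_le[of "head Q a" q i] by (auto simp: awalk_Cons_iff)
  then show ?thesis using Cons by blast
qed (auto simp: awalk_Nil_iff)

lemma awalk_snoc_iff: "awalk i (p @ [a]) j \<longleftrightarrow> awalk i p (tail Q a) \<and> a \<in> arcs Q \<and> head Q a = j"
  by (induction p arbitrary: i) (auto simp: awalk_Nil_iff awalk_Cons_iff)

lemma awalk_nonempty_snoc:
  assumes "awalk i p j" "i \<noteq> j"
  obtains q a where "p = q @ [a]" "awalk i q (tail Q a)" "a \<in> arcs Q" "head Q a = j"
  using assms by (cases p rule: rev_cases) (auto simp: awalk_Nil_iff awalk_snoc_iff)

lemma unique_nonzero_in_arc:
  assumes "i \<in> {1..\<rho>}" "a \<in> arcs Q" "head Q a = i" "tail Q a \<noteq> 0" "b \<in> arcs Q" "head Q b = i" "tail Q b \<noteq> 0"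
  shows "a = b"
proof -
  have "finite {a \<in> in_arcs Q i. tail Q a \<noteq> 0}" by simp
  moreover have "card {a \<in> in_arcs Q i. tail Q a \<noteq> 0} \<le> Suc 0" using in_nonzero_le[OF assms(1)] by simp
  ultimately show ?thesis using assms by (auto simp: card_le_Suc0_iff_eq)
qed

lemma unique_out_arc:
  assumes "out_degree Q i \<le> 1" "a \<in> arcs Q" "tail Q a = i" "b \<in> arcs Q" "tail Q b = i"
  shows "a = b"
proof -
  have "card (out_arcs Q i) \<le> Suc 0" "finite (out_arcs Q i)" using assms(1) by (auto simp: out_degree_def)
  then show ?thesis using assms by (auto simp: card_le_Suc0_iff_eq)
qed

lemma parent_eq_tail:
  assumes "i \<in> {1..\<rho>}" "a \<in> arcs Q" "head Q a = i" "tail Q a \<noteq> 0"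
  shows "parent Q i = tail Q a"
  unfolding parent_def by (rule the_equality) (use assms unique_nonzero_in_arc in blast)+

lemma parent_arc:
  assumes "i \<in> {2..\<rho>}"
  obtains a where "a \<in> arcs Q" "head Q a = i" "tail Q a = parent Q i" "1 \<le> parent Q i" "parent Q i < i"
proof -
  obtain p where "awalk 1 p i" using walk_from_1[OF assms] by blast
  moreover have "1 \<noteq> i" using assms by auto
  ultimately obtain q a where a: "awalk 1 q (tail Q a)" "a \<in> arcs Q" "head Q a = i"
    by (rule awalk_nonempty_snoc)
  then have "1 \<le> tail Q a" using awalk_le by blast
  moreover from this have "parent Q i = tail Q a" using parent_eq_tail assms a by auto
  ultimately show thesis using that[of a] a arc_less by auto
qed

lemma parent_bounds: "i \<in> {2..\<rho>} \<Longrightarrow> 1 \<le> parent Q i \<and> parent Q i < i"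
  by (erule parent_arc) simp

text \<open>Besides the arrows from 0, only the one from the parent enters \<open>i\<close>, and
  none if \<open>i = 1\<close>. Taking \<open>r\<close> and \<open>num_paths Q\<close> for
  \<open>f\<close> gives the recursions of both \<open>in_rank\<close> and \<open>num_paths\<close>,
  as both functions are 1 at vertex 0.\<close>

lemma sum_in_arcs:
  fixes f :: "nat \<Rightarrow> nat"
  assumes "i \<in> {1..\<rho>}"
  shows "(\<Sum>a\<in>in_arcs Q i. f (tail Q a)) = num_arrows Q 0 i * f 0 + (if i = 1 then 0 else f (parent Q i))"
proof -
  let ?Z = "{a \<in> arcs Q. tail Q a = 0 \<and> head Q a = i}" and ?N = "{a \<in> in_arcs Q i. tail Q a \<noteq> 0}"
  have "(\<Sum>a\<in>in_arcs Q i. f (tail Q a)) = (\<Sum>a\<in>?Z \<union> ?N. f (tail Q a))"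
    by (rule sum.cong) auto
  also have "\<dots> = (\<Sum>a\<in>?Z. f (tail Q a)) + (\<Sum>a\<in>?N. f (tail Q a))"
    by (rule sum.union_disjoint) auto
  finally have "(\<Sum>a\<in>in_arcs Q i. f (tail Q a)) = (\<Sum>a\<in>?Z. f (tail Q a)) + (\<Sum>a\<in>?N. f (tail Q a))" .
  moreover have "(\<Sum>a\<in>?Z. f (tail Q a)) = num_arrows Q 0 i * f 0"
    by (simp add: num_arrows_def)
  moreover have "(\<Sum>a\<in>?N. f (tail Q a)) = (if i = 1 then 0 else f (parent Q i))"
  proof (cases "i = 1")
    case True
    then have "?N = {}" using arc_less by fastforce
    then show ?thesis using True by simp
  next
    case False
    then have "i \<in> {2..\<rho>}" using assms by auto
    then obtain a where a: "a \<in> arcs Q" "head Q a = i" "tail Q a = parent Q i" "1 \<le> parent Q i"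
      by (rule parent_arc)
    then have "?N = {a}" using unique_nonzero_in_arc[OF assms] by fastforce
    then show ?thesis using False a by simp
  qed
  ultimately show ?thesis by simp
qed

lemma num_paths_eq_sum:
  assumes "i \<in> {1..\<rho>}"
  shows "num_paths Q i = (\<Sum>a\<in>in_arcs Q i. num_paths Q (tail Q a))"
proof -
  have walks: "{p. awalk 0 p i} = (\<Union>a\<in>in_arcs Q i. (\<lambda>p. p @ [a]) ` {p. awalk 0 p (tail Q a)})" if nz: "i \<noteq> 0" for i
  proof (intro equalityI subsetI)
    fix p assume "p \<in> {p. awalk 0 p i}"
    then have "awalk 0 p i" by simp
    then obtain q a where "p = q @ [a]" "awalk 0 q (tail Q a)" "a \<in> arcs Q" "head Q a = i"
      by (rule awalk_nonempty_snoc) (use nz in auto)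
    then show "p \<in> (\<Union>a\<in>in_arcs Q i. (\<lambda>p. p @ [a]) ` {p. awalk 0 p (tail Q a)})" by auto
  qed (auto simp: arc_implies_awalk)
  \<comment> \<open>Infinite sets have cardinality 0, so finiteness has to precede the counting.
    Arrows lead to larger vertices, which permits the induction.\<close>
  have fin: "finite {p. awalk 0 p i}" for i
  proof (induction i rule: less_induct)
    case (less i)
    show ?case
    proof (cases "i = 0")
      case True
      then have "{p. awalk 0 p i} \<subseteq> {[]}" using awalk_refl_iff by auto
      then show ?thesis by (rule finite_subset) simp
    next
      case False
      show ?thesis unfolding walks[OF False]
        by (intro finite_UN_I finite_imageI less.IH) (use arc_less in auto)
    qed
  qed
  have i: "i \<noteq> 0" using assms by simp
  have "num_paths Q i = card (\<Union>a\<in>in_arcs Q i. (\<lambda>p. p @ [a]) ` {p. awalk 0 p (tail Q a)})"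
    by (simp add: num_paths_def walks[OF i])
  also have "\<dots> = (\<Sum>a\<in>in_arcs Q i. card ((\<lambda>p. p @ [a]) ` {p. awalk 0 p (tail Q a)}))"
    using fin by (intro card_UN_disjoint) auto
  also have "\<dots> = (\<Sum>a\<in>in_arcs Q i. num_paths Q (tail Q a))"
    unfolding num_paths_def by (intro sum.cong refl card_image) (auto simp: inj_on_def)
  finally show "num_paths Q i = (\<Sum>a\<in>in_arcs Q i. num_paths Q (tail Q a))" .
qed

lemma num_paths_0: "num_paths Q 0 = 1"
proof -
  have "{p. awalk 0 p 0} = {[]}" using awalk_refl_iff verts by auto
  then show ?thesis by (simp add: num_paths_def)
qed

lemma num_paths_1: "1 \<le> \<rho> \<Longrightarrow> num_paths Q 1 = num_arrows Q 0 1"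
  and num_paths_rec: "i \<in> {2..\<rho>} \<Longrightarrow> num_paths Q i = num_paths Q (parent Q i) + num_arrows Q 0 i"
  and in_rank_1: "1 \<le> \<rho> \<Longrightarrow> in_rank Q r 1 = num_arrows Q 0 1"
  and in_rank_rec: "i \<in> {2..\<rho>} \<Longrightarrow> in_rank Q r i = r (parent Q i) + num_arrows Q 0 i"
  using sum_in_arcs[of i r] sum_in_arcs[of i "num_paths Q"] num_paths_eq_sum[of i]
    sum_in_arcs[of 1 r] sum_in_arcs[of 1 "num_paths Q"] num_paths_eq_sum[of 1]
  by (auto simp: in_rank_def num_paths_0 r0)

text \<open>\<open>num_paths\<close> and \<open>in_rank\<close> add the same number of arrows from 0
  to the values of \<open>num_paths\<close> and \<open>r\<close> at the parent. So the positive
  difference at the parent is inherited, and \<open>r i\<close> lies below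
  \<open>in_rank Q r i\<close>. This makes the subtraction in \<open>corank\<close> exact.\<close>

lemma r_less_num_paths: "i \<in> {1..\<rho>} \<Longrightarrow> r i < num_paths Q i"
proof (induction i rule: less_induct)
  case (less i)
  show ?case
  proof (cases "i = 1")
    case True
    then show ?thesis using r_less[of 1] less.prems num_paths_1 in_rank_1 by simp
  next
    case False
    then have i: "i \<in> {2..\<rho>}" using less.prems by auto
    then have "r (parent Q i) < num_paths Q (parent Q i)" using less.IH parent_bounds[OF i] by auto
    then show ?thesis using r_less[OF less.prems] num_paths_rec[OF i] in_rank_rec[OF i] by simp
  qed
qed

lemma corank_pos: "i \<in> {1..\<rho>} \<Longrightarrow> 0 < corank Q r i"
  using r_less_num_paths by (simp add: corank_def)

lemma corank_rec:
  assumes "i \<in> {2..\<rho>}"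
  shows "corank Q r i = corank Q r (parent Q i) + (in_rank Q r i - r i)" "r i < in_rank Q r i"
proof -
  show "r i < in_rank Q r i" using r_less assms by auto
  moreover have "r (parent Q i) < num_paths Q (parent Q i)" "r i < num_paths Q i"
    using r_less_num_paths parent_bounds[OF assms] assms by auto
  ultimately show "corank Q r i = corank Q r (parent Q i) + (in_rank Q r i - r i)"
    using num_paths_rec[OF assms] in_rank_rec[OF assms] by (simp add: corank_def)
qed

section \<open>The branches as chains of parents\<close>

lemma vertices_through_bounds: "i \<in> vertices_through Q a \<Longrightarrow> i \<in> {2..\<rho>}"
  by (auto simp: vertices_through_def verts)

lemma vertices_through_parent:
  assumes "a \<in> out_arcs Q 1" "i \<in> vertices_through Q a"
  shows "parent Q i = 1 \<and> head Q a = i \<or> parent Q i \<in> vertices_through Q a"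
proof -
  have i: "i \<in> {2..\<rho>}" by (rule vertices_through_bounds[OF assms(2)])
  obtain p where p: "awalk 1 p i" "a \<in> set p" using assms(2) by (auto simp: vertices_through_def)
  have "1 \<noteq> i" using i by auto
  with p(1) obtain q e where e: "p = q @ [e]" "awalk 1 q (tail Q e)" "e \<in> arcs Q" "head Q e = i"
    by (rule awalk_nonempty_snoc)
  have ge1: "1 \<le> tail Q e" using awalk_le[OF e(2)] .
  then have pe: "parent Q i = tail Q e" using parent_eq_tail[of i e] e i by auto
  show ?thesis
  proof (cases "parent Q i = 1")
    case True
    then have "q = []" using e(2) pe by (simp add: awalk_refl_iff)
    then show ?thesis using True p(2) e pe by auto
  next
    case False
    then have "a \<noteq> e" using assms(1) pe by auto
    then have "a \<in> set q" using p(2) e(1) by simp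
    moreover have "tail Q e \<in> verts Q" using e(3) by simp
    ultimately have "tail Q e \<in> vertices_through Q a"
      using e(2) False pe ge1 by (auto simp: vertices_through_def)
    then show ?thesis using pe by simp
  qed
qed

lemma parent_inj:
  assumes "i \<in> {2..\<rho>}" "j \<in> {2..\<rho>}" "parent Q i = parent Q j" "out_degree Q (parent Q i) \<le> 1"
  shows "i = j"
proof -
  obtain a where a: "a \<in> arcs Q" "head Q a = i" "tail Q a = parent Q i" using parent_arc[OF assms(1)] .
  obtain b where b: "b \<in> arcs Q" "head Q b = j" "tail Q b = parent Q j" using parent_arc[OF assms(2)] .
  have "a = b" by (rule unique_out_arc[OF assms(4) a(1,3) b(1)]) (simp only: b(3) assms(3))
  then show ?thesis using a(2) b(2) by simp
qed

text \<open>Vertex 1 may have two outgoing arrows, but a vertex of this branch with parent 1 must be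
  the head of \<open>a\<close>. At all other parents the out-degree is at most one.\<close>

lemma vertices_through_parent_inj:
  assumes "a \<in> out_arcs Q 1" "i \<in> vertices_through Q a" "j \<in> vertices_through Q a" "parent Q i = parent Q j"
  shows "i = j"
proof (cases "parent Q i = 1")
  case True
  then have "1 \<notin> vertices_through Q a" using vertices_through_bounds by fastforce
  then show ?thesis using vertices_through_parent[OF assms(1,2)] vertices_through_parent[OF assms(1,3)] True assms(4) by auto
next
  case False
  then have "parent Q i \<in> {2..\<rho>}" using vertices_through_parent[OF assms(1,2)] vertices_through_bounds by blast
  then show ?thesis using parent_inj vertices_through_bounds assms out_degree_le by blast
qed

text \<open>Membership in both sets passes to the parent until the parent is 1. Then both arrows end
  in the same vertex, which has at most one arrow from a nonzero vertex.\<close>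

lemma vertices_through_disjoint:
  assumes "a \<in> out_arcs Q 1" "b \<in> out_arcs Q 1" "a \<noteq> b"
  shows "vertices_through Q a \<inter> vertices_through Q b = {}"
proof -
  have not1: "1 \<notin> vertices_through Q c" for c using vertices_through_bounds[of 1 c] by auto
  have "i \<in> vertices_through Q a \<Longrightarrow> i \<notin> vertices_through Q b" for i
  proof (induction i rule: less_induct)
    case (less i)
    show ?case
    proof
      assume ib: "i \<in> vertices_through Q b"
      have i: "i \<in> {2..\<rho>}" by (rule vertices_through_bounds[OF less.prems])
      consider "parent Q i = 1" "head Q a = i" "head Q b = i"
        | "parent Q i \<in> vertices_through Q a" "parent Q i \<in> vertices_through Q b"
        using vertices_through_parent[OF assms(1) less.prems] vertices_through_parent[OF assms(2) ib] not1 by auto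
      then show False
      proof cases
        case 1
        then have "a = b" using unique_nonzero_in_arc[of i a b] assms i by auto
        then show False using assms(3) by contradiction
      next
        case 2
        then show False using less.IH parent_bounds[OF i] by blast
      qed
    qed
  qed
  then show ?thesis by blast
qed

lemma vertices_through_exists:
  assumes "i \<in> {2..\<rho>}"
  shows "\<exists>a\<in>out_arcs Q 1. i \<in> vertices_through Q a"
proof -
  obtain p where p: "awalk 1 p i" using walk_from_1[OF assms] by blast
  then obtain a q where a: "p = a # q" using assms by (cases p) (auto simp: awalk_Nil_iff)
  then have "a \<in> out_arcs Q 1" using p by (simp add: awalk_Cons_iff)
  moreover have "i \<in> vertices_through Q a"
    unfolding vertices_through_def using p a assms verts by (auto intro!: exI[of _ p])
  ultimately show ?thesis by blast
qed

lemma branch_union: "S1 \<union> S2 = {2..\<rho>}"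
  and branch_disjoint: "S1 \<inter> S2 = {}"
  and branch_parent: "S \<in> {S1, S2} \<Longrightarrow> i \<in> S \<Longrightarrow> parent Q i \<in> insert 1 S"
  and branch_inj: "S \<in> {S1, S2} \<Longrightarrow> i \<in> S \<Longrightarrow> j \<in> S \<Longrightarrow> parent Q i = parent Q j \<Longrightarrow> i = j"
proof -
  have "S1 \<union> S2 = {2..\<rho>} \<and> S1 \<inter> S2 = {} \<and> (\<forall>S\<in>{S1, S2}. \<forall>i\<in>S. parent Q i \<in> insert 1 S) \<and>
    (\<forall>S\<in>{S1, S2}. \<forall>i\<in>S. \<forall>j\<in>S. parent Q i = parent Q j \<longrightarrow> i = j)"
  proof (cases "out_degree Q 1 = 2")
    case True
    then obtain a1 a2 where a: "a1 \<noteq> a2" "out_arcs Q 1 = {a1, a2}"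
      and S: "S1 = vertices_through Q a1" "S2 = vertices_through Q a2"
      using br by (auto simp: branches_def)
    then have o: "a1 \<in> out_arcs Q 1" "a2 \<in> out_arcs Q 1" by simp_all
    have "S1 \<union> S2 = {2..\<rho>}"
    proof (intro equalityI subsetI)
      fix i assume "i \<in> S1 \<union> S2"
      then show "i \<in> {2..\<rho>}" unfolding S using vertices_through_bounds by (elim UnE)
    next
      fix i assume "i \<in> {2..\<rho>}"
      then show "i \<in> S1 \<union> S2" using vertices_through_exists[of i] unfolding S a(2) by simp
    qed
    moreover have "S1 \<inter> S2 = {}" unfolding S by (rule vertices_through_disjoint[OF o a(1)])
    moreover have "\<forall>S\<in>{S1, S2}. \<forall>i\<in>S. parent Q i \<in> insert 1 S"
      using vertices_through_parent[OF o(1)] vertices_through_parent[OF o(2)] unfolding S by auto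
    moreover have "\<forall>S\<in>{S1, S2}. \<forall>i\<in>S. \<forall>j\<in>S. parent Q i = parent Q j \<longrightarrow> i = j"
      using vertices_through_parent_inj[OF o(1)] vertices_through_parent_inj[OF o(2)] unfolding S by auto
    ultimately show ?thesis by blast
  next
    case False
    then have S: "S1 = {2..\<rho>}" "S2 = {}" using br by (auto simp: branches_def)
    have "out_degree Q 1 \<le> 2" using Y by (simp add: Y_shaped_def)
    then have o1: "out_degree Q 1 \<le> 1" using False by simp
    have "parent Q i \<in> insert 1 {2..\<rho>}" if "i \<in> {2..\<rho>}" for i
      using parent_bounds[OF that] that by auto
    moreover have "i = j" if "i \<in> {2..\<rho>}" "j \<in> {2..\<rho>}" "parent Q i = parent Q j" for i j
    proof (rule parent_inj[OF that])
      show "out_degree Q (parent Q i) \<le> 1"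
        using calculation[OF that(1)] out_degree_le[of "parent Q i"] o1 by auto
    qed
    ultimately show ?thesis unfolding S by blast
  qed
  then show "S1 \<union> S2 = {2..\<rho>}" "S1 \<inter> S2 = {}"
    "S \<in> {S1, S2} \<Longrightarrow> i \<in> S \<Longrightarrow> parent Q i \<in> insert 1 S"
    "S \<in> {S1, S2} \<Longrightarrow> i \<in> S \<Longrightarrow> j \<in> S \<Longrightarrow> parent Q i = parent Q j \<Longrightarrow> i = j" by blast+
qed

lemma branch_bounds: "S \<in> {S1, S2} \<Longrightarrow> i \<in> S \<Longrightarrow> i \<in> {2..\<rho>}"
  using branch_union by blast

lemma branch_le_parent:
  assumes "S \<in> {S1, S2}" "i \<in> insert 1 S" "j \<in> insert 1 S" "i < j"
  shows "i \<le> parent Q j"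
proof (rule le_pred_of_inj_pred[OF _ _ assms(2-4)])
  fix k assume k: "k \<in> S"
  show "1 \<le> parent Q k \<and> parent Q k < k \<and> parent Q k \<in> insert 1 S"
    using parent_bounds[OF branch_bounds[OF assms(1) k]] branch_parent[OF assms(1) k] by blast
next
  fix k l assume "k \<in> S" "l \<in> S" "parent Q k = parent Q l"
  then show "k = l" by (rule branch_inj[OF assms(1)])
qed

lemma branch_mono:
  assumes "S \<in> {S1, S2}" "i \<in> insert 1 S" "j \<in> insert 1 S" "i \<le> j"
  shows "corank Q r i \<le> corank Q r j \<and> num_paths Q i \<le> num_paths Q j"
  using assms(2-)
proof (induction j rule: less_induct)
  case (less j)
  show ?case
  proof (cases "i = j")
    case False
    then have ij: "i < j" using less.prems by simp
    have "1 \<le> i" using less.prems(1) branch_bounds[OF assms(1), of i] by auto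
    then have j: "j \<in> S" using ij less.prems by auto
    then have jb: "j \<in> {2..\<rho>}" by (rule branch_bounds[OF assms(1)])
    have "i \<le> parent Q j" by (rule branch_le_parent[OF assms(1) less.prems(1,2) ij])
    then have "corank Q r i \<le> corank Q r (parent Q j) \<and> num_paths Q i \<le> num_paths Q (parent Q j)"
      using less.IH parent_bounds[OF jb] branch_parent[OF assms(1) j] less.prems by blast
    then show ?thesis using corank_rec(1)[OF jb] num_paths_rec[OF jb] by linarith
  qed simp
qed

end

section \<open>The matrices of a Y-shaped quiver\<close>

lemma interval_minor_shift:
  "interval_minor M R (R + k) c = interval_minor (\<lambda>t. M (R + t)) 0 k (\<lambda>t. c (R + t))"
proof -
  let ?A = "{0..<k}" and ?B = "{R..<R + k}"
  have bij: "bij_betw (\<lambda>t. R + t) ?A ?B"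
    by (rule bij_betw_byWitness[where f'="\<lambda>t. t - R"]) auto
  have bij': "bij_betw (\<lambda>t. t - R) ?B ?A"
    by (rule bij_betw_byWitness[where f'="\<lambda>t. R + t"]) auto
  have inj: "inj_on (\<lambda>t. R + t) ?A" using bij by (rule bij_betw_imp_inj_on)
  show ?thesis
    unfolding interval_minor_def
  proof (rule sum.reindex_bij_witness[symmetric, where j="map_permutation ?A (\<lambda>t. R + t)" and i="map_permutation ?B (\<lambda>t. t - R)"])
    fix \<pi> assume "\<pi> \<in> {\<pi>. \<pi> permutes ?A}"
    then have \<pi>: "\<pi> permutes ?A" by simp
    let ?p = "map_permutation ?A (\<lambda>t. R + t) \<pi>"
    show "map_permutation ?B (\<lambda>t. t - R) ?p = \<pi>"
      by (rule map_permutation_compose_inv[OF bij \<pi>]) simp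
    show "?p \<in> {\<pi>. \<pi> permutes ?B}" using map_permutation_permutes[OF bij \<pi>] by simp
    have "(\<Prod>t\<in>?B. M (?p t) (c t)) = (\<Prod>t\<in>?A. M (?p (R + t)) (c (R + t)))"
      by (rule prod.reindex_bij_betw[OF bij, symmetric])
    also have "\<dots> = (\<Prod>t\<in>?A. M (R + \<pi> t) (c (R + t)))"
      by (rule prod.cong) (simp_all add: map_permutation_apply[OF inj])
    finally show "of_int (sign ?p) * (\<Prod>t\<in>?B. M (?p t) (c t)) = of_int (sign \<pi>) * (\<Prod>t\<in>?A. M (R + \<pi> t) (c (R + t)))"
      using sign_map_permutation[OF inj \<pi>] by simp
  next
    fix \<pi> assume "\<pi> \<in> {\<pi>. \<pi> permutes ?B}"
    then have \<pi>: "\<pi> permutes ?B" by simp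
    show "map_permutation ?A (\<lambda>t. R + t) (map_permutation ?B (\<lambda>t. t - R) \<pi>) = \<pi>"
      by (rule map_permutation_compose_inv[OF bij' \<pi>]) simp
    show "map_permutation ?B (\<lambda>t. t - R) \<pi> \<in> {\<pi>. \<pi> permutes ?A}"
      using map_permutation_permutes[OF bij' \<pi>] by simp
  qed
qed

lemma det_submatrix_eq_interval_minor:
  assumes A: "A \<in> carrier_mat k n"
    and entries: "\<And>a b. a < k \<Longrightarrow> b < n \<Longrightarrow> A $$ (a, b) = M (R + a) (C + b)"
    and J: "J \<subseteq> {..<n}" "card J = k"
  shows "det (submatrix A {..<k} J) = interval_minor M R (R + k) (\<lambda>t. C + pick J (t - R))"
proof -
  have I: "card {i. i < dim_row A \<and> i \<in> {..<k}} = k" using A by simp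
  have "{j. j < dim_col A \<and> j \<in> J} = J" using A J by auto
  then have Jc: "card {j. j < dim_col A \<and> j \<in> J} = k" using J by simp
  have pI: "pick {..<k} a = a" if "a < k" for a
  proof -
    have "{x \<in> {..<k}. x < a} = {..<a}" using that by auto
    then show ?thesis using pick_card_in_set[of a "{..<k}"] that by simp
  qed
  have pJ: "pick J b < n" if "b < k" for b
  proof -
    have "pick J b \<in> J" using that J(2) by (intro pick_in_set) simp
    then show ?thesis using J(1) by blast
  qed
  have B: "submatrix A {..<k} J \<in> carrier_mat k k" 
    by (rule carrier_matI) (simp_all only: dim_submatrix I Jc)
  have ent: "submatrix A {..<k} J $$ (a, b) = M (R + a) (C + pick J b)" if "a < k" "b < k" for a b
  proof -
    have "submatrix A {..<k} J $$ (a, b) = A $$ (pick {..<k} a, pick J b)"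
      by (rule submatrix_index) (simp_all only: I Jc that)
    also have "\<dots> = M (R + a) (C + pick J b)"
      by (simp only: pI[OF that(1)] entries[OF that(1) pJ[OF that(2)]])
    finally show ?thesis .
  qed
  have "det (submatrix A {..<k} J) =
      (\<Sum>p | p permutes {0..<k}. of_int (sign p) * (\<Prod>j<k. M (R + p j) (C + pick J j)))"
    \<comment> \<open>The column form of the expansion is the fitting one, since
      \<open>interval_minor\<close> permutes the rows and keeps the columns in place.\<close>
    unfolding det_col[OF B]
  proof (intro sum.cong refl arg_cong2[where f="(*)"] prod.cong)
    fix p j assume "p \<in> {p. p permutes {0..<k}}" "j \<in> {..<k}"
    then have "p j < k" "j < k" using permutes_in_image[of p "{0..<k}" j] by auto
    then show "submatrix A {..<k} J $$ (p j, j) = M (R + p j) (C + pick J j)" by (rule ent)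
  qed
  also have "\<dots> = interval_minor (\<lambda>t. M (R + t)) 0 k (\<lambda>t. C + pick J (R + t - R))"
    by (simp add: interval_minor_def lessThan_atLeast0)
  also have "\<dots> = interval_minor M R (R + k) (\<lambda>t. C + pick J (t - R))"
    by (rule interval_minor_shift[symmetric])
  finally show ?thesis .
qed

context Y_quiver
begin

abbreviation k where "k \<equiv> corank Q r"
abbreviation n where "n \<equiv> num_paths Q"
abbreviation pa where "pa \<equiv> parent Q"

text \<open>Offsets that have to be at least every \<open>k i\<close> and every \<open>n i\<close>,
  so that subtractions like \<open>R0 + k 1 - k i\<close> are exact; the sums are convenient upper
  bounds.\<close>

definition R0 where "R0 = (\<Sum>i\<in>{1..\<rho>}. k i)"
definition C0 where "C0 = (\<Sum>i\<in>{1..\<rho>}. n i)"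

text \<open>All the matrices \<open>A\<^sub>i\<close> are submatrices of one staircase-shaped matrix, whose rows from \<open>R0\<close> on
  and columns from \<open>C0\<close> on start with \<open>A\<^sub>1\<close>: the blocks of \<open>S1\<close> are stacked above \<open>A\<^sub>1\<close>
  and aligned to the right, the blocks of \<open>S2\<close> are stacked below and aligned to the left.
  The matrix \<open>A\<^sub>i\<close> starts at \<open>(mat_row i, mat_col i)\<close> and its block \<open>X\<^sup>i\<close> has the rows
  \<open>blk_top i..<blk_bot i\<close>.\<close>

definition mat_row where "mat_row i = (if i \<in> S1 then R0 + k 1 - k i else R0)"
definition mat_col where "mat_col i = (if i \<in> S1 then C0 + n 1 - n i else C0)"
definition blk_top where
  "blk_top i = (if i \<in> S1 then R0 + k 1 - k i else if i = 1 then R0 else R0 + k (pa i))"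
definition blk_bot where
  "blk_bot i = (if i \<in> S1 then R0 + k 1 - k (pa i) else R0 + k i)"

definition in_block where
  "in_block i t \<longleftrightarrow> i \<in> {1..\<rho>} \<and> blk_top i \<le> t \<and> t < blk_bot i"

definition qsupp where
  "qsupp t c \<longleftrightarrow> (\<exists>i. in_block i t \<and> mat_col i \<le> c \<and> c < mat_col i + n i)"

text \<open>Meaningful on \<open>qsupp\<close> only, where \<open>in_block_unique\<close> justifies
  the definite description.\<close>

definition qvar_at :: "nat \<Rightarrow> nat \<Rightarrow> qvar" where
  "qvar_at t c = (let i = (THE i. in_block i t) in (i, t - blk_top i, c - mat_col i))"

lemma k_le_R0: "i \<in> {1..\<rho>} \<Longrightarrow> k i \<le> R0"
  unfolding R0_def by (rule member_le_sum) auto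

lemma n_le_C0: "i \<in> {1..\<rho>} \<Longrightarrow> n i \<le> C0"
  unfolding C0_def by (rule member_le_sum) auto

lemma S1_facts:
  assumes "i \<in> S1"
  shows "i \<in> {2..\<rho>}" "pa i \<in> insert 1 S1" "k 1 \<le> k (pa i)" "k (pa i) < k i" "k i \<le> R0"
    "n 1 \<le> n (pa i)" "n (pa i) \<le> n i" "n i \<le> C0" "i \<notin> S2" "i \<noteq> 1"
proof -
  show i: "i \<in> {2..\<rho>}" using assms branch_union by blast
  show p: "pa i \<in> insert 1 S1" using branch_parent[of S1 i] assms by simp
  have "k 1 \<le> k (pa i) \<and> n 1 \<le> n (pa i)"
    using branch_mono[of S1 1 "pa i"] p parent_bounds[OF i] by simp
  then show "k 1 \<le> k (pa i)" "n 1 \<le> n (pa i)" by auto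
  show "k (pa i) < k i" using corank_rec[OF i] by linarith
  show "n (pa i) \<le> n i" using num_paths_rec[OF i] by linarith
  show "k i \<le> R0" "n i \<le> C0" using k_le_R0 n_le_C0 i by auto
  show "i \<notin> S2" using branch_disjoint assms by blast
  show "i \<noteq> 1" using i by auto
qed

lemma S2_facts:
  assumes "i \<in> S2"
  shows "i \<in> {2..\<rho>}" "pa i \<in> insert 1 S2" "k 1 \<le> k (pa i)" "k (pa i) < k i"
    "n 1 \<le> n (pa i)" "n (pa i) \<le> n i" "i \<notin> S1" "i \<noteq> 1"
proof -
  show i: "i \<in> {2..\<rho>}" using assms branch_union by blast
  show p: "pa i \<in> insert 1 S2" using branch_parent[of S2 i] assms by simp
  have "k 1 \<le> k (pa i) \<and> n 1 \<le> n (pa i)"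
    using branch_mono[of S2 1 "pa i"] p parent_bounds[OF i] by simp
  then show "k 1 \<le> k (pa i)" "n 1 \<le> n (pa i)" by auto
  show "k (pa i) < k i" using corank_rec[OF i] by linarith
  show "n (pa i) \<le> n i" using num_paths_rec[OF i] by linarith
  show "i \<notin> S1" using branch_disjoint assms by blast
  show "i \<noteq> 1" using i by auto
qed

lemma one_notin: "1 \<notin> S1" "1 \<notin> S2"
  using S1_facts(10) S2_facts(8) by blast+

lemma vertex_cases:
  assumes "i \<in> {1..\<rho>}"
  obtains "i = 1" | "i \<in> S1" | "i \<in> S2"
  using assms branch_union by (metis UnE atLeastAtMost_iff le_neq_implies_less less_eq_Suc_le numeral_2_eq_2 One_nat_def)

section \<open>The position of the blocks and the staircase\<close>

lemma block_greater_total: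
  assumes "i \<in> {1..\<rho>}" "j \<in> {1..\<rho>}" "i \<noteq> j"
  shows "block_greater S1 S2 i j \<or> block_greater S1 S2 j i"
  using assms(1)
proof (cases i rule: vertex_cases)
  case 1
  show ?thesis using assms(2) by (cases j rule: vertex_cases) (use 1 assms(3) in \<open>auto simp: block_greater_def\<close>)
next
  case 2
  show ?thesis using assms(2) by (cases j rule: vertex_cases) (use 2 assms(3) in \<open>auto simp: block_greater_def\<close>)
next
  case 3
  show ?thesis using assms(2) by (cases j rule: vertex_cases) (use 3 assms(3) in \<open>auto simp: block_greater_def\<close>)
qed

lemma block_greater_cases:
  assumes "block_greater S1 S2 i j"
  obtains "i \<in> S1" "j = 1" | "i = 1" "j \<in> S2" | "i \<in> S1" "j \<in> S2"
    | "i \<in> S1" "j \<in> S1" "j < i" | "i \<in> S2" "j \<in> S2" "i < j"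
  using assms unfolding block_greater_def by blast

text \<open>Along a branch, an earlier vertex is at most the parent of a later one, and
  \<open>k\<close> and \<open>n\<close> grow; the block of vertex 1 separates the two branches. Thus
  the variable order of the blocks is their order from top to bottom, and the drift of both column
  limits to the right produces the staircase.\<close>

lemma block_greater_bounds:
  assumes "block_greater S1 S2 i j"
  shows "blk_bot i \<le> blk_top j \<and> mat_col i \<le> mat_col j \<and> mat_col i + n i \<le> mat_col j + n j"
  using assms
proof (cases rule: block_greater_cases)
  case 1
  show ?thesis using S1_facts[OF 1(1)] one_notin 1(2)
    by (auto simp: blk_bot_def blk_top_def mat_col_def 1(1))
next
  case 2
  show ?thesis using S2_facts[OF 2(2)] one_notin 2(1)
    by (auto simp: blk_bot_def blk_top_def mat_col_def)
next
  case 3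
  show ?thesis using S1_facts[OF 3(1)] S2_facts[OF 3(2)]
    by (auto simp: blk_bot_def blk_top_def mat_col_def 3)
next
  case 4
  have "j \<le> pa i" using branch_le_parent[of S1 j i] 4 by simp
  then have "k j \<le> k (pa i) \<and> n j \<le> n (pa i)" using branch_mono[of S1 j "pa i"] S1_facts(2)[OF 4(1)] 4 by simp
  then show ?thesis using S1_facts[OF 4(1)] S1_facts[OF 4(2)]
    by (auto simp: blk_bot_def blk_top_def mat_col_def 4)
next
  case 5
  have "i \<le> pa j" using branch_le_parent[of S2 i j] 5 by simp
  then have "k i \<le> k (pa j) \<and> n i \<le> n (pa j)" using branch_mono[of S2 i "pa j"] S2_facts(2)[OF 5(2)] 5 by simp
  then show ?thesis using S2_facts[OF 5(1)] S2_facts[OF 5(2)]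
    by (auto simp: blk_bot_def blk_top_def mat_col_def)
qed

lemma block_order:
  assumes "in_block i t" "in_block j t'"
  shows "i = j \<or> block_greater S1 S2 i j \<and> \<not> block_greater S1 S2 j i \<and> t < t' \<or>
    block_greater S1 S2 j i \<and> \<not> block_greater S1 S2 i j \<and> t' < t"
proof -
  have lt: "s < s'" if "in_block a s" "in_block b s'" "block_greater S1 S2 a b" for a b s s'
    using block_greater_bounds[OF that(3)] that(1,2) by (auto simp: in_block_def)
  have "i \<noteq> j \<Longrightarrow> block_greater S1 S2 i j \<or> block_greater S1 S2 j i"
    using block_greater_total assms by (auto simp: in_block_def)
  then show ?thesis using lt[OF assms] lt[OF assms(2,1)] by (metis less_asym)
qed

lemma in_block_unique: "in_block i t \<Longrightarrow> in_block j t \<Longrightarrow> i = j"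
  using block_order by blast

lemma qvar_at_eq:
  assumes "in_block i t"
  shows "qvar_at t c = (i, t - blk_top i, c - mat_col i)"
proof -
  have "(THE i. in_block i t) = i" using assms in_block_unique by blast
  then show ?thesis by (simp add: qvar_at_def)
qed

lemma block_cols_mono:
  assumes "in_block i t" "in_block j t'" "t \<le> t'"
  shows "mat_col i \<le> mat_col j \<and> mat_col i + n i \<le> mat_col j + n j"
  using block_order[OF assms(1,2)] block_greater_bounds[of i j] assms(3) by auto

text \<open>The block of \<open>i\<close> ends where the matrix of its parent begins, so the blocks
  of the branch tile the rows. The absence of gaps is needed for the staircase property, where a row
  between two rows of blocks must have a column window of its own.\<close>

lemma S1_rows_covered:
  assumes "i \<in> S1 \<or> i = 1" "i \<in> {1..\<rho>}" "mat_row i \<le> t" "t < R0 + k 1"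
  shows "\<exists>j. in_block j t"
  using assms
proof (induction i rule: less_induct)
  case (less i)
  show ?case
  proof (cases "i = 1")
    case True
    then show ?thesis using less.prems one_notin
      by (intro exI[of _ 1]) (auto simp: in_block_def mat_row_def blk_top_def blk_bot_def)
  next
    case False
    then have i: "i \<in> S1" using less.prems by simp
    show ?thesis
    proof (cases "t < blk_bot i")
      case True
      then show ?thesis using less.prems i
        by (intro exI[of _ i]) (auto simp: in_block_def mat_row_def blk_top_def)
    next
      case False
      show ?thesis
      proof (rule less.IH[of "pa i"])
        show "pa i < i" "pa i \<in> {1..\<rho>}" using parent_bounds[OF S1_facts(1)[OF i]] S1_facts(1)[OF i] by auto
        show "pa i \<in> S1 \<or> pa i = 1" using S1_facts(2)[OF i] by blast
        show "mat_row (pa i) \<le> t" using False i S1_facts(2)[OF i] one_notin by (auto simp: mat_row_def blk_bot_def)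
      qed (rule less.prems(4))
    qed
  qed
qed

lemma S2_rows_covered:
  assumes "i \<in> S2 \<or> i = 1" "i \<in> {1..\<rho>}" "R0 \<le> t" "t < R0 + k i"
  shows "\<exists>j. in_block j t"
  using assms
proof (induction i rule: less_induct)
  case (less i)
  show ?case
  proof (cases "i = 1")
    case True
    then show ?thesis using less.prems one_notin
      by (intro exI[of _ 1]) (auto simp: in_block_def blk_top_def blk_bot_def)
  next
    case False
    then have i: "i \<in> S2" using less.prems by simp
    show ?thesis
    proof (cases "blk_top i \<le> t")
      case True
      then show ?thesis using less.prems i S2_facts(7)[OF i]
        by (intro exI[of _ i]) (auto simp: in_block_def blk_bot_def)
    next
      case False
      show ?thesis
      proof (rule less.IH[of "pa i"])
        show "pa i < i" "pa i \<in> {1..\<rho>}" using parent_bounds[OF S2_facts(1)[OF i]] S2_facts(1)[OF i] by auto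
        show "pa i \<in> S2 \<or> pa i = 1" using S2_facts(2)[OF i] by blast
        show "t < R0 + k (pa i)" using False S2_facts(7,8)[OF i] by (auto simp: blk_top_def)
      qed (rule less.prems(3))
    qed
  qed
qed

lemma in_block_bounds:
  assumes "in_block i t"
  shows "i \<in> S1 \<Longrightarrow> mat_row i \<le> t \<and> t < R0" "i \<notin> S1 \<Longrightarrow> R0 \<le> t" "i \<in> S2 \<Longrightarrow> R0 + k 1 \<le> t"
    "t < R0 + k i \<or> i \<in> S1" "i \<notin> S2 \<Longrightarrow> t < R0 + k 1"
proof -
  have i: "i \<in> {1..\<rho>}" "blk_top i \<le> t" "t < blk_bot i" using assms by (auto simp: in_block_def)
  show S1: "mat_row i \<le> t \<and> t < R0" if "i \<in> S1"
    using i S1_facts[OF that] that by (auto simp: blk_top_def blk_bot_def mat_row_def)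
  show "R0 \<le> t" if "i \<notin> S1" using i that by (auto simp: blk_top_def split: if_splits)
  show "R0 + k 1 \<le> t" if "i \<in> S2" using i S2_facts[OF that] by (auto simp: blk_top_def)
  show "t < R0 + k i \<or> i \<in> S1" using i by (auto simp: blk_bot_def)
  show "t < R0 + k 1" if "i \<notin> S2"
    using i(1)
  proof (cases rule: vertex_cases)
    case 1
    then show ?thesis using i one_notin by (simp add: blk_bot_def)
  qed (use that S1 in auto)
qed

lemma rows_between_covered:
  assumes "in_block i t" "in_block j t'" "t \<le> s" "s \<le> t'"
  shows "\<exists>l. in_block l s"
proof (cases "s < R0 + k 1")
  case True
  have i: "i \<in> {1..\<rho>}" using assms(1) by (simp add: in_block_def)
  show ?thesis
  proof (cases "i \<in> S1")
    case T: True
    then show ?thesis using S1_rows_covered[of i s] in_block_bounds(1)[OF assms(1) T] i True assms(3) by simp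
  next
    case False
    then show ?thesis using S1_rows_covered[of 1 s] in_block_bounds(2)[OF assms(1) False] i True assms(3) one_notin
      by (simp add: mat_row_def)
  qed
next
  case False
  then have j: "j \<in> S2" using in_block_bounds(5)[OF assms(2)] assms(4) by linarith
  then have "t' < R0 + k j" using in_block_bounds(4)[OF assms(2)] S2_facts(7)[OF j] by simp
  then show ?thesis using S2_rows_covered[of j s] j S2_facts(1)[OF j] False assms(4) by simp
qed

text \<open>If both quadrants met the support, row \<open>t\<close> would lie between two rows of
  blocks, hence in a block, and the monotone column limits would put \<open>c\<close> inside its
  window.\<close>

lemma qsupp_stair:
  assumes "\<not> qsupp t c"
  shows "(\<forall>t' c'. t \<le> t' \<longrightarrow> c' \<le> c \<longrightarrow> \<not> qsupp t' c') \<or> (\<forall>t' c'. t' \<le> t \<longrightarrow> c \<le> c' \<longrightarrow> \<not> qsupp t' c')"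
proof (rule ccontr)
  assume "\<not> ?thesis"
  then obtain t1 c1 t2 c2 where *: "t \<le> t1" "c1 \<le> c" "qsupp t1 c1" "t2 \<le> t" "c \<le> c2" "qsupp t2 c2" by blast
  obtain i where i: "in_block i t1" "mat_col i \<le> c1" using *(3) by (auto simp: qsupp_def)
  obtain j where j: "in_block j t2" "c2 < mat_col j + n j" using *(6) by (auto simp: qsupp_def)
  obtain l where l: "in_block l t" using rows_between_covered[OF j(1) i(1) *(4,1)] by blast
  have "mat_col l \<le> c" using block_cols_mono[OF l i(1) *(1)] i(2) *(2) by linarith
  moreover have "c < mat_col l + n l" using block_cols_mono[OF j(1) l *(4)] j(2) *(5) by linarith
  ultimately have "qsupp t c" using l by (auto simp: qsupp_def)
  then show False using assms by contradiction
qed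

lemma var_greater_iff:
  assumes "qsupp t c" "qsupp t' c'"
  shows "var_greater S1 S2 (qvar_at t c) (qvar_at t' c') \<longleftrightarrow> t < t' \<or> t = t' \<and> c < c'"
proof -
  obtain i where i: "in_block i t" "mat_col i \<le> c" using assms(1) by (auto simp: qsupp_def)
  obtain j where j: "in_block j t'" "mat_col j \<le> c'" using assms(2) by (auto simp: qsupp_def)
  have irr: "\<not> block_greater S1 S2 i i"
    using block_greater_bounds[of i i] i(1) by (auto simp: in_block_def)
  have top: "blk_top i \<le> t" "blk_top j \<le> t'" using i j by (auto simp: in_block_def)
  show ?thesis
    unfolding qvar_at_eq[OF i(1)] qvar_at_eq[OF j(1)] var_greater_def prod.case
    using block_order[OF i(1) j(1)]
  proof (elim disjE conjE)
    assume e: "i = j"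
    show "(block_greater S1 S2 i j \<or> i = j \<and> (t - blk_top i < t' - blk_top j \<or>
        t - blk_top i = t' - blk_top j \<and> c - mat_col i < c' - mat_col j)) = (t < t' \<or> t = t' \<and> c < c')"
      using irr top i(2) j(2) unfolding e by auto
  qed (use irr in auto)
qed

definition shapes where
  "shapes = (\<lambda>i. (mat_row i, mat_row i + k i)) ` {1..\<rho>}"

lemma mat_row_add: "i \<in> {1..\<rho>} \<Longrightarrow> mat_row i + k i = (if i \<in> S1 then R0 + k 1 else R0 + k i)"
  using k_le_R0[of i] by (auto simp: mat_row_def)

text \<open>\<open>R0\<close> is the first row of the matrix of vertex 1. Intervals from
  \<open>S1\<close> start at or before it and all end at \<open>R0 + k 1\<close>; the others all
  start at it and end at \<open>R0 + k 1\<close> or later. This gives the common row and the chain.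
  The column indices are below \<open>C0 + n 1\<close> for \<open>S1\<close> and below
  \<open>C0 + C0\<close> otherwise, which explains the bound.\<close>

sublocale staircase_shapes qsupp qvar_at "var_greater S1 S2" shapes R0 "C0 + n 1 + C0"
proof
  fix t c t' c'
  show "\<not> qsupp t c \<Longrightarrow> (\<forall>t' c'. t \<le> t' \<longrightarrow> c' \<le> c \<longrightarrow> \<not> qsupp t' c') \<or> (\<forall>t' c'. t' \<le> t \<longrightarrow> c \<le> c' \<longrightarrow> \<not> qsupp t' c')"
    by (rule qsupp_stair)
  show "qsupp t c \<Longrightarrow> qsupp t' c' \<Longrightarrow> var_greater S1 S2 (qvar_at t c) (qvar_at t' c') \<longleftrightarrow> t < t' \<or> t = t' \<and> c < c'"
    by (rule var_greater_iff)
next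
  fix u w assume "(u, w) \<in> shapes"
  then obtain i where i: "i \<in> {1..\<rho>}" "u = mat_row i" "w = mat_row i + k i" by (auto simp: shapes_def)
  have "mat_row i \<le> R0" using S1_facts[of i] by (auto simp: mat_row_def)
  moreover have "0 < k i" "0 < k 1" using corank_pos i(1) by auto
  ultimately show "u \<le> R0 \<and> R0 < w" using mat_row_add[OF i(1)] i by auto
next
  fix u w u' w' assume "(u, w) \<in> shapes" "(u', w') \<in> shapes"
  then obtain i j where i: "i \<in> {1..\<rho>}" "u = mat_row i" "w = mat_row i + k i"
    and j: "j \<in> {1..\<rho>}" "u' = mat_row j" "w' = mat_row j + k j" by (auto simp: shapes_def)
  have le: "mat_row l \<le> R0" if "l \<in> {1..\<rho>}" for l using S1_facts[of l] by (auto simp: mat_row_def)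
  have ge: "k 1 \<le> k l" if "l \<in> {1..\<rho>}" for l
    using that
  proof (cases rule: vertex_cases)
    case 2
    then show ?thesis using S1_facts(3,4)[of l] by linarith
  next
    case 3
    then show ?thesis using S2_facts(3,4)[of l] by linarith
  qed simp
  show "u \<le> u' \<and> w \<le> w' \<or> u' \<le> u \<and> w' \<le> w"
    unfolding i j mat_row_add[OF i(1)] mat_row_add[OF j(1)]
    using le[OF i(1)] le[OF j(1)] ge[OF i(1)] ge[OF j(1)]
    by (cases "i \<in> S1"; cases "j \<in> S1") (auto simp: mat_row_def)
qed

end

section \<open>The quiver matrices inside the staircase\<close>

lemma finite_minors: "finite (minors m A)"
proof -
  have "minors m A \<subseteq> (\<lambda>(I, J). det (submatrix A I J)) ` (Pow {..<dim_row A} \<times> Pow {..<dim_col A})"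
    unfolding minors_def by auto
  then show ?thesis by (rule finite_subset) simp
qed

lemma append_cols_carrier:
  assumes "A \<in> carrier_mat nr nc1" "B \<in> carrier_mat nr nc2"
  shows "append_cols A B \<in> carrier_mat nr (nc1 + nc2)"
  using carrier_matD[OF assms(1)] carrier_matD[OF assms(2)]
  by (intro carrier_matI) (simp_all add: append_cols_def)

lemma index_append_cols:
  assumes "A \<in> carrier_mat nr nc1" "B \<in> carrier_mat nr nc2" "a < nr" "b < nc1 + nc2"
  shows "append_cols A B $$ (a, b) = (if b < nc1 then A $$ (a, b) else B $$ (a, b - nc1))"
  using carrier_matD[OF assms(1)] carrier_matD[OF assms(2)] assms(3,4)
  by (simp add: append_cols_def)

lemma index_append_rows:
  assumes "A \<in> carrier_mat nr1 nc" "B \<in> carrier_mat nr2 nc" "a < nr1 + nr2" "b < nc"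
  shows "(A @\<^sub>r B) $$ (a, b) = (if a < nr1 then A $$ (a, b) else B $$ (a - nr1, b))"
  using carrier_matD[OF assms(1)] carrier_matD[OF assms(2)] assms(3,4)
  by (simp add: append_rows_def)

lemma var_mat_carrier: "var_mat i nr nc \<in> carrier_mat nr nc"
  by (simp add: var_mat_def)

lemma index_var_mat: "a < nr \<Longrightarrow> b < nc \<Longrightarrow> var_mat i nr nc $$ (a, b) = poly_var (i, a, b)"
  by (simp add: var_mat_def)

context Y_quiver
begin

lemma M_in_block:
  assumes "in_block i t" "b < n i"
  shows "M t (mat_col i + b) = poly_var (i, t - blk_top i, b)"
proof -
  have "qsupp t (mat_col i + b)" using assms by (auto simp: qsupp_def)
  then show ?thesis by (simp add: M_def qvar_at_eq[OF assms(1)])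
qed

text \<open>The rows of a matrix from \<open>S1\<close> meet only blocks with the same right limit,
  among which the block of \<open>i\<close> starts furthest to the left; for \<open>S2\<close> left
  and right change roles. This accounts for the zero blocks and confines the columns of nonzero
  minors.\<close>

lemma matrix_support:
  assumes i: "i \<in> {1..\<rho>}" and t: "mat_row i \<le> t" "t < mat_row i + k i" and c: "qsupp t c"
  shows "mat_col i \<le> c \<and> c < mat_col i + n i"
proof -
  obtain j where j: "in_block j t" "mat_col j \<le> c" "c < mat_col j + n j" using c by (auto simp: qsupp_def)
  have jv: "j \<in> {1..\<rho>}" "blk_top j \<le> t" "t < blk_bot j" using j(1) by (auto simp: in_block_def)
  note total = block_greater_total[OF i jv(1)]
  show ?thesis using i
  proof (cases rule: vertex_cases)
    case 1
    then have "R0 \<le> t" "t < R0 + k 1" using t one_notin by (auto simp: mat_row_def)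
    then have "j \<notin> S1" "j \<notin> S2" using in_block_bounds(1,3)[OF j(1)] by fastforce+
    with jv(1) have "j = 1" by (cases rule: vertex_cases) auto
    then show ?thesis using 1 j by simp
  next
    case 2
    have "t < R0 + k 1" using t mat_row_add[OF i] 2 by simp
    then have "j \<notin> S2" using in_block_bounds(3)[OF j(1)] by fastforce
    with jv(1) have "mat_col j + n j = C0 + n 1"
      by (cases rule: vertex_cases) (use S1_facts(8)[of j] one_notin in \<open>auto simp: mat_col_def\<close>)
    moreover have "mat_col i + n i = C0 + n 1" using S1_facts(8)[OF 2] 2 by (simp add: mat_col_def)
    moreover have "mat_col i \<le> mat_col j"
    proof (cases "i = j")
      case False
      have "blk_top i = mat_row i" using 2 by (simp add: blk_top_def mat_row_def)
      then have "\<not> block_greater S1 S2 j i" using block_greater_bounds[of j i] t jv by linarith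
      then show ?thesis using total False block_greater_bounds[of i j] by blast
    qed simp
    ultimately show ?thesis using j by simp
  next
    case 3
    have nS1: "i \<notin> S1" by (rule S2_facts(7)[OF 3])
    then have "R0 \<le> t" "t < R0 + k i" using t by (auto simp: mat_row_def)
    then have "j \<notin> S1" using in_block_bounds(1)[OF j(1)] by fastforce
    then have "mat_col j = mat_col i" using nS1 by (simp add: mat_col_def)
    moreover have "mat_col j + n j \<le> mat_col i + n i"
    proof (cases "i = j")
      case False
      have "blk_bot i = R0 + k i" using nS1 by (simp add: blk_bot_def)
      then have "\<not> block_greater S1 S2 i j" using block_greater_bounds[of i j] \<open>t < R0 + k i\<close> jv by linarith
      then show ?thesis using total False block_greater_bounds[of j i] by blast
    qed simp
    ultimately show ?thesis using j by simp
  qed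
qed

lemma M_outside:
  assumes "i \<in> {1..\<rho>}" "mat_row i \<le> t" "t < mat_row i + k i" "c < mat_col i \<or> mat_col i + n i \<le> c"
  shows "M t c = 0"
  using matrix_support[OF assms(1-3), of c] assms(4) by (auto simp: M_def)

text \<open>Induction along parents. The new rows form the block of \<open>i\<close>, the matrix of
  the parent already sits at its own offsets, and the zero block is the part of its rows outside its
  columns, which vanishes by \<open>M_outside\<close>.\<close>

lemma quiver_matrix_entries:
  assumes "i \<in> {1..\<rho>}"
  shows "quiver_matrix Q r S1 i \<in> carrier_mat (k i) (n i) \<and>
    (\<forall>a<k i. \<forall>b<n i. quiver_matrix Q r S1 i $$ (a, b) = M (mat_row i + a) (mat_col i + b))"
  using assms
proof (induction i rule: less_induct)
  case (less i)
  show ?case using less.prems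
  proof (cases rule: vertex_cases)
    case 1
    have eq: "quiver_matrix Q r S1 i = var_mat 1 (k 1) (n 1)" unfolding 1 by (subst quiver_matrix.simps) simp
    have "M (mat_row 1 + a) (mat_col 1 + b) = poly_var (1, a, b)" if "a < k 1" "b < n 1" for a b
    proof -
      have "in_block 1 (mat_row 1 + a)"
        using that less.prems 1 one_notin by (auto simp: in_block_def mat_row_def blk_top_def blk_bot_def)
      then show ?thesis using M_in_block[of 1 "mat_row 1 + a" b] that one_notin
        by (simp add: mat_row_def blk_top_def)
    qed
    then show ?thesis unfolding eq by (auto simp: var_mat_def 1)
  next
    case 2
    note f = S1_facts[OF 2]
    have p: "pa i \<in> {1..\<rho>}" "pa i < i" using parent_bounds[OF f(1)] f(1) by auto
    let ?A = "quiver_matrix Q r S1 (pa i)" and ?X = "var_mat i (in_rank Q r i - r i) (n i)"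
      and ?Z = "0\<^sub>m (k (pa i)) (num_arrows Q 0 i) :: qvar cpoly mat"
    let ?d = "in_rank Q r i - r i"
    have A: "?A \<in> carrier_mat (k (pa i)) (n (pa i))"
      "\<And>a b. a < k (pa i) \<Longrightarrow> b < n (pa i) \<Longrightarrow> ?A $$ (a, b) = M (mat_row (pa i) + a) (mat_col (pa i) + b)"
      using less.IH[OF p(2,1)] by auto
    have eq: "quiver_matrix Q r S1 i = ?X @\<^sub>r append_cols ?Z ?A"
      using 2 p by (subst quiver_matrix.simps) (simp add: Let_def)
    have ki: "k i = k (pa i) + ?d" by (rule corank_rec(1)[OF f(1)])
    have ni: "n i = n (pa i) + num_arrows Q 0 i" by (rule num_paths_rec[OF f(1)])
    have prow: "mat_row (pa i) = mat_row i + ?d" "mat_row (pa i) + k (pa i) = R0 + k 1"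
      using f ki one_notin 2 k_le_R0[OF p(1)] by (auto simp: mat_row_def)
    have pcol: "mat_col (pa i) = mat_col i + num_arrows Q 0 i"
      using f ni one_notin 2 n_le_C0[OF p(1)] by (auto simp: mat_col_def)
    have X: "M (mat_row i + a) (mat_col i + b) = poly_var (i, a, b)" if "a < ?d" "b < n i" for a b
    proof -
      have "in_block i (mat_row i + a)"
        using that less.prems f ki 2 by (auto simp: in_block_def mat_row_def blk_top_def blk_bot_def)
      then show ?thesis using M_in_block[of i "mat_row i + a" b] that 2
        by (simp add: mat_row_def blk_top_def)
    qed
    have Y: "M (mat_row i + a) (mat_col i + b) = (if b < num_arrows Q 0 i then 0 else ?A $$ (a - ?d, b - num_arrows Q 0 i))"
      if "\<not> a < ?d" "a < k i" "b < n i" for a b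
    proof (cases "b < num_arrows Q 0 i")
      case True
      then show ?thesis using M_outside[OF p(1), of "mat_row i + a" "mat_col i + b"] that prow(1) pcol ki by simp
    next
      case False
      then show ?thesis using A(2)[of "a - ?d" "b - num_arrows Q 0 i"] that prow(1) pcol ki ni by simp
    qed
    show ?thesis unfolding eq
    proof (intro conjI allI impI)
      note Z = zero_carrier_mat[of "k (pa i)" "num_arrows Q 0 i"]
      note ZA = append_cols_carrier[OF Z A(1)]
      have dims: "?d + k (pa i) = k i" "num_arrows Q 0 i + n (pa i) = n i" using ki ni by simp_all
      show "?X @\<^sub>r append_cols ?Z ?A \<in> carrier_mat (k i) (n i)"
        using carrier_append_rows[OF var_mat_carrier ZA[unfolded dims], of i ?d] unfolding dims .
      fix a b assume ab: "a < k i" "b < n i"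
      have "(?X @\<^sub>r append_cols ?Z ?A) $$ (a, b) = (if a < ?d then ?X $$ (a, b) else append_cols ?Z ?A $$ (a - ?d, b))"
        by (rule index_append_rows[OF var_mat_carrier ZA[unfolded dims]]) (use ab dims in simp_all)
      also have "\<dots> = M (mat_row i + a) (mat_col i + b)"
      proof (cases "a < ?d")
        case True
        then show ?thesis using X[OF True ab(2)] index_var_mat[OF True ab(2)] by simp
      next
        case False
        then have lt: "a - ?d < k (pa i)" "b < num_arrows Q 0 i + n (pa i)" using ab dims by simp_all
        show ?thesis using Y[OF False ab] index_append_cols[OF Z A(1) lt] False lt by simp
      qed
      finally show "(?X @\<^sub>r append_cols ?Z ?A) $$ (a, b) = M (mat_row i + a) (mat_col i + b)" .
    qed
  next
    case 3
    note f = S2_facts[OF 3]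
    have p: "pa i \<in> {1..\<rho>}" "pa i < i" using parent_bounds[OF f(1)] f(1) by auto
    have pS1: "pa i \<notin> S1" using f(2) one_notin S2_facts(7)[of "pa i"] by auto
    let ?A = "quiver_matrix Q r S1 (pa i)" and ?X = "var_mat i (in_rank Q r i - r i) (n i)"
      and ?Z = "0\<^sub>m (k (pa i)) (num_arrows Q 0 i) :: qvar cpoly mat"
    let ?d = "in_rank Q r i - r i"
    have A: "?A \<in> carrier_mat (k (pa i)) (n (pa i))"
      "\<And>a b. a < k (pa i) \<Longrightarrow> b < n (pa i) \<Longrightarrow> ?A $$ (a, b) = M (mat_row (pa i) + a) (mat_col (pa i) + b)"
      using less.IH[OF p(2,1)] by auto
    have eq: "quiver_matrix Q r S1 i = append_cols ?A ?Z @\<^sub>r ?X"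
      using f p by (subst quiver_matrix.simps) (simp add: Let_def)
    have ki: "k i = k (pa i) + ?d" by (rule corank_rec(1)[OF f(1)])
    have ni: "n i = n (pa i) + num_arrows Q 0 i" by (rule num_paths_rec[OF f(1)])
    have rows: "mat_row i = R0" "mat_row (pa i) = R0" "mat_col i = C0" "mat_col (pa i) = C0"
      using f pS1 by (simp_all add: mat_row_def mat_col_def)
    have X: "M (mat_row i + a) (mat_col i + b) = poly_var (i, a - k (pa i), b)" if "\<not> a < k (pa i)" "a < k i" "b < n i" for a b
    proof -
      have "in_block i (mat_row i + a)"
        using that less.prems f rows by (auto simp: in_block_def blk_top_def blk_bot_def)
      then show ?thesis using M_in_block[of i "mat_row i + a" b] that f rows
        by (simp add: blk_top_def)
    qed
    have Y: "M (mat_row i + a) (mat_col i + b) = (if b < n (pa i) then ?A $$ (a, b) else 0)"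
      if "a < k (pa i)" "b < n i" for a b
    proof (cases "b < n (pa i)")
      case True
      then show ?thesis using A(2)[of a b] that rows by simp
    next
      case False
      then show ?thesis using M_outside[OF p(1), of "mat_row i + a" "mat_col i + b"] that rows by simp
    qed
    show ?thesis unfolding eq
    proof (intro conjI allI impI)
      note Z = zero_carrier_mat[of "k (pa i)" "num_arrows Q 0 i"]
      note AZ = append_cols_carrier[OF A(1) Z]
      have dims: "k (pa i) + ?d = k i" "n (pa i) + num_arrows Q 0 i = n i" using ki ni by simp_all
      show "append_cols ?A ?Z @\<^sub>r ?X \<in> carrier_mat (k i) (n i)"
        using carrier_append_rows[OF AZ[unfolded dims] var_mat_carrier, of i ?d] unfolding dims .
      fix a b assume ab: "a < k i" "b < n i"
      have "(append_cols ?A ?Z @\<^sub>r ?X) $$ (a, b) =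
          (if a < k (pa i) then append_cols ?A ?Z $$ (a, b) else ?X $$ (a - k (pa i), b))"
        by (rule index_append_rows[OF AZ[unfolded dims] var_mat_carrier]) (use ab dims in simp_all)
      also have "\<dots> = M (mat_row i + a) (mat_col i + b)"
      proof (cases "a < k (pa i)")
        case True
        have lt: "b < n (pa i) + num_arrows Q 0 i" using ab dims by simp
        have "b - n (pa i) < num_arrows Q 0 i" if "\<not> b < n (pa i)" using that lt by simp
        then show ?thesis using Y[OF True ab(2)] index_append_cols[OF A(1) Z True lt] True by simp
      next
        case False
        then have lt: "a - k (pa i) < ?d" using ab dims by simp
        show ?thesis using X[OF False ab] index_var_mat[OF lt ab(2)] False by simp
      qed
      finally show "(append_cols ?A ?Z @\<^sub>r ?X) $$ (a, b) = M (mat_row i + a) (mat_col i + b)" .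
    qed
  qed
qed

lemma minor_eq_tminor:
  assumes i: "i \<in> {1..\<rho>}" and J: "J \<subseteq> {..<n i}" "card J = k i"
  shows "det (submatrix (quiver_matrix Q r S1 i) {..<k i} J) =
    tminor (mat_row i, mat_row i + k i, \<lambda>t. mat_col i + pick J (t - mat_row i))"
  unfolding tminor.simps
  by (rule det_submatrix_eq_interval_minor[of _ "k i" "n i"]) (use quiver_matrix_entries[OF i] J in auto)

lemma quiver_minors_subset: "quiver_minors Q \<rho> r S1 \<subseteq> minor_set \<union> {0}"
proof
  fix f assume "f \<in> quiver_minors Q \<rho> r S1"
  then obtain i I J where i: "i \<in> {1..\<rho>}" and f: "f = det (submatrix (quiver_matrix Q r S1 i) I J)"
    and IJ: "I \<subseteq> {..<k i}" "card I = k i" "J \<subseteq> {..<n i}" "card J = k i"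
    using quiver_matrix_entries by (fastforce simp: quiver_minors_def minors_def)
  \<comment> \<open>The matrix has exactly \<open>k i\<close> rows, so a maximal minor uses all of
    them.\<close>
  have I: "I = {..<k i}" using IJ(1,2) by (intro card_subset_eq) auto
  let ?c = "\<lambda>t. mat_col i + pick J (t - mat_row i)"
  have pJ: "pick J (t - mat_row i) < n i" if "t < mat_row i + k i" "mat_row i \<le> t" for t
  proof -
    have "pick J (t - mat_row i) \<in> J" using that IJ(4) by (intro pick_in_set) auto
    then show ?thesis using IJ(3) by blast
  qed
  have bound: "mat_col i + n i \<le> C0 + n 1 + C0"
    using n_le_C0[OF i] by (auto simp: mat_col_def)
  have "admissible (mat_row i, mat_row i + k i, ?c)"
    unfolding admissible.simps
  proof (intro conjI ballI)
    show "(mat_row i, mat_row i + k i) \<in> shapes" unfolding shapes_def using i by (rule imageI)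
    show "?c t < C0 + n 1 + C0" if "t \<in> {mat_row i..<mat_row i + k i}" for t
      using pJ[of t] that bound by simp
  qed
  moreover have "increasing (mat_row i, mat_row i + k i, ?c)"
    unfolding increasing.simps
  proof (rule strict_mono_onI)
    fix s t assume st: "s \<in> {mat_row i..<mat_row i + k i}" "t \<in> {mat_row i..<mat_row i + k i}" "s < t"
    then have "t - mat_row i < card J" "s - mat_row i < t - mat_row i" using IJ(4) by auto
    then have "pick J (s - mat_row i) < pick J (t - mat_row i)" by (intro pick_mono disjI1)
    then show "?c s < ?c t" by simp
  qed
  ultimately show "f \<in> minor_set \<union> {0}"
    using minor_eq_tminor[OF i IJ(3,4)] unfolding f I minor_set_def by blast
qed

lemma minor_set_subset: "minor_set \<subseteq> quiver_minors Q \<rho> r S1 \<union> {0}"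
proof
  fix f assume "f \<in> minor_set"
  then obtain x where x: "f = tminor x" "admissible x" "increasing x" unfolding minor_set_def by blast
  obtain u w c where xe: "x = (u, w, c)" by (cases x)
  have f: "f = interval_minor M u w c" "(u, w) \<in> shapes" "strict_mono_on {u..<w} c"
    using x unfolding xe tminor.simps admissible.simps increasing.simps by blast+
  obtain i where i: "i \<in> {1..\<rho>}" "u = mat_row i" "w = mat_row i + k i" using f(2) by (auto simp: shapes_def)
  show "f \<in> quiver_minors Q \<rho> r S1 \<union> {0}"
  proof (cases "f = 0")
    case False
    \<comment> \<open>The columns of an admissible triple may leave the matrix. A nonzero minor has
      its diagonal in the support, and then \<open>matrix_support\<close> bounds its
      columns.\<close>
    then have "qsupp t (c t)" if "t \<in> {u..<w}" for t using minor_eq_0[OF f(3) that] f(1) by blast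
    then have range: "mat_col i \<le> c t \<and> c t < mat_col i + n i" if "t \<in> {u..<w}" for t
      using matrix_support[OF i(1), of t "c t"] that i by simp
    define e where "e t = c t - mat_col i" for t
    define J where "J = e ` {u..<w}"
    have mono: "e s < e t \<longleftrightarrow> s < t" if "s \<in> {u..<w}" "t \<in> {u..<w}" for s t
      using range[OF that(1)] range[OF that(2)] strict_mono_on_less[OF f(3) that] by (auto simp: e_def)
    have inj: "inj_on e {u..<w}" by (rule inj_onI) (metis mono linorder_neq_iff)
    have "e t < n i" if "t \<in> {u..<w}" for t using range[OF that] unfolding e_def by linarith
    then have J: "J \<subseteq> {..<n i}" "card J = k i"
      using card_image[OF inj] i(2,3) by (auto simp: J_def)
    \<comment> \<open>\<open>e\<close> is increasing with image \<open>J\<close>, so exactly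
      \<open>t - u\<close> elements of \<open>J\<close> precede \<open>e t\<close>;
      \<open>pick\<close> counts from 0.\<close>
    have pick: "pick J (t - u) = e t" if "t \<in> {u..<w}" for t
    proof -
      have "{a \<in> J. a < e t} = e ` {u..<t}" using mono that unfolding J_def by fastforce
      moreover have "inj_on e {u..<t}" by (rule inj_on_subset[OF inj]) (use that in auto)
      ultimately have "card {a \<in> J. a < e t} = t - u" by (simp add: card_image)
      then show ?thesis using pick_card_in_set[of "e t" J] that by (auto simp: J_def)
    qed
    have "f = tminor (mat_row i, mat_row i + k i, \<lambda>t. mat_col i + pick J (t - mat_row i))"
      unfolding f(1) i(2,3) tminor.simps
    proof (rule interval_minor_cong)
      fix t assume "mat_row i \<le> t" "t < mat_row i + k i"
      then have t: "t \<in> {u..<w}" using i by simp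
      then show "c t = mat_col i + pick J (t - mat_row i)"
        using pick[OF t] range[OF t] i(2) by (simp add: e_def)
    qed
    then have "f = det (submatrix (quiver_matrix Q r S1 i) {..<k i} J)" using minor_eq_tminor[OF i(1) J] by simp
    moreover have "dim_row (quiver_matrix Q r S1 i) = k i" "dim_col (quiver_matrix Q r S1 i) = n i"
      using quiver_matrix_entries[OF i(1)] by auto
    ultimately have "f \<in> minors (k i) (quiver_matrix Q r S1 i)"
      using J unfolding minors_def by (intro CollectI exI[of _ "{..<k i}"] exI[of _ J]) simp
    then show ?thesis using i(1) by (auto simp: quiver_minors_def)
  qed simp
qed

end

theorem theorem1p1:
  fixes Q :: "(nat, 'a) pre_digraph" and \<rho> :: nat and r :: "nat \<Rightarrow> nat"
    and S1 S2 :: "nat set"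
  assumes "Y_shaped Q \<rho> r"
    and "branches Q \<rho> S1 S2"
  shows "is_SAGBI_basis (lex_greater (var_greater S1 S2))
           (quiver_Pluecker_algebra Q \<rho> r S1) (quiver_minors Q \<rho> r S1)"
proof -
  interpret Y_quiver Q \<rho> r S1 S2 by unfold_locales fact+
  have "finite (quiver_minors Q \<rho> r S1)" by (simp add: quiver_minors_def finite_minors)
  then show ?thesis
    unfolding quiver_Pluecker_algebra_def
    by (rule minors_SAGBI[OF _ quiver_minors_subset minor_set_subset])
qed

end
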